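(* Let $\eta\in(0,1]$, $q\in(0,1)$ and $\theta\in(0,+\infty)$, let $\mu=\eta/q$, and let $(a_n,n\in\mathbb{N}^* )$ be a sequence of elements of $\mathbb{N}^*$. For $n\ge1$ let $\tau_n$ be a random tree distributed as the Galton-Watson tree $\tau$ with offspring distribution $\mathcal{G}(\eta,q)$ conditionally on $\{Z_n=a_n\}$. Assume that $\lim_{n\to\infty}a_n\mu^n=\theta$ if $\mu<1$, or $\lim_{n\to\infty}a_nn^{-2}=\theta$ if $\mu=1$, or $\lim_{n\to\infty}a_n\mu^{-n}=\theta$ if $\mu>1$. Then $\tau_n$ converges in distribution to $\tau^\theta$ as $n\to\infty$.
   Context: Notation: $\mathbb{N}=\{0,1,2,\ldots\}$, $\mathbb{N}^*=\{1,2,\ldots\}$, $\bar{\mathbb{N}}=\mathbb{N}\cup\{+\infty\}$, $x\vee y=\max(x,y)$, and $0^0=1$. Trees. Let $\mathcal{U}=\bigcup_{n\ge0}(\mathbb{N}^* )^n$ be the set of finite words, with $(\mathbb{N}^* )^0=\{\emptyset\}$; $|u|$ is the length of $u$. A tree is a subset $\mathbf{t}\subset\mathcal{U}$ containing $\emptyset$ (the root), containing with each $u$ all its prefixes (ancestors), and such that for every $u\in\mathbf{t}$ there is $k_u(\mathbf{t})\in\bar{\mathbb{N}}$ (the number of children of $u$) with $ui\in\mathbf{t}\iff 1\le i\le k_u(\mathbf{t})$ for every $i\in\mathbb{N}^*$. Put $k_u(\mathbf{t})=-1$ if $u\notin\mathbf{t}$. $\mathbb{T}_\infty$ is the set of all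 trees, with the topology in which $\mathbf{t}_n\to\mathbf{t}$ iff $k_u(\mathbf{t}_n)\to k_u(\mathbf{t})$ for all $u\in\mathcal{U}$, where $\{-1\}\cup\bar{\mathbb{N}}$ is the one-point compactification of the discrete space $\{-1\}\cup\mathbb{N}$. Convergence in distribution of random trees is weak convergence in $\mathbb{T}_\infty$. $\mathbb{T}_{\rm f}$ is the set of trees with all $k_u(\mathbf{t})<\infty$, $u\in\mathbf{t}$. The height is $H(\mathbf{t})=\sup\{|u|:u\in\mathbf{t}\}$, $z_n(\mathbf{t})=\#\{u\in\mathbf{t}:|u|=n\}$, and $r_h(\mathbf{t})=\{u\in\mathbf{t}:|u|\le h\}$. Offspring distribution. $\mathcal{G}(\eta,q)$ is the distribution $p$ on $\mathbb{N}$ with $p(0)=1-\eta$ and $p(k)=\eta q(1-q)^{k-1}$ for $k\ge1$. Its mean is $\mu=\eta/q$. Put $\gamma=\frac1{1-q}$ and $\kappa=\frac{1-\eta}{1-q}$. Galton-Watson tree. $\tau$ is a $\mathbb{T}_{\rm f}$-valued random variable with $\mathbb{P}(r_h(\tau)=\mathbf{t})=\prod_{u\in r_{h-1}(\mathbf{t})}p(k_u(\mathbf{t}))$ for all $h\ge1$ and $\mathbf{t}\in\mathbb{T}_{\rm f}$ with $H(\mathbf{t})\le h$; $Z_n=z_n(\tau)$. The distribution $\mathfrak{p}$. Let $\mathfrak{p}=p$ if $\mu\le1$; if $\mu>1$ let $\mathfrak{p}=\mathcal{G}(q,\eta)$, i.e. $\mathfrak{p}(0)=1-q$ and $\mathfrak{p}(k)=q\eta(1-\eta)^{k-1}$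 for $k\ge1$ (equivalently $\mathfrak{p}(n)=\mathfrak{c}^{n-1}p(n)$ with $\mathfrak{c}=\min(1,\kappa)$ when $\mathfrak{c}>0$). For $s\ge1$ its $s$-th order size-biased distribution is $\mathfrak{p}_{[s]}(n)=\binom{n}{s}(q\vee\eta)^{s+1}(1-(q\vee\eta))^{n-s}$, $n\ge s$. The random tree $\tau^\theta$. It is obtained by forgetting the types in a random tree whose vertices have type $\mathrm{s}$ or $\mathrm{e}$, where $\mathcal{S}_h$ denotes the set of vertices of type $\mathrm{s}$ at level $h$, defined generation by generation as follows. (i) The root has type $\mathrm{s}$: $\mathcal{S}_0=\{\emptyset\}$. (ii) The vertices of type $\mathrm{e}$ reproduce independently of each other and of everything else at lower or same height; a vertex of type $\mathrm{e}$ has only children of type $\mathrm{e}$, their number having distribution $\mathfrak{p}$. (iii) For $h\ge0$, conditionally on $r_h(\tau^\theta)$ and $(\mathcal{S}_\ell,0\le\ell\le h)$, the increment $\Delta_h=\#\mathcal{S}_{h+1}-\#\mathcal{S}_h$ is Poisson with mean $\theta\zeta_h$, where $$\zeta_h=\begin{cases}\mu^{-h-1}(1-\mu)(\kappa-1)/\kappa&\text{if }\mu<1,\\ \gamma-1&\text{if }\mu=1,\\ \mu^h(\mu-1)(1-\kappa)&\text{if }\mu>1.\end{cases}$$ Each $u\in\mathcal{S}_h$ has $\kappa^{\mathrm{s}}(u)\ge1$ children of type $\mathrm{s}$; given $\#\mathcal{S}_{h+1}$, all configurations $(\kappa^{\mathrm{s}}(u),u\in\mathcal{S}_h)$ of integers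 $\ge1$ with sum $\#\mathcal{S}_{h+1}$ are equally likely, each having probability $1/\binom{\#\mathcal{S}_{h+1}-1}{\#\mathcal{S}_h-1}$. Conditionally on $r_h(\tau^\theta)$, $\mathcal{S}_h$ and $(\kappa^{\mathrm{s}}(v)=s_v,v\in\mathcal{S}_h)$, independently for each $u\in\mathcal{S}_h$, the total number of children $k_u(\tau^\theta)$ has distribution $\mathfrak{p}_{[s_u]}$, and the $s_u$ children of type $\mathrm{s}$ are chosen uniformly at random among the $k_u(\tau^\theta)$ children, the others being of type $\mathrm{e}$. *)

theory Defs
  imports "HOL-Probability.Probability" "HOL-Library.Sublist" "HOL-Library.Extended_Nat"
begin
type_synonym word = "nat list"

definition words :: "word set" where
  "words = lists {1..}"

definition all_trees :: "word set set" where
  "all_trees = {t. t \<subseteq> words \<and> [] \<in> t \<and> (\<forall>u\<in>t. \<forall>v. prefix v u \<longrightarrow> v \<in> t) \<and>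
     (\<forall>u\<in>t. \<exists>k::enat. \<forall>i\<ge>1. u @ [i] \<in> t \<longleftrightarrow> enat i \<le> k)}"

text \<open>
  The number of children takes its values in \<open>{-1, 0, 1, \<dots>} \<union> {\<infinity>}\<close>. It is an \<^typ>\<open>int option\<close>,
  with \<open>None\<close> for \<open>\<infinity>\<close>, because this is the carrier of the library's one-point compactification.
\<close>

definition num_children :: "word \<Rightarrow> word set \<Rightarrow> int option" where
  "num_children u t =
     (if u \<in> t then
        (case (THE k::enat. \<forall>i\<ge>1. u @ [i] \<in> t \<longleftrightarrow> enat i \<le> k) of enat n \<Rightarrow> Some (int n) | \<infinity> \<Rightarrow> None)
      else Some (-1))"

lemma enat_cut_unique:
  fixes k l :: enat
  assumes "\<And>i. i \<ge> 1 \<Longrightarrow> enat i \<le> k \<longleftrightarrow> enat i \<le> l"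
  shows "k = l"
proof -
  have aux: "m \<le> n" if "\<And>i. i \<ge> 1 \<Longrightarrow> enat i \<le> m \<Longrightarrow> enat i \<le> n" for m n :: enat
  proof (rule ccontr)
    assume "\<not> m \<le> n"
    then obtain a where a: "n = enat a" "enat a < m"
      by (cases n) auto
    then have "enat (Suc a) \<le> m"
      by (simp add: Suc_ile_eq)
    then show False
      using that[of "Suc a"] a by simp
  qed
  show ?thesis
    using aux[of k l] aux[of l k] assms by (simp add: antisym)
qed

lemma child_iff_num_children:
  assumes "t \<in> all_trees" "u \<in> t" "i \<ge> 1"
  shows "u @ [i] \<in> t \<longleftrightarrow> (case num_children u t of None \<Rightarrow> True | Some m \<Rightarrow> int i \<le> m)"
proof -
  obtain k :: enat where k: "\<forall>i\<ge>1. u @ [i] \<in> t \<longleftrightarrow> enat i \<le> k"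
    using assms unfolding all_trees_def by blast
  have "(THE k::enat. \<forall>i\<ge>1. u @ [i] \<in> t \<longleftrightarrow> enat i \<le> k) = k"
    using k by (intro the_equality enat_cut_unique) auto
  then have "num_children u t = (case k of enat n \<Rightarrow> Some (int n) | \<infinity> \<Rightarrow> None)"
    unfolding num_children_def by (simp only: assms(2) if_True)
  moreover have "u @ [i] \<in> t \<longleftrightarrow> enat i \<le> k"
    using k assms(3) by blast
  ultimately show ?thesis
    by (cases k) simp_all
qed

lemma num_children_ge: "num_children u t = Some m \<Longrightarrow> m \<ge> -1"
  by (auto simp: num_children_def split: if_splits enat.splits)

definition locally_finite_trees :: "word set set" where
  "locally_finite_trees = {t \<in> all_trees. \<forall>u\<in>t. num_children u t \<noteq> None}"

definition tree_height :: "word set \<Rightarrow> enat" where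
  "tree_height t = (SUP u\<in>t. enat (length u))"

text \<open>
  As \<^const>\<open>card\<close> is \<open>0\<close> on infinite sets, this is meant for locally finite trees only, whose
  levels are all finite.
\<close>

definition generation_size :: "nat \<Rightarrow> word set \<Rightarrow> nat" where
  "generation_size n t = card {u \<in> t. length u = n}"

definition restrict_height :: "nat \<Rightarrow> word set \<Rightarrow> word set" where
  "restrict_height h t = {u \<in> t. length u \<le> h}"

definition children_space :: "int option topology" where
  "children_space = Alexandroff_compactification (discrete_topology {-1..})"

text \<open>
  The initial topology of the maps \<open>t \<mapsto> k\<^sub>u(t)\<close>; see \<open>limitin_tree_topology\<close> below for its
  convergence.
\<close>

definition tree_topology :: "word set topology" where
  "tree_topology = pullback_topology all_trees (\<lambda>t. \<lambda>u\<in>words. num_children u t)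
     (product_topology (\<lambda>_. children_space) words)"

lemma num_children_in_space: "num_children u t \<in> topspace children_space"
  using num_children_ge[of u t] by (cases "num_children u t") (auto simp: children_space_def)

lemma topspace_tree_topology [simp]: "topspace tree_topology = all_trees"
  using num_children_in_space
  by (auto simp: tree_topology_def topspace_pullback_topology PiE_def)

lemma limitin_pullback_topology:
  assumes "f ` A \<subseteq> topspace T"
  shows "limitin (pullback_topology A f T) x l F \<longleftrightarrow>
           l \<in> A \<and> eventually (\<lambda>n. x n \<in> A) F \<and> limitin T (f \<circ> x) (f l) F"
proof (intro iffI conjI)
  assume L: "limitin (pullback_topology A f T) x l F"
  then show "l \<in> A"
    by (auto simp: limitin_def topspace_pullback_topology)
  have "openin (pullback_topology A f T) A"
    using assms openin_topspace[of "pullback_topology A f T"]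
    by (simp add: topspace_pullback_topology Int_absorb1 image_subset_iff_subset_vimage)
  with L \<open>l \<in> A\<close> show "eventually (\<lambda>n. x n \<in> A) F"
    by (auto simp: limitin_def)
  show "limitin T (f \<circ> x) (f l) F"
    unfolding limitin_def
  proof (intro conjI allI impI)
    show "f l \<in> topspace T" using assms \<open>l \<in> A\<close> by auto
    fix U assume "openin T U \<and> f l \<in> U"
    then have "openin (pullback_topology A f T) (f -` U \<inter> A)" "l \<in> f -` U \<inter> A"
      using \<open>l \<in> A\<close> by (auto simp: openin_pullback_topology)
    then have "eventually (\<lambda>n. x n \<in> f -` U \<inter> A) F"
      using L unfolding limitin_def by blast
    then show "eventually (\<lambda>n. (f \<circ> x) n \<in> U) F"
      by eventually_elim auto
  qed
next
  assume R: "l \<in> A \<and> eventually (\<lambda>n. x n \<in> A) F \<and> limitin T (f \<circ> x) (f l) F"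
  show "limitin (pullback_topology A f T) x l F"
    unfolding limitin_def
  proof (intro conjI allI impI)
    show "l \<in> topspace (pullback_topology A f T)"
      using R assms by (auto simp: topspace_pullback_topology)
    fix V assume "openin (pullback_topology A f T) V \<and> l \<in> V"
    then obtain U where U: "openin T U" "V = f -` U \<inter> A" "f l \<in> U"
      by (auto simp: openin_pullback_topology)
    then have "eventually (\<lambda>n. (f \<circ> x) n \<in> U) F"
      using R by (simp add: limitin_def)
    moreover have "eventually (\<lambda>n. x n \<in> A) F" using R by simp
    ultimately show "eventually (\<lambda>n. x n \<in> V) F"
      by eventually_elim (auto simp: U)
  qed
qed

lemma limitin_tree_topology:
  "limitin tree_topology x t F \<longleftrightarrow>
     t \<in> all_trees \<and> eventually (\<lambda>n. x n \<in> all_trees) F \<and>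
     (\<forall>u\<in>words. limitin children_space (\<lambda>n. num_children u (x n)) (num_children u t) F)"
  unfolding tree_topology_def
  apply (subst limitin_pullback_topology)
   apply (simp add: num_children_in_space image_subset_iff restrict_PiE_iff)
  apply (simp add: limitin_componentwise num_children_in_space comp_def restrict_PiE_iff)
  done

definition tree_borel :: "word set measure" where
  "tree_borel = sigma all_trees {U. openin tree_topology U}"

definition random_tree :: "'a measure \<Rightarrow> ('a \<Rightarrow> word set) \<Rightarrow> bool" where
  "random_tree M T \<longleftrightarrow> prob_space M \<and> T \<in> M \<rightarrow>\<^sub>M tree_borel"

definition converges_in_distribution ::
    "(nat \<Rightarrow> 'a measure) \<Rightarrow> (nat \<Rightarrow> 'a \<Rightarrow> word set) \<Rightarrow> 'b measure \<Rightarrow> ('b \<Rightarrow> word set) \<Rightarrow> bool" where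
  "converges_in_distribution N X M Y \<longleftrightarrow>
     (\<forall>f :: word set \<Rightarrow> real. continuous_map tree_topology euclideanreal f \<and> bounded (f ` all_trees) \<longrightarrow>
        (\<lambda>n. \<integral>\<omega>. f (X n \<omega>) \<partial>N n) \<longlonglongrightarrow> (\<integral>\<omega>. f (Y \<omega>) \<partial>M))"

definition geom_offspring :: "real \<Rightarrow> real \<Rightarrow> nat pmf" where
  "geom_offspring \<eta> q = embed_pmf (\<lambda>k. if k = 0 then 1 - \<eta> else \<eta> * q * (1 - q) ^ (k - 1))"

lemma pmf_geom_offspring:
  assumes "\<eta> \<in> {0..1}" "q \<in> {0<..1}"
  shows "pmf (geom_offspring \<eta> q) k = (if k = 0 then 1 - \<eta> else \<eta> * q * (1 - q) ^ (k - 1))"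
proof -
  define P where "P = bind_pmf (bernoulli_pmf \<eta>)
    (\<lambda>b. if b then map_pmf Suc (geometric_pmf q) else return_pmf 0)"
  have 1: "pmf (map_pmf Suc (geometric_pmf q)) (Suc j) = (1 - q) ^ j * q" for j
    using assms by (subst pmf_map_inj') auto
  have 0: "pmf (map_pmf Suc (geometric_pmf q)) 0 = 0"
    by (simp add: pmf_eq_0_set_pmf)
  have P: "pmf P k = (if k = 0 then 1 - \<eta> else \<eta> * q * (1 - q) ^ (k - 1))" for k
    using assms by (cases k) (auto simp: P_def pmf_bind 0 1)
  have "geom_offspring \<eta> q = embed_pmf (pmf P)"
    unfolding geom_offspring_def by (rule arg_cong[of _ _ embed_pmf], rule ext) (simp only: P)
  also have "\<dots> = P"
    by (rule type_definition.Rep_inverse[OF td_pmf_embed_pmf])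
  finally show ?thesis
    by (simp add: P)
qed

text \<open>
  In the product, \<open>nat (the (num_children u t))\<close> is the number of children of \<open>u\<close> as a natural
  number; the index set is finite and consists of vertices of the locally finite tree \<open>t\<close>.
\<close>

definition galton_watson :: "nat pmf \<Rightarrow> 'a measure \<Rightarrow> ('a \<Rightarrow> word set) \<Rightarrow> bool" where
  "galton_watson p M T \<longleftrightarrow> random_tree M T \<and> (\<forall>\<omega>\<in>space M. T \<omega> \<in> locally_finite_trees) \<and>
     (\<forall>h\<ge>1. \<forall>t\<in>locally_finite_trees. tree_height t \<le> enat h \<longrightarrow>
        measure M {\<omega>\<in>space M. restrict_height h (T \<omega>) = t} =
          (\<Prod>u\<in>restrict_height (h - 1) t. pmf p (nat (the (num_children u t)))))"

definition e_offspring :: "real \<Rightarrow> real \<Rightarrow> nat pmf" where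
  "e_offspring \<eta> q = (if \<eta> / q \<le> 1 then geom_offspring \<eta> q else geom_offspring q \<eta>)"

definition size_biased_offspring :: "real \<Rightarrow> real \<Rightarrow> nat \<Rightarrow> nat pmf" where
  "size_biased_offspring \<eta> q s =
     embed_pmf (\<lambda>n. if n \<ge> s then real (n choose s) * max q \<eta> ^ (s + 1) * (1 - max q \<eta>) ^ (n - s) else 0)"

lemma pmf_size_biased_offspring:
  assumes "\<eta> \<in> {0..1}" "q \<in> {0<..1}"
  shows "pmf (size_biased_offspring \<eta> q s) n =
    (if n \<ge> s then real (n choose s) * max q \<eta> ^ (s + 1) * (1 - max q \<eta>) ^ (n - s) else 0)"
proof -
  define r where "r = max q \<eta>"
  have r: "r \<in> {0<..1}" using assms by (auto simp: r_def)
  define P where "P = map_pmf (\<lambda>k. k + s) (neg_binomial_pmf (s + 1) r)"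
  have "pmf P n = (if n \<ge> s then real (n choose s) * r ^ (s + 1) * (1 - r) ^ (n - s) else 0)" for n
  proof (cases "n \<ge> s")
    case True
    then obtain k where n: "n = k + s" by (metis add.commute le_Suc_ex)
    have "pmf P n = pmf (neg_binomial_pmf (s + 1) r) k"
      unfolding P_def n by (rule pmf_map_inj') (auto simp: inj_def)
    also have "\<dots> = real ((k + s) choose k) * r ^ (s + 1) * (1 - r) ^ k"
      using r by (subst pmf_neg_binomial) auto
    also have "(k + s) choose k = n choose s"
      using binomial_symmetric[of k "k + s"] n by simp
    finally show ?thesis using n by simp
  next
    case False
    then show ?thesis by (auto simp: P_def pmf_eq_0_set_pmf)
  qed
  note P = this
  have "size_biased_offspring \<eta> q s = embed_pmf (pmf P)"
    unfolding size_biased_offspring_def r_def[symmetric]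
    by (rule arg_cong[of _ _ embed_pmf], rule ext) (simp only: P)
  also have "\<dots> = P"
    by (rule type_definition.Rep_inverse[OF td_pmf_embed_pmf])
  finally show ?thesis
    by (simp add: P r_def)
qed

definition zeta :: "real \<Rightarrow> real \<Rightarrow> nat \<Rightarrow> real" where
  "zeta \<eta> q h =
     (let \<mu> = \<eta> / q; \<gamma> = 1 / (1 - q); \<kappa> = (1 - \<eta>) / (1 - q) in
      if \<mu> < 1 then (1 - \<mu>) * (\<kappa> - 1) / \<kappa> / \<mu> ^ (h + 1)
      else if \<mu> = 1 then \<gamma> - 1
      else \<mu> ^ h * (\<mu> - 1) * (1 - \<kappa>))"

text \<open>
  All vertices of the random tree have finitely many children, so the tree truncated at height
  \<open>h\<close> together with its vertices of type \<open>s\<close> is a finite object, and its law is a \<^typ>\<open>'a pmf\<close>.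
  A state is a pair \<open>(t, S)\<close> of the truncated tree and the set of its vertices of type \<open>s\<close>, at all
  levels up to \<open>h\<close>; the other vertices have type \<open>e\<close>. The function \<open>grow\<close> samples level \<open>h + 1\<close>
  given a state at height \<open>h\<close>: \<open>\<Delta>\<close> is the increment of the number of type-\<open>s\<close> vertices, \<open>s u\<close> the
  number of type-\<open>s\<close> children of \<open>u\<close>, \<open>k u\<close> the number of all children of \<open>u\<close>, and \<open>A u\<close> the set of
  ranks of the type-\<open>s\<close> children of \<open>u\<close>. Outside the index sets these functions are set to \<open>0\<close>
  or \<open>{}\<close>, which makes the set of configurations finite.
\<close>

definition s_configurations :: "word set \<Rightarrow> nat \<Rightarrow> (word \<Rightarrow> nat) set" where
  "s_configurations V m = {s. (\<forall>u\<in>V. s u \<ge> 1) \<and> (\<forall>u. u \<notin> V \<longrightarrow> s u = 0) \<and> (\<Sum>u\<in>V. s u) = m}"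

definition grow :: "real \<Rightarrow> real \<Rightarrow> real \<Rightarrow> nat \<Rightarrow> word set \<times> word set \<Rightarrow> (word set \<times> word set) pmf" where
  "grow \<eta> q \<theta> h = (\<lambda>(t, S).
     let L = {u \<in> t. length u = h}; V = {u \<in> S. length u = h} in
     do {
       \<Delta> \<leftarrow> poisson_pmf (\<theta> * zeta \<eta> q h);
       s \<leftarrow> pmf_of_set (s_configurations V (card V + \<Delta>));
       k \<leftarrow> Pi_pmf L 0 (\<lambda>u. if u \<in> V then size_biased_offspring \<eta> q (s u) else e_offspring \<eta> q);
       A \<leftarrow> Pi_pmf V {} (\<lambda>u. pmf_of_set {B. B \<subseteq> {1..k u} \<and> card B = s u});
       return_pmf (t \<union> {u @ [i] |u i. u \<in> L \<and> i \<in> {1..k u}},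
                   S \<union> {u @ [i] |u i. u \<in> V \<and> i \<in> A u})
     })"

primrec typed_tree_law :: "real \<Rightarrow> real \<Rightarrow> real \<Rightarrow> nat \<Rightarrow> (word set \<times> word set) pmf" where
  "typed_tree_law \<eta> q \<theta> 0 = return_pmf ({[]}, {[]})"
| "typed_tree_law \<eta> q \<theta> (Suc h) = bind_pmf (typed_tree_law \<eta> q \<theta> h) (grow \<eta> q \<theta> h)"

text \<open>
  \<open>T\<close> is a version of the random tree \<open>\<tau>\<^sup>\<theta>\<close>. Since \<open>grow\<close> leaves the levels up to \<open>h\<close> unchanged,
  prescribing the law of the typed tree truncated at each height amounts to prescribing the
  Markovian evolution from one level to the next. The random set \<open>S\<close> collects the vertices of
  type \<open>s\<close>.
\<close>

definition theta_tree :: "real \<Rightarrow> real \<Rightarrow> real \<Rightarrow> 'a measure \<Rightarrow> ('a \<Rightarrow> word set) \<Rightarrow> bool" where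
  "theta_tree \<eta> q \<theta> M T \<longleftrightarrow> random_tree M T \<and>
     (\<exists>S :: 'a \<Rightarrow> word set.
        (\<forall>u. {\<omega>\<in>space M. u \<in> S \<omega>} \<in> sets M) \<and>
        (\<forall>h t V. measure M {\<omega>\<in>space M. restrict_height h (T \<omega>) = t \<and> restrict_height h (S \<omega>) = V} =
           pmf (typed_tree_law \<eta> q \<theta> h) (t, V)))"

end

theory Submission
  imports Defs
begin

text \<open>
Fix a height \<open>h\<close> and a finite tree \<open>t\<close> of height at most \<open>h\<close> with \<open>z\<close> vertices at level \<open>h\<close>. By the
branching property, the conditioned tree has truncation \<open>t\<close> with probability
\<open>P(r\<^sub>h \<tau> = t) \<cdot> P\<^sub>z(Z\<^sub>n\<^sub>-\<^sub>h = a\<^sub>n) / P\<^sub>1(Z\<^sub>n = a\<^sub>n)\<close>, where \<open>P\<^sub>z\<close> starts from \<open>z\<close> individuals. The offspring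
generating function \<open>f\<close> is a Moebius map, and \<open>1 / (1 - f(s))\<close> is an affine function of \<open>1 / (1 - s)\<close>, so
that \<open>Z\<^sub>j\<close> is explicit: it is positive with some probability \<open>\<alpha>\<^sub>j\<close>, and then geometric with some
parameter \<open>\<beta>\<^sub>j\<close>. Splitting \<open>P\<^sub>z\<close> according to the number \<open>m\<close> of individuals with descendants in
generation \<open>n\<close> makes the ratio a finite sum over \<open>m \<le> z\<close>, whose terms converge by elementary
asymptotics of \<open>\<alpha>\<^sub>j\<close> and \<open>\<beta>\<^sub>j\<close> (\<open>conditional_probability_tendsto\<close>).

On the side of the limit tree, consider the probability that the truncated typed tree is \<open>(t, S)\<close>. In
the product over the generations, the Poisson probabilities divided by the numbers of configurations
telescope, and both offspring laws are exponential tilts of \<open>p\<close>. What remains is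
\<open>P(r\<^sub>h \<tau> = t)\<close> times a quantity that depends only on \<open>z\<close> and on the number \<open>m\<close> of vertices of \<open>S\<close> at level \<open>h\<close>
(\<open>pmf_typed_tree_law\<close>). Moreover \<open>S\<close> is the set of ancestors of its level \<open>h\<close>. Hence the sum over \<open>S\<close> is a sum
over nonempty subsets of level \<open>h\<close> of \<open>t\<close>, that is, a sum over \<open>m\<close> with binomial coefficients, and it is
the sum found above.

Finally, the cylinder probabilities determine the convergence in distribution: a continuous function
is nearly constant on the cylinder of trees with a given truncation at a large height, and the
truncations of the limit tree take countably many values, so no mass is lost in the limit
(\<open>converges_in_distributionI_cylinders\<close>).

The three regimes are treated together through the maximum and the minimum of \<open>q\<close> and \<open>\<eta>\<close>: with
\<open>b = max q \<eta> / min q \<eta>\<close>, the Poisson rates \<open>\<zeta>\<^sub>h\<close> are a multiple of \<open>b\<^sup>h\<close>, and the extinction probability is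
\<open>(1 - max q \<eta>) / (1 - q)\<close>.
\<close>

section \<open>Finite trees and the addition of a generation\<close>

definition level :: "nat \<Rightarrow> word set \<Rightarrow> word set" where
  "level h t = {u \<in> t. length u = h}"

definition children_of :: "word set \<Rightarrow> (word \<Rightarrow> nat set) \<Rightarrow> word set" where
  "children_of L B = {u @ [i] |u i. u \<in> L \<and> i \<in> B u}"

text \<open>
The value is \<open>0\<close> outside the tree and unspecified for a vertex with infinitely many children.
\<close>

definition child_count :: "word \<Rightarrow> word set \<Rightarrow> nat" where
  "child_count u t = nat (the (num_children u t))"

definition trees_upto :: "nat \<Rightarrow> word set set" where
  "trees_upto h = {t \<in> all_trees. finite t \<and> (\<forall>u\<in>t. length u \<le> h)}"

definition add_generation :: "nat \<Rightarrow> word set \<Rightarrow> (word \<Rightarrow> nat) \<Rightarrow> word set" where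
  "add_generation h t k = t \<union> children_of (level h t) (\<lambda>u. {1..k u})"

lemma append_in_children_of_iff [simp]: "u @ [i] \<in> children_of L B \<longleftrightarrow> u \<in> L \<and> i \<in> B u"
  by (auto simp: children_of_def)

lemma length_children_of: "w \<in> children_of (level h t) B \<Longrightarrow> length w = Suc h"
  by (auto simp: children_of_def level_def)

lemma finite_children_of:
  assumes "finite L" "\<And>u. u \<in> L \<Longrightarrow> finite (B u)"
  shows "finite (children_of L B)"
proof -
  have "children_of L B = (\<lambda>(u, i). u @ [i]) ` (SIGMA u:L. B u)"
    by (auto simp: children_of_def)
  then show ?thesis
    using assms by simp
qed

lemma card_children_of:
  assumes "finite L" "\<And>u. u \<in> L \<Longrightarrow> finite (B u)"
  shows "card (children_of L B) = (\<Sum>u\<in>L. card (B u))"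
proof -
  have "children_of L B = (\<lambda>(u, i). u @ [i]) ` (SIGMA u:L. B u)"
    by (auto simp: children_of_def)
  moreover have "inj_on (\<lambda>(u, i). u @ [i]) (SIGMA u:L. B u)"
    by (auto simp: inj_on_def)
  ultimately show ?thesis
    using assms by (simp add: card_image)
qed

lemma finite_level: "finite t \<Longrightarrow> finite (level h t)"
  by (simp add: level_def)

lemma finite_level_trees_upto: "t \<in> trees_upto h \<Longrightarrow> finite (level h t)"
  by (simp add: trees_upto_def finite_level)

lemma root_in_trees_upto_0: "{[]} \<in> trees_upto 0"
  by (auto simp: trees_upto_def all_trees_def words_def enat_0_iff intro!: exI[of _ 0])

lemma num_children_eqI:
  assumes "u \<in> t" "\<And>i. i \<ge> 1 \<Longrightarrow> u @ [i] \<in> t \<longleftrightarrow> i \<le> m"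
  shows "num_children u t = Some (int m)"
proof -
  have "(THE k::enat. \<forall>i\<ge>1. u @ [i] \<in> t \<longleftrightarrow> enat i \<le> k) = enat m"
  proof (rule the_equality)
    fix k :: enat
    assume "\<forall>i\<ge>1. u @ [i] \<in> t \<longleftrightarrow> enat i \<le> k"
    then show "k = enat m"
      using assms(2) by (intro enat_cut_unique) simp
  qed (simp add: assms)
  then show ?thesis
    using assms(1) by (simp add: num_children_def)
qed

text \<open>
The number of children of \<open>u\<close> only involves \<open>u\<close> and the words \<open>u @ [i]\<close>, so it can be read off from any
truncation at a height above \<open>length u\<close>.
\<close>

lemma num_children_cong:
  assumes "u \<in> t \<longleftrightarrow> u \<in> t'" "\<And>i. i \<ge> 1 \<Longrightarrow> u @ [i] \<in> t \<longleftrightarrow> u @ [i] \<in> t'"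
  shows "num_children u t = num_children u t'"
proof -
  have "(\<lambda>k::enat. \<forall>i\<ge>1. u @ [i] \<in> t \<longleftrightarrow> enat i \<le> k) = (\<lambda>k. \<forall>i\<ge>1. u @ [i] \<in> t' \<longleftrightarrow> enat i \<le> k)"
    using assms(2) by auto
  then show ?thesis
    using assms(1) unfolding num_children_def by (simp only:)
qed

lemma num_children_restrict_height:
  "length u < h \<Longrightarrow> num_children u (restrict_height h t) = num_children u t"
  by (intro num_children_cong) (auto simp: restrict_height_def)

lemma restrict_height_trees_upto: "t \<in> trees_upto h \<Longrightarrow> restrict_height h t = t"
  by (auto simp: restrict_height_def trees_upto_def)

lemma restrict_height_restrict_height:
  "h \<le> h' \<Longrightarrow> restrict_height h (restrict_height h' t) = restrict_height h t"
  by (auto simp: restrict_height_def)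

lemma restrict_height_add_generation:
  "t \<in> trees_upto h \<Longrightarrow> restrict_height h (add_generation h t k) = t"
  using length_children_of
  by (fastforce simp: restrict_height_def add_generation_def trees_upto_def)

lemma level_Suc_add_generation:
  "t \<in> trees_upto h \<Longrightarrow> level (Suc h) (add_generation h t k) = children_of (level h t) (\<lambda>u. {1..k u})"
  using length_children_of
  by (fastforce simp: level_def[of "Suc h"] add_generation_def trees_upto_def)

lemma card_level_Suc_add_generation:
  "t \<in> trees_upto h \<Longrightarrow> card (level (Suc h) (add_generation h t k)) = (\<Sum>u\<in>level h t. k u)"
  by (simp add: level_Suc_add_generation card_children_of finite_level_trees_upto)

lemma append_in_add_generation_iff:
  assumes "t \<in> trees_upto h" "u \<in> level h t"
  shows "u @ [i] \<in> add_generation h t k \<longleftrightarrow> i \<in> {1..k u}"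
  using assms by (auto simp: add_generation_def trees_upto_def level_def)

text \<open>
Vertices of level \<open>h\<close> have no children in \<open>t\<close>, so the new tree shows all the chosen numbers of children;
the functions are normalised by the value \<open>0\<close> elsewhere.
\<close>

lemma add_generation_inject:
  assumes t: "t \<in> trees_upto h"
    and k: "\<And>u. u \<notin> level h t \<Longrightarrow> k u = 0" "\<And>u. u \<notin> level h t \<Longrightarrow> k' u = 0"
    and eq: "add_generation h t k = add_generation h t k'"
  shows "k = k'"
proof
  fix u
  show "k u = k' u"
  proof (cases "u \<in> level h t")
    case True
    then have "{1..k u} = {1..k' u}"
      using append_in_add_generation_iff[OF t True, of _ k] append_in_add_generation_iff[OF t True, of _ k'] eq
      by blast
    then show ?thesis
      by (metis card_atLeastAtMost diff_Suc_1)
  qed (simp add: k)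
qed

lemma add_generation_in_trees_upto:
  assumes t: "t \<in> trees_upto h"
  shows "add_generation h t k \<in> trees_upto (Suc h)"
proof -
  let ?t = "add_generation h t k"
  have *: "t \<subseteq> words" "[] \<in> t" "finite t" "\<And>u. u \<in> t \<Longrightarrow> length u \<le> h"
    "\<And>u v. u \<in> t \<Longrightarrow> prefix v u \<Longrightarrow> v \<in> t"
    "\<And>u. u \<in> t \<Longrightarrow> \<exists>k::enat. \<forall>i\<ge>1. u @ [i] \<in> t \<longleftrightarrow> enat i \<le> k"
    using t by (auto simp: trees_upto_def all_trees_def)
  have new: "w \<in> ?t \<longleftrightarrow> w \<in> t \<or> (\<exists>u i. w = u @ [i] \<and> u \<in> t \<and> length u = h \<and> 1 \<le> i \<and> i \<le> k u)" for w
    by (auto simp: add_generation_def children_of_def level_def)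
  have "\<exists>l::enat. \<forall>i\<ge>1. u @ [i] \<in> ?t \<longleftrightarrow> enat i \<le> l" if u: "u \<in> ?t" for u
  proof -
    consider "u \<in> t" "length u < h" | "u \<in> t" "length u = h" | "length u = Suc h"
      using u *(4)[of u] by (force simp: new)
    then show ?thesis
    proof cases
      case 1
      then show ?thesis
        using *(6)[of u] by (simp add: new)
    next
      case 2
      then show ?thesis
        using *(4)[of "u @ [_]"] by (intro exI[of _ "enat (k u)"]) (auto simp: new)
    next
      case 3
      then have "u @ [i] \<notin> ?t" for i
        using *(4)[of "u @ [i]"] *(4)[of u] by (auto simp: new)
      then show ?thesis
        by (intro exI[of _ 0]) (simp add: zero_enat_def)
    qed
  qed
  moreover have "v \<in> ?t" if "u \<in> ?t" "prefix v u" for u v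
    using that *(5) by (auto simp: new)
  moreover have "?t \<subseteq> words"
    using *(1) by (fastforce simp: new words_def in_lists_conv_set)
  moreover have "finite ?t"
    using t by (auto simp: add_generation_def trees_upto_def intro!: finite_children_of finite_level)
  moreover have "\<forall>u\<in>?t. length u \<le> Suc h"
    using *(4) by (force simp: new)
  moreover have "[] \<in> ?t"
    using *(2) by (simp add: new)
  ultimately show ?thesis
    by (simp add: trees_upto_def all_trees_def)
qed

lemma child_count_add_generation:
  assumes "t \<in> trees_upto h" "u \<in> t"
  shows "child_count u (add_generation h t k) = (if length u = h then k u else child_count u t)"
proof (cases "length u = h")
  case True
  then have "num_children u (add_generation h t k) = Some (int (k u))"
    using assms
    by (intro num_children_eqI)
       (auto simp: append_in_add_generation_iff[OF assms(1)] level_def add_generation_def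
          trees_upto_def children_of_def)
  then show ?thesis
    using True by (simp add: child_count_def)
next
  case False
  then have "length u < h"
    using assms by (auto simp: trees_upto_def intro: le_neq_implies_less)
  then have "num_children u (add_generation h t k) = num_children u t"
    using num_children_restrict_height[of u h "add_generation h t k"] assms(1)
    by (simp add: restrict_height_add_generation)
  then show ?thesis
    using False by (simp add: child_count_def)
qed

text \<open>
The probability that a Galton-Watson tree with offspring distribution \<open>p\<close> has truncation \<open>t\<close> at height \<open>h\<close>.
\<close>

definition gw_weight :: "nat pmf \<Rightarrow> nat \<Rightarrow> word set \<Rightarrow> real" where
  "gw_weight p h t = (\<Prod>u\<in>{u\<in>t. length u < h}. pmf p (child_count u t))"

lemma gw_weight_add_generation:
  assumes t: "t \<in> trees_upto h"
  shows "gw_weight p (Suc h) (add_generation h t k) = gw_weight p h t * (\<Prod>u\<in>level h t. pmf p (k u))"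
proof -
  have fin: "finite t"
    using t by (simp add: trees_upto_def)
  have "{u \<in> add_generation h t k. length u < Suc h} = {u \<in> t. length u < h} \<union> level h t"
    using t length_children_of by (fastforce simp: add_generation_def trees_upto_def level_def)
  then have "gw_weight p (Suc h) (add_generation h t k) =
      (\<Prod>u\<in>{u \<in> t. length u < h} \<union> level h t. pmf p (child_count u (add_generation h t k)))"
    by (simp add: gw_weight_def)
  also have "\<dots> = (\<Prod>u\<in>{u \<in> t. length u < h}. pmf p (child_count u (add_generation h t k))) *
      (\<Prod>u\<in>level h t. pmf p (child_count u (add_generation h t k)))"
    using fin by (intro prod.union_disjoint) (auto simp: level_def)
  also have "\<dots> = gw_weight p h t * (\<Prod>u\<in>level h t. pmf p (k u))"
    unfolding gw_weight_def
    by (intro arg_cong2[of _ _ _ _ "(*)"] prod.cong)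
       (auto simp: child_count_add_generation[OF t] level_def)
  finally show ?thesis .
qed

lemma trees_upto_locally_finite:
  assumes "t \<in> trees_upto h"
  shows "t \<in> locally_finite_trees" "tree_height t \<le> enat h"
proof -
  have t: "t \<in> all_trees" "finite t" "\<And>u. u \<in> t \<Longrightarrow> length u \<le> h"
    using assms by (auto simp: trees_upto_def)
  have "num_children u t \<noteq> None" if "u \<in> t" for u
  proof
    assume "num_children u t = None"
    then have "(\<lambda>i. u @ [i]) ` {1..} \<subseteq> t"
      using child_iff_num_children[OF t(1) that] by auto
    then have "finite ((\<lambda>i. u @ [i]) ` {1::nat..})"
      using t(2) finite_subset by blast
    then show False
      by (subst (asm) finite_image_iff) (auto simp: inj_on_def infinite_Ici)
  qed
  then show "t \<in> locally_finite_trees"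
    using t(1) by (simp add: locally_finite_trees_def)
  show "tree_height t \<le> enat h"
    unfolding tree_height_def using t(3) by (intro SUP_least) simp
qed

text \<open>
The children of the finitely many vertices of height at most \<open>h\<close> are finite in number, which gives the
induction step.
\<close>

lemma finite_restrict_height:
  assumes "t \<in> locally_finite_trees"
  shows "finite (restrict_height h t)"
proof (induction h)
  case 0
  show ?case
    by (rule finite_subset[of _ "{[]}"]) (auto simp: restrict_height_def)
next
  case (Suc h)
  have t: "t \<in> all_trees" "\<And>u. u \<in> t \<Longrightarrow> num_children u t \<noteq> None"
    using assms by (auto simp: locally_finite_trees_def)
  have "w \<in> restrict_height h t \<union> children_of (restrict_height h t) (\<lambda>u. {1..child_count u t})"
    if w: "w \<in> restrict_height (Suc h) t" for w
  proof (cases "length w \<le> h")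
    case True
    then show ?thesis
      using w by (simp add: restrict_height_def)
  next
    case False
    then obtain u i where ui: "w = u @ [i]"
      by (cases w rule: rev_cases) auto
    have w': "w \<in> t" "length u \<le> h"
      using w ui by (auto simp: restrict_height_def)
    then have u: "u \<in> t" and "w \<in> words"
      using t(1) ui by (auto simp: all_trees_def)
    then have "i \<ge> 1"
      using ui by (simp add: words_def)
    obtain m where m: "num_children u t = Some m"
      using t(2)[OF u] by auto
    have "int i \<le> m"
      using child_iff_num_children[OF t(1) u \<open>i \<ge> 1\<close>] w' ui m by simp
    then have "i \<in> {1..child_count u t}"
      using \<open>i \<ge> 1\<close> m by (simp add: child_count_def)
    then show ?thesis
      using u w' ui by (simp add: restrict_height_def)
  qed
  then show ?case
    using Suc finite_children_of[OF Suc] finite_subset by (meson finite_UnI finite_atLeastAtMost subsetI)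
qed

lemma restrict_height_0: "t \<in> all_trees \<Longrightarrow> restrict_height 0 t = {[]}"
  by (auto simp: restrict_height_def all_trees_def)

section \<open>Convergence in distribution through truncated trees\<close>

lemma sets_tree_borel_openin: "openin tree_topology U \<Longrightarrow> U \<in> sets tree_borel"
  unfolding tree_borel_def
  using openin_subset[of tree_topology] by (subst sets_measure_of) auto

lemma space_tree_borel [simp]: "space tree_borel = all_trees"
  unfolding tree_borel_def
  using openin_subset[of tree_topology] by (subst space_measure_of) auto

lemma continuous_map_num_children:
  assumes "u \<in> words"
  shows "continuous_map tree_topology children_space (num_children u)"
proof -
  have "continuous_map tree_topology children_space ((\<lambda>x. x u) \<circ> (\<lambda>t. \<lambda>u\<in>words. num_children u t))"
    unfolding tree_topology_def
    by (intro continuous_map_pullback continuous_map_product_projection assms)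
  moreover have "(\<lambda>x. x u) \<circ> (\<lambda>t. \<lambda>u\<in>words. num_children u t) = num_children u"
    using assms by auto
  ultimately show ?thesis
    by simp
qed

text \<open>
The value \<open>-1\<close> of the number of children is isolated in the compactification and characterises the
words outside the tree. Membership of a word is therefore an open and closed condition.
\<close>

lemma openin_not_in_tree:
  assumes "u \<in> words"
  shows "openin tree_topology {t \<in> all_trees. u \<notin> t}"
proof -
  have "openin children_space {Some (-1)}"
    by (auto simp: children_space_def openin_Alexandroff_compactification)
  from openin_continuous_map_preimage[OF continuous_map_num_children[OF assms] this]
  have "openin tree_topology {t \<in> all_trees. num_children u t = Some (-1)}"
    by simp
  also have "{t \<in> all_trees. num_children u t = Some (-1)} = {t \<in> all_trees. u \<notin> t}"
    by (auto simp: num_children_def split: enat.splits if_splits)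
  finally show ?thesis .
qed

lemma sets_in_tree: "{t \<in> all_trees. u \<in> t} \<in> sets tree_borel"
proof (cases "u \<in> words")
  case True
  have "{t \<in> all_trees. u \<in> t} = space tree_borel - {t \<in> all_trees. u \<notin> t}"
    by auto
  then show ?thesis
    using sets.compl_sets[OF sets_tree_borel_openin[OF openin_not_in_tree[OF True]]] by simp
next
  case False
  then have "{t \<in> all_trees. u \<in> t} = {}"
    by (auto simp: all_trees_def)
  then show ?thesis
    by (simp only: sets.empty_sets)
qed

lemma measurable_mem_tree:
  assumes "T \<in> M \<rightarrow>\<^sub>M tree_borel"
  shows "{\<omega>\<in>space M. u \<in> T \<omega>} \<in> sets M"
proof -
  have "T -` {t \<in> all_trees. u \<in> t} \<inter> space M \<in> sets M"
    using assms sets_in_tree by (rule measurable_sets)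
  also have "T -` {t \<in> all_trees. u \<in> t} \<inter> space M = {\<omega>\<in>space M. u \<in> T \<omega>}"
    using measurable_space[OF assms] by auto
  finally show ?thesis .
qed

text \<open>
There are countably many words, so a truncation is prescribed by countably many membership
conditions.
\<close>

lemma sets_restrict_height_eq:
  assumes "\<And>u. {\<omega>\<in>space M. u \<in> X \<omega>} \<in> sets M"
  shows "{\<omega>\<in>space M. restrict_height h (X \<omega>) = t} \<in> sets M"
proof -
  have [measurable]: "Measurable.pred M (\<lambda>\<omega>. u \<in> X \<omega>)" for u
    using assms[of u] by (simp add: pred_def)
  have "{\<omega>\<in>space M. restrict_height h (X \<omega>) = t} =
      {\<omega>\<in>space M. \<forall>u. (length u \<le> h \<and> u \<in> X \<omega>) \<longleftrightarrow> u \<in> t}"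
    by (auto simp: restrict_height_def)
  also have "\<dots> \<in> sets M"
    by measurable
  finally show ?thesis .
qed

lemma sets_restrict_height_tree_eq:
  "T \<in> M \<rightarrow>\<^sub>M tree_borel \<Longrightarrow> {\<omega>\<in>space M. restrict_height h (T \<omega>) = t} \<in> sets M"
  by (intro sets_restrict_height_eq measurable_mem_tree)

lemma sets_cylinder: "{t' \<in> all_trees. restrict_height h t' = t} \<in> sets tree_borel"
  using sets_restrict_height_eq[of tree_borel "\<lambda>t. t" h t] sets_in_tree by simp

lemma borel_measurable_continuous_tree:
  fixes f :: "word set \<Rightarrow> real"
  assumes "continuous_map tree_topology euclideanreal f"
  shows "f \<in> borel_measurable tree_borel"
proof (rule borel_measurableI)
  fix S :: "real set"
  assume "open S"
  then have "openin tree_topology {t \<in> all_trees. f t \<in> S}"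
    using openin_continuous_map_preimage[OF assms, of S] by simp
  moreover have "f -` S \<inter> space tree_borel = {t \<in> all_trees. f t \<in> S}"
    by auto
  ultimately show "f -` S \<inter> space tree_borel \<in> sets tree_borel"
    by (simp add: sets_tree_borel_openin)
qed

text \<open>
A basic neighbourhood constrains finitely many of the numbers of children, and these are determined by
the truncation at any height above the lengths of the words involved.
\<close>

lemma open_contains_cylinder:
  assumes U: "openin tree_topology U" and t: "t \<in> U"
  obtains h where "\<And>t'. t' \<in> all_trees \<Longrightarrow> restrict_height h t' = restrict_height h t \<Longrightarrow> t' \<in> U"
proof -
  let ?f = "\<lambda>t. \<lambda>u\<in>words. num_children u t"
  obtain W where W: "openin (product_topology (\<lambda>_. children_space) words) W" "U = ?f -` W \<inter> all_trees"
    using U by (auto simp: tree_topology_def openin_pullback_topology)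
  have "?f t \<in> W"
    using t W by auto
  then obtain X where X: "finite {u \<in> words. X u \<noteq> topspace children_space}"
      "?f t \<in> PiE words X" "PiE words X \<subseteq> W"
    using bspec[OF W(1)[unfolded openin_product_topology_alt], of "?f t"] by blast
  define h where "h = Suc (Max (insert 0 (length ` {u \<in> words. X u \<noteq> topspace children_space})))"
  have h: "length u < h" if "u \<in> words" "X u \<noteq> topspace children_space" for u
    using that X(1) unfolding h_def by (auto simp: less_Suc_eq_le intro!: Max_ge)
  show ?thesis
  proof (rule that)
    fix t'
    assume t': "t' \<in> all_trees" "restrict_height h t' = restrict_height h t"
    have "num_children u t' \<in> X u" if u: "u \<in> words" for u
    proof (cases "X u = topspace children_space")
      case True
      then show ?thesis
        by (simp add: num_children_in_space)
    next
      case False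
      then have "num_children u t' = num_children u t"
        using num_children_restrict_height[OF h[OF u]] t'(2) by metis
      then show ?thesis
        using X(2) u by (auto simp: PiE_iff)
    qed
    then have "?f t' \<in> PiE words X"
      by auto
    with X(3) have "?f t' \<in> W"
      by (rule subsetD)
    then show "t' \<in> U"
      using W(2) t'(1) by simp
  qed
qed

lemma continuous_nearly_constant_on_cylinder:
  fixes f :: "word set \<Rightarrow> real"
  assumes f: "continuous_map tree_topology euclideanreal f" and t: "t \<in> all_trees" and e: "0 < e"
  obtains h where "\<And>t'. t' \<in> all_trees \<Longrightarrow> restrict_height h t' = restrict_height h t \<Longrightarrow> \<bar>f t' - f t\<bar> < e"
proof -
  have "openin tree_topology {x \<in> topspace tree_topology. f x \<in> ball (f t) e}"
    using f by (rule openin_continuous_map_preimage) simp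
  moreover have "t \<in> {x \<in> topspace tree_topology. f x \<in> ball (f t) e}"
    using t e by simp
  ultimately show ?thesis
  proof (rule open_contains_cylinder)
    fix h
    assume "\<And>t'. t' \<in> all_trees \<Longrightarrow> restrict_height h t' = restrict_height h t \<Longrightarrow>
       t' \<in> {x \<in> topspace tree_topology. f x \<in> ball (f t) e}"
    then show ?thesis
      by (intro that[of h]) (auto simp: dist_real_def abs_minus_commute)
  qed
qed

text \<open>
One half of the convergence of expectations, in the manner of Fatou's lemma. Up to a small probability,
\<open>Y\<close> lies in one of finitely many cylinders on which \<open>f\<close> is constant up to \<open>\<delta>\<close>. There the expectations are
compared through the cylinder probabilities, and elsewhere through \<open>f + B \<ge> 0\<close>, which is why lower
bounds on the cylinder probabilities suffice. The constant \<open>\<delta>\<close> is chosen so that the accumulated error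
\<open>\<delta> (2 + 6 B)\<close> equals \<open>e\<close>.
\<close>

lemma expectation_liminf_of_cylinders:
  fixes f :: "word set \<Rightarrow> real"
  assumes X: "\<And>n. n \<ge> 1 \<Longrightarrow> random_tree (N n) (X n)"
    and Y: "random_tree M Y"
    and C: "\<And>h. countable (C h)" "\<And>h. AE \<omega> in M. restrict_height h (Y \<omega>) \<in> C h"
      "\<And>h. C h \<subseteq> all_trees"
    and lim: "\<And>h t e. t \<in> C h \<Longrightarrow> e > 0 \<Longrightarrow> eventually (\<lambda>n.
       measure (N n) {\<omega>\<in>space (N n). restrict_height h (X n \<omega>) = t} \<ge>
       measure M {\<omega>\<in>space M. restrict_height h (Y \<omega>) = t} - e) sequentially"
    and f: "continuous_map tree_topology euclideanreal f" and B: "\<And>t. t \<in> all_trees \<Longrightarrow> \<bar>f t\<bar> \<le> B"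
    and e: "0 < e"
  shows "eventually (\<lambda>n. (\<integral>\<omega>. f (X n \<omega>) \<partial>N n) \<ge> (\<integral>\<omega>. f (Y \<omega>) \<partial>M) - e) sequentially"
proof -
  interpret M: prob_space M
    using Y by (simp add: random_tree_def)
  note [measurable] = borel_measurable_continuous_tree[OF f]
  have Y_meas [measurable]: "Y \<in> M \<rightarrow>\<^sub>M tree_borel"
    using Y by (simp add: random_tree_def)
  have Y_tree: "Y \<omega> \<in> all_trees" if "\<omega> \<in> space M" for \<omega>
    using measurable_space[OF Y_meas that] by simp
  have B0: "0 \<le> B"
  proof -
    obtain \<omega> where "\<omega> \<in> space M"
      using M.not_empty by blast
    then show ?thesis
      using B[OF Y_tree] abs_ge_zero order_trans by blast
  qed
  define \<delta> where "\<delta> = e / (2 + 6 * B)"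
  have \<delta>: "0 < \<delta>" "\<delta> * (2 + 6 * B) = e"
    using e B0 by (auto simp: \<delta>_def)
  define G where "G h = {t \<in> C h. \<forall>t'\<in>all_trees. restrict_height h t' = t \<longrightarrow> \<bar>f t' - f t\<bar> \<le> \<delta>}" for h
  have G: "G h \<subseteq> C h" "countable (G h)" for h
    using C(1) countable_subset[of "G h" "C h"] by (auto simp: G_def)
  have cyl [measurable]: "{\<omega>\<in>space M. restrict_height h (Y \<omega>) = t} \<in> sets M" for h t
    using Y_meas by (rule sets_restrict_height_tree_eq)
  have cylG [measurable]: "{\<omega>\<in>space M. restrict_height h (Y \<omega>) \<in> A} \<in> sets M" if "countable A" for h A
  proof -
    have "{\<omega>\<in>space M. restrict_height h (Y \<omega>) \<in> A} = (\<Union>t\<in>A. {\<omega>\<in>space M. restrict_height h (Y \<omega>) = t})"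
      by auto
    then show ?thesis
      using that cyl by (auto intro: sets.countable_UN')
  qed
  \<comment> \<open>By continuity at \<open>Y \<omega>\<close>, the truncation of \<open>Y \<omega>\<close> at height \<open>h\<close> eventually lies in \<open>G h\<close>.\<close>
  have "(\<lambda>h. measure M {\<omega>\<in>space M. restrict_height h (Y \<omega>) \<in> G h}) \<longlonglongrightarrow> 1"
  proof -
    have "(\<lambda>h. \<integral>\<omega>. indicat_real {\<omega>\<in>space M. restrict_height h (Y \<omega>) \<in> G h} \<omega> \<partial>M) \<longlonglongrightarrow> (\<integral>\<omega>. 1 \<partial>M)"
    proof (rule integral_dominated_convergence[where w = "\<lambda>_. 1"])
      have "AE \<omega> in M. \<forall>h. restrict_height h (Y \<omega>) \<in> C h"
        using C(2) by (simp add: AE_all_countable)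
      then show "AE \<omega> in M. (\<lambda>h. indicat_real {\<omega>\<in>space M. restrict_height h (Y \<omega>) \<in> G h} \<omega>) \<longlonglongrightarrow> 1"
      proof (rule AE_mp, intro AE_I2 impI)
        fix \<omega>
        assume \<omega>: "\<omega> \<in> space M" "\<forall>h. restrict_height h (Y \<omega>) \<in> C h"
        obtain h0 where h0: "\<And>t'. t' \<in> all_trees \<Longrightarrow> restrict_height h0 t' = restrict_height h0 (Y \<omega>) \<Longrightarrow>
            \<bar>f t' - f (Y \<omega>)\<bar> < \<delta> / 2"
          using continuous_nearly_constant_on_cylinder[OF f Y_tree[OF \<omega>(1)], of "\<delta> / 2"] \<delta>(1) by auto
        have "restrict_height h (Y \<omega>) \<in> G h" if h: "h \<ge> h0" for h
        proof -
          have t: "restrict_height h (Y \<omega>) \<in> all_trees"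
            using \<omega>(2) C(3) by blast
          have "\<bar>f t' - f (restrict_height h (Y \<omega>))\<bar> \<le> \<delta>"
            if t': "t' \<in> all_trees" "restrict_height h t' = restrict_height h (Y \<omega>)" for t'
          proof -
            have "restrict_height h0 t' = restrict_height h0 (Y \<omega>)"
              using t'(2) restrict_height_restrict_height[OF h] by metis
            moreover have "restrict_height h0 (restrict_height h (Y \<omega>)) = restrict_height h0 (Y \<omega>)"
              using h by (rule restrict_height_restrict_height)
            ultimately show ?thesis
              using h0[OF t'(1)] h0[OF t] by linarith
          qed
          then show ?thesis
            using \<omega>(2) by (simp add: G_def)
        qed
        then have "eventually (\<lambda>h. indicat_real {\<omega>\<in>space M. restrict_height h (Y \<omega>) \<in> G h} \<omega> = 1) sequentially"
          using \<omega>(1) by (auto simp: eventually_sequentially intro!: exI[of _ h0])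
        then show "(\<lambda>h. indicat_real {\<omega>\<in>space M. restrict_height h (Y \<omega>) \<in> G h} \<omega>) \<longlonglongrightarrow> 1"
          by (rule tendsto_eventually)
      qed
    qed (use cylG[OF G(2)] in \<open>auto simp: indicator_def\<close>)
    moreover have "(\<integral>\<omega>. indicat_real {\<omega>\<in>space M. restrict_height h (Y \<omega>) \<in> G h} \<omega> \<partial>M) =
        measure M {\<omega>\<in>space M. restrict_height h (Y \<omega>) \<in> G h}" for h
      using cylG[OF G(2)] by (simp add: Int_absorb2)
    ultimately show ?thesis
      by (simp add: M.prob_space)
  qed
  then have "eventually (\<lambda>h. measure M {\<omega>\<in>space M. restrict_height h (Y \<omega>) \<in> G h} > 1 - \<delta>) sequentially"
    using \<delta>(1) by (intro order_tendstoD) auto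
  then obtain h where h: "measure M {\<omega>\<in>space M. restrict_height h (Y \<omega>) \<in> G h} > 1 - \<delta>"
    by (auto simp: eventually_sequentially)
  define F where "F i = {t \<in> G h. to_nat_on (G h) t < i}" for i
  have finF: "finite (F i)" for i
  proof (rule finite_imageD)
    show "finite (to_nat_on (G h) ` F i)"
      by (rule finite_subset[of _ "{..<i}"]) (auto simp: F_def)
    show "inj_on (to_nat_on (G h)) (F i)"
      using inj_on_to_nat_on[OF G(2)] by (rule inj_on_subset) (auto simp: F_def)
  qed
  have "(\<lambda>i. measure M {\<omega>\<in>space M. restrict_height h (Y \<omega>) \<in> F i}) \<longlonglongrightarrow>
      measure M (\<Union>i. {\<omega>\<in>space M. restrict_height h (Y \<omega>) \<in> F i})"
    using cylG[OF countable_finite[OF finF]]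
    by (intro M.finite_Lim_measure_incseq) (auto simp: incseq_def F_def)
  also have "(\<Union>i. {\<omega>\<in>space M. restrict_height h (Y \<omega>) \<in> F i}) = {\<omega>\<in>space M. restrict_height h (Y \<omega>) \<in> G h}"
    by (auto simp: F_def)
  finally have "eventually (\<lambda>i. measure M {\<omega>\<in>space M. restrict_height h (Y \<omega>) \<in> F i} >
      measure M {\<omega>\<in>space M. restrict_height h (Y \<omega>) \<in> G h} - \<delta>) sequentially"
    using \<delta>(1) by (intro order_tendstoD) auto
  then obtain i where "measure M {\<omega>\<in>space M. restrict_height h (Y \<omega>) \<in> F i} >
      measure M {\<omega>\<in>space M. restrict_height h (Y \<omega>) \<in> G h} - \<delta>"
    by (auto simp: eventually_sequentially)
  with h have i: "measure M {\<omega>\<in>space M. restrict_height h (Y \<omega>) \<in> F i} > 1 - 2 * \<delta>"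
    by linarith
  define K where "K = F i"
  have K: "finite K" "K \<subseteq> G h"
    using finF by (auto simp: K_def F_def)
  have K_tree: "t \<in> all_trees" if "t \<in> K" for t
    using that K(2) G(1) C(3) by blast
  have Kf: "\<bar>f t' - f t\<bar> \<le> \<delta>" if "t \<in> K" "t' \<in> all_trees" "restrict_height h t' = t" for t t'
    using that K(2) by (auto simp: G_def)
  define PY where "PY t = measure M {\<omega>\<in>space M. restrict_height h (Y \<omega>) = t}" for t
  let ?I = "\<lambda>M Y t. indicat_real {\<omega>\<in>space M. restrict_height h (Y \<omega>) = t}"
  have sum_I: "(\<Sum>t\<in>K. c t * ?I M Y t \<omega>) =
      (if restrict_height h (Y \<omega>) \<in> K then c (restrict_height h (Y \<omega>)) else 0)"
    if "\<omega> \<in> space M" for c :: "word set \<Rightarrow> real" and \<omega> and M :: "'x measure" and Y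
  proof -
    have "(\<Sum>t\<in>K. c t * ?I M Y t \<omega>) = (\<Sum>t\<in>K. if restrict_height h (Y \<omega>) = t then c t else 0)"
      using that by (intro sum.cong) (auto simp: indicator_def)
    then show ?thesis
      using K(1) by simp
  qed
  have int_I: "integrable M (\<lambda>\<omega>. \<Sum>t\<in>K. c t * ?I M Y t \<omega>)"
     "(\<integral>\<omega>. (\<Sum>t\<in>K. c t * ?I M Y t \<omega>) \<partial>M) = (\<Sum>t\<in>K. c t * measure M {\<omega>\<in>space M. restrict_height h (Y \<omega>) = t})"
    if "random_tree M Y" for c :: "word set \<Rightarrow> real" and M :: "'x measure" and Y
  proof -
    interpret prob_space M
      using that by (simp add: random_tree_def)
    have *: "{\<omega>\<in>space M. restrict_height h (Y \<omega>) = t} \<in> sets M" for t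
      using that by (intro sets_restrict_height_tree_eq) (simp add: random_tree_def)
    have **: "integrable M (\<lambda>\<omega>. c t * ?I M Y t \<omega>)" for t
      using * by (intro integrable_mult_right integrable_real_indicator) (auto simp: emeasure_eq_measure)
    then show "integrable M (\<lambda>\<omega>. \<Sum>t\<in>K. c t * ?I M Y t \<omega>)"
      by (intro Bochner_Integration.integrable_sum)
    show "(\<integral>\<omega>. (\<Sum>t\<in>K. c t * ?I M Y t \<omega>) \<partial>M) = (\<Sum>t\<in>K. c t * measure M {\<omega>\<in>space M. restrict_height h (Y \<omega>) = t})"
      using * ** by (subst Bochner_Integration.integral_sum) (auto simp: Int_absorb2 intro!: sum.cong)
  qed
  have int_f: "integrable M (\<lambda>\<omega>. f (Y \<omega>))" if "random_tree M Y" for M :: "'x measure" and Y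
  proof -
    interpret prob_space M
      using that by (simp add: random_tree_def)
    have [measurable]: "Y \<in> M \<rightarrow>\<^sub>M tree_borel"
      using that by (simp add: random_tree_def)
    show ?thesis
      using measurable_space[of Y M tree_borel] B
      by (intro integrable_const_bound[where B = B]) auto
  qed
  have PY: "(\<Sum>t\<in>K. PY t) > 1 - 2 * \<delta>"
  proof -
    have "(\<Sum>t\<in>K. PY t) = measure M (\<Union>t\<in>K. {\<omega>\<in>space M. restrict_height h (Y \<omega>) = t})"
      unfolding PY_def using K(1) cyl
      by (intro M.finite_measure_finite_Union[symmetric]) (auto simp: disjoint_family_on_def)
    also have "(\<Union>t\<in>K. {\<omega>\<in>space M. restrict_height h (Y \<omega>) = t}) = {\<omega>\<in>space M. restrict_height h (Y \<omega>) \<in> F i}"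
      by (auto simp: K_def)
    finally show ?thesis
      using i by simp
  qed
  have PY1: "(\<Sum>t\<in>K. PY t) \<le> 1"
  proof -
    have "(\<Sum>t\<in>K. PY t) = measure M (\<Union>t\<in>K. {\<omega>\<in>space M. restrict_height h (Y \<omega>) = t})"
      unfolding PY_def using K(1) cyl
      by (intro M.finite_measure_finite_Union[symmetric]) (auto simp: disjoint_family_on_def)
    then show ?thesis
      by simp
  qed
  \<comment> \<open>Off the cylinders of \<open>K\<close>, use the bound \<open>0 \<le> f + B \<le> 2 B\<close>.\<close>
  have upper: "(\<integral>\<omega>. f (Y \<omega>) \<partial>M) + B \<le> (\<Sum>t\<in>K. (f t + B) * PY t) + \<delta> + 4 * B * \<delta>"
  proof -
    have "(\<integral>\<omega>. f (Y \<omega>) + B \<partial>M) \<le> (\<integral>\<omega>. 2 * B + (\<Sum>t\<in>K. (f t + B + \<delta> - 2 * B) * ?I M Y t \<omega>) \<partial>M)"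
    proof (rule integral_mono)
      show "integrable M (\<lambda>\<omega>. f (Y \<omega>) + B)"
        using int_f[OF Y] by simp
      show "integrable M (\<lambda>\<omega>. 2 * B + (\<Sum>t\<in>K. (f t + B + \<delta> - 2 * B) * ?I M Y t \<omega>))"
        by (intro Bochner_Integration.integrable_add int_I(1)[OF Y]) simp
      fix \<omega>
      assume \<omega>: "\<omega> \<in> space M"
      show "f (Y \<omega>) + B \<le> 2 * B + (\<Sum>t\<in>K. (f t + B + \<delta> - 2 * B) * ?I M Y t \<omega>)"
        unfolding sum_I[OF \<omega>] using Kf[OF _ Y_tree[OF \<omega>] refl] B[OF Y_tree[OF \<omega>]] by (auto simp: abs_le_iff)
    qed
    also have "\<dots> = 2 * B + (\<Sum>t\<in>K. (f t + B + \<delta> - 2 * B) * PY t)"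
      by (subst Bochner_Integration.integral_add[OF _ int_I(1)[OF Y]])
         (simp_all add: int_I(2)[OF Y] PY_def M.prob_space)
    also have "(\<Sum>t\<in>K. (f t + B + \<delta> - 2 * B) * PY t) =
        (\<Sum>t\<in>K. (f t + B) * PY t) + \<delta> * (\<Sum>t\<in>K. PY t) - 2 * B * (\<Sum>t\<in>K. PY t)"
      unfolding sum_distrib_left sum.distrib[symmetric] sum_subtractf[symmetric]
      by (intro sum.cong) (auto simp: algebra_simps)
    finally have "(\<integral>\<omega>. f (Y \<omega>) + B \<partial>M) \<le>
        2 * B + ((\<Sum>t\<in>K. (f t + B) * PY t) + \<delta> * (\<Sum>t\<in>K. PY t) - 2 * B * (\<Sum>t\<in>K. PY t))" .
    moreover have "\<delta> * (\<Sum>t\<in>K. PY t) \<le> \<delta>"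
      using PY1 \<delta>(1) by (simp add: mult_left_le)
    moreover have "2 * B * (1 - 2 * \<delta>) \<le> 2 * B * (\<Sum>t\<in>K. PY t)"
      using PY B0 by (intro mult_left_mono) auto
    ultimately show ?thesis
      using int_f[OF Y] by (simp add: M.prob_space algebra_simps)
  qed
  define \<epsilon> where "\<epsilon> = \<delta> / (real (card K) + 1)"
  have \<epsilon>: "0 < \<epsilon>" "real (card K) * \<epsilon> \<le> \<delta>"
    using \<delta>(1) by (auto simp: \<epsilon>_def field_simps)
  have "eventually (\<lambda>n. \<forall>t\<in>K. measure (N n) {\<omega>\<in>space (N n). restrict_height h (X n \<omega>) = t} \<ge> PY t - \<epsilon>) sequentially"
    using K G(1) lim[OF _ \<epsilon>(1)] unfolding PY_def by (intro eventually_ball_finite) blast+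
  then show ?thesis
    using eventually_ge_at_top[of 1]
  proof eventually_elim
    case (elim n)
    note Xn = X[OF elim(2)]
    interpret N: prob_space "N n"
      using Xn by (simp add: random_tree_def)
    have "X n \<in> N n \<rightarrow>\<^sub>M tree_borel"
      using Xn by (simp add: random_tree_def)
    then have X_tree: "X n \<omega> \<in> all_trees" if "\<omega> \<in> space (N n)" for \<omega>
      using measurable_space[OF _ that, of "X n" tree_borel] by simp
    have "(\<Sum>t\<in>K. (f t + B) * PY t) - 2 * B * \<delta> \<le> (\<Sum>t\<in>K. (f t + B) * PY t) - real (card K) * (2 * B * \<epsilon>)"
      using mult_left_mono[OF \<epsilon>(2), of "2 * B"] B0 by (simp add: algebra_simps)
    also have "\<dots> = (\<Sum>t\<in>K. (f t + B) * PY t - 2 * B * \<epsilon>)"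
      by (simp add: sum_subtractf)
    also have "\<dots> \<le> (\<Sum>t\<in>K. (f t + B) * measure (N n) {\<omega>\<in>space (N n). restrict_height h (X n \<omega>) = t})"
    proof (rule sum_mono)
      fix t
      assume t: "t \<in> K"
      have ft: "0 \<le> f t + B" "f t + B \<le> 2 * B"
        using B[OF K_tree[OF t]] by auto
      have "(f t + B) * PY t - 2 * B * \<epsilon> \<le> (f t + B) * PY t - (f t + B) * \<epsilon>"
        using mult_right_mono[OF ft(2), of \<epsilon>] \<epsilon>(1) by simp
      also have "\<dots> = (f t + B) * (PY t - \<epsilon>)"
        by (simp add: algebra_simps)
      also have "\<dots> \<le> (f t + B) * measure (N n) {\<omega>\<in>space (N n). restrict_height h (X n \<omega>) = t}"
        using elim(1) t ft by (intro mult_left_mono) auto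
      finally show "(f t + B) * PY t - 2 * B * \<epsilon> \<le>
          (f t + B) * measure (N n) {\<omega>\<in>space (N n). restrict_height h (X n \<omega>) = t}" .
    qed
    also have "\<dots> = (\<integral>\<omega>. (\<Sum>t\<in>K. (f t + B) * ?I (N n) (X n) t \<omega>) \<partial>N n)"
      by (rule int_I(2)[OF Xn, symmetric])
    also have "\<dots> \<le> (\<integral>\<omega>. f (X n \<omega>) + (B + \<delta>) \<partial>N n)"
    proof (rule integral_mono[OF int_I(1)[OF Xn]])
      show "integrable (N n) (\<lambda>\<omega>. f (X n \<omega>) + (B + \<delta>))"
        using int_f[OF Xn] by simp
      fix \<omega>
      assume \<omega>: "\<omega> \<in> space (N n)"
      show "(\<Sum>t\<in>K. (f t + B) * ?I (N n) (X n) t \<omega>) \<le> f (X n \<omega>) + (B + \<delta>)"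
        unfolding sum_I[OF \<omega>] using Kf[OF _ X_tree[OF \<omega>] refl] B[OF X_tree[OF \<omega>]] \<delta>(1)
        by (auto simp: abs_le_iff)
    qed
    also have "\<dots> = (\<integral>\<omega>. f (X n \<omega>) \<partial>N n) + B + \<delta>"
      using int_f[OF Xn] by (simp add: N.prob_space)
    finally show ?case
      using upper \<delta>(2) by (simp add: algebra_simps)
  qed
qed

text \<open>
Applying the one-sided estimate to \<open>f\<close> and to \<open>- f\<close> gives convergence. Lower bounds on the limits of the
cylinder probabilities are enough: at each height the bounds add up to \<open>1\<close>, which leaves no room for
larger limits.
\<close>

lemma converges_in_distributionI_cylinders:
  assumes "\<And>n. n \<ge> 1 \<Longrightarrow> random_tree (N n) (X n)" "random_tree M Y"
    and "\<And>h. countable (C h)" "\<And>h. AE \<omega> in M. restrict_height h (Y \<omega>) \<in> C h"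
      "\<And>h. C h \<subseteq> all_trees"
    and "\<And>h t e. t \<in> C h \<Longrightarrow> e > 0 \<Longrightarrow> eventually (\<lambda>n.
       measure (N n) {\<omega>\<in>space (N n). restrict_height h (X n \<omega>) = t} \<ge>
       measure M {\<omega>\<in>space M. restrict_height h (Y \<omega>) = t} - e) sequentially"
  shows "converges_in_distribution N X M Y"
  unfolding converges_in_distribution_def
proof (intro allI impI)
  fix f :: "word set \<Rightarrow> real"
  assume f: "continuous_map tree_topology euclideanreal f \<and> bounded (f ` all_trees)"
  then obtain B where B: "\<And>t. t \<in> all_trees \<Longrightarrow> \<bar>f t\<bar> \<le> B"
    by (auto simp: bounded_iff)
  have neg: "continuous_map tree_topology euclideanreal (\<lambda>t. - f t)"
    using f by (simp add: continuous_map_minus)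
  show "(\<lambda>n. \<integral>\<omega>. f (X n \<omega>) \<partial>N n) \<longlonglongrightarrow> (\<integral>\<omega>. f (Y \<omega>) \<partial>M)"
  proof (rule tendstoI)
    fix e :: real
    assume e: "e > 0"
    have "eventually (\<lambda>n. (\<integral>\<omega>. f (X n \<omega>) \<partial>N n) \<ge> (\<integral>\<omega>. f (Y \<omega>) \<partial>M) - e / 2) sequentially"
      using f B e by (intro expectation_liminf_of_cylinders[OF assms, of f B]) auto
    moreover have "eventually (\<lambda>n. (\<integral>\<omega>. - f (X n \<omega>) \<partial>N n) \<ge> (\<integral>\<omega>. - f (Y \<omega>) \<partial>M) - e / 2) sequentially"
      using neg B e by (intro expectation_liminf_of_cylinders[OF assms, of "\<lambda>t. - f t" B]) auto
    ultimately show "eventually (\<lambda>n. dist (\<integral>\<omega>. f (X n \<omega>) \<partial>N n) (\<integral>\<omega>. f (Y \<omega>) \<partial>M) < e) sequentially"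
      by eventually_elim (use e in \<open>auto simp: dist_real_def abs_less_iff\<close>)
  qed
qed

section \<open>Probability generating functions\<close>

text \<open>
The generating function takes values in the extended nonnegative reals, where the formulas for
compositions and products hold without integrability conditions.
\<close>

definition pgf :: "nat pmf \<Rightarrow> ennreal \<Rightarrow> ennreal" where
  "pgf p x = (\<integral>\<^sup>+k. x ^ k \<partial>measure_pmf p)"

lemma pgf_eq_suminf:
  assumes "0 \<le> s"
  shows "pgf p (ennreal s) = (\<Sum>k. ennreal (pmf p k * s ^ k))"
  using assms
  by (simp add: pgf_def nn_integral_measure_pmf nn_integral_count_space_nat ennreal_mult ennreal_power)

lemma pgf_eqI_sums:
  assumes "0 \<le> s" "(\<lambda>k. pmf p k * s ^ k) sums v"
  shows "pgf p (ennreal s) = ennreal v"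
  unfolding pgf_eq_suminf[OF assms(1)] using assms by (intro suminf_ennreal_eq) auto

lemma pgf_bind: "pgf (bind_pmf p K) x = (\<integral>\<^sup>+y. pgf (K y) x \<partial>p)"
  by (simp add: pgf_def)

lemma summable_pmf_power:
  assumes "\<bar>x\<bar> < 1"
  shows "summable (\<lambda>k. pmf p k * x ^ k)"
proof (rule summable_comparison_test)
  show "\<exists>N. \<forall>n\<ge>N. norm (pmf p n * x ^ n) \<le> \<bar>x\<bar> ^ n"
  proof (intro exI[of _ 0] allI impI)
    fix n
    have "pmf p n * \<bar>x\<bar> ^ n \<le> \<bar>x\<bar> ^ n"
      by (intro mult_left_le_one_le) (auto simp: pmf_le_1)
    then show "norm (pmf p n * x ^ n) \<le> \<bar>x\<bar> ^ n"
      by (simp add: abs_mult power_abs)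
  qed
  show "summable (\<lambda>n. \<bar>x\<bar> ^ n)"
    using assms by (intro summable_geometric) simp
qed

text \<open>
If all the coefficients before \<open>d m\<close> vanish, then \<open>d m\<close> is the limit at \<open>0\<close> from the right of the series
divided by \<open>x ^ m\<close>.
\<close>

lemma power_series_eq_0:
  fixes d :: "nat \<Rightarrow> real"
  assumes summable: "\<And>x. \<bar>x\<bar> < 1 \<Longrightarrow> summable (\<lambda>k. d k * x ^ k)"
    and zero: "\<And>x. 0 < x \<Longrightarrow> x < 1 \<Longrightarrow> (\<Sum>k. d k * x ^ k) = 0"
  shows "d m = 0"
proof (induction m rule: less_induct)
  case (less m)
  define g where "g x = (\<Sum>k. d (k + m) * x ^ k)" for x
  have g: "(\<lambda>k. d (k + m) * x ^ k) sums g x" "g x * x ^ m = (\<Sum>k. d k * x ^ k)" if "\<bar>x\<bar> < 1" "x \<noteq> 0" for x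
  proof -
    have s: "summable (\<lambda>k. d (k + m) * x ^ (k + m))"
      using summable[OF that(1)] by (subst summable_iff_shift)
    have "summable (\<lambda>k. d (k + m) * x ^ (k + m) * inverse (x ^ m))"
      using s by (rule summable_mult2)
    then have s': "summable (\<lambda>k. d (k + m) * x ^ k)"
      using that(2) by (simp add: power_add field_simps)
    then show "(\<lambda>k. d (k + m) * x ^ k) sums g x"
      unfolding g_def by (rule summable_sums)
    have "g x * x ^ m = (\<Sum>k. d (k + m) * x ^ k * x ^ m)"
      unfolding g_def using s' by (rule suminf_mult2)
    also have "\<dots> = (\<Sum>k. d (k + m) * x ^ (k + m))"
      by (simp add: power_add mult.assoc)
    also have "\<dots> = (\<Sum>k. d k * x ^ k)"
      using suminf_split_initial_segment[OF summable[OF that(1)], of m] less by simp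
    finally show "g x * x ^ m = (\<Sum>k. d k * x ^ k)" .
  qed
  have "(g \<longlongrightarrow> d (0 + m)) (at 0)"
    by (rule powser_limit_0_strong[of 1]) (use g in auto)
  then have "(g \<longlongrightarrow> d m) (at_right 0)"
    using filterlim_at_split by auto
  moreover have "eventually (\<lambda>x. g x = 0) (at_right 0)"
    unfolding eventually_at_right_field
  proof (intro exI[of _ 1] conjI allI impI)
    fix x :: real
    assume x: "0 < x" "x < 1"
    then have "g x * x ^ m = 0"
      using g(2)[of x] zero[of x] by simp
    then show "g x = 0"
      using x by simp
  qed simp
  then have "(g \<longlongrightarrow> 0) (at_right 0)"
    by (rule tendsto_eventually)
  ultimately show "d m = 0"
    using tendsto_unique trivial_limit_at_right_real by blast
qed

lemma pmf_eqI_pgf: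
  assumes "\<And>s. 0 < s \<Longrightarrow> s < 1 \<Longrightarrow> pgf p (ennreal s) = pgf p' (ennreal s)"
  shows "p = p'"
proof (rule pmf_eqI)
  fix m
  have "pmf p m - pmf p' m = 0"
  proof (rule power_series_eq_0[where d = "\<lambda>k. pmf p k - pmf p' k"])
    fix x :: real
    assume x: "\<bar>x\<bar> < 1"
    show "summable (\<lambda>k. (pmf p k - pmf p' k) * x ^ k)"
      using summable_diff[OF summable_pmf_power[OF x, of p] summable_pmf_power[OF x, of p']]
      by (simp add: left_diff_distrib)
  next
    fix x :: real
    assume x: "0 < x" "x < 1"
    then have s: "summable (\<lambda>k. pmf p k * x ^ k)" for p
      by (intro summable_pmf_power) simp
    have "ennreal (\<Sum>k. pmf p k * x ^ k) = ennreal (\<Sum>k. pmf p' k * x ^ k)"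
      using assms[OF x] pgf_eqI_sums[OF _ summable_sums[OF s]] x by simp
    then have "(\<Sum>k. pmf p k * x ^ k) = (\<Sum>k. pmf p' k * x ^ k)"
      using x s by (subst (asm) ennreal_inj) (auto intro!: suminf_nonneg)
    then show "(\<Sum>k. (pmf p k - pmf p' k) * x ^ k) = 0"
      using suminf_diff[OF s s, of p p'] by (simp add: left_diff_distrib)
  qed
  then show "pmf p m = pmf p' m"
    by simp
qed

section \<open>Sums of independent zero-modified geometric variables\<close>

text \<open>
The law of the sum of \<open>z\<close> independent variables that are \<open>0\<close> with probability \<open>1 - \<alpha>\<close> and otherwise
geometric on the positive integers with parameter \<open>\<beta>\<close>: if \<open>m\<close> of them are positive, their sum exceeds \<open>m\<close>
by a negative binomial variable.
\<close>

definition zero_modified_geometric_sum :: "real \<Rightarrow> real \<Rightarrow> nat \<Rightarrow> nat pmf" where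
  "zero_modified_geometric_sum \<alpha> \<beta> z =
     bind_pmf (binomial_pmf z \<alpha>) (\<lambda>m. map_pmf (\<lambda>k. k + m) (neg_binomial_pmf m \<beta>))"

lemma pgf_geometric:
  assumes "0 < \<beta>" "\<beta> \<le> 1" "0 \<le> s" "s < 1"
  shows "pgf (geometric_pmf \<beta>) (ennreal s) = ennreal (\<beta> / (1 - (1 - \<beta>) * s))"
proof (rule pgf_eqI_sums[OF assms(3)])
  have "(1 - \<beta>) * s < 1"
    using assms mult_left_le_one_le[of s "1 - \<beta>"] by simp
  moreover have "0 \<le> (1 - \<beta>) * s"
    using assms by simp
  ultimately have "(\<lambda>k. \<beta> * ((1 - \<beta>) * s) ^ k) sums (\<beta> * (1 / (1 - (1 - \<beta>) * s)))"
    by (intro sums_mult geometric_sums) simp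
  then show "(\<lambda>k. pmf (geometric_pmf \<beta>) k * s ^ k) sums (\<beta> / (1 - (1 - \<beta>) * s))"
    using assms by (simp add: power_mult_distrib mult_ac)
qed

lemma pgf_neg_binomial: "pgf (neg_binomial_pmf m \<beta>) x = pgf (geometric_pmf \<beta>) x ^ m"
proof (induction m)
  case (Suc m)
  then show ?case
    by (simp add: pgf_def neg_binomial_pmf_Suc nn_integral_pair_pmf' case_prod_unfold power_add
        nn_integral_cmult nn_integral_multc)
qed (simp add: pgf_def)

lemma pgf_binomial:
  assumes "\<alpha> \<in> {0..1}" "0 \<le> s"
  shows "pgf (binomial_pmf z \<alpha>) (ennreal s) = ennreal ((1 - \<alpha> + \<alpha> * s) ^ z)"
proof (rule pgf_eqI_sums[OF assms(2)])
  have "(\<lambda>k. pmf (binomial_pmf z \<alpha>) k * s ^ k) sums (\<Sum>k\<le>z. pmf (binomial_pmf z \<alpha>) k * s ^ k)"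
    using assms by (intro sums_finite) auto
  also have "(\<Sum>k\<le>z. pmf (binomial_pmf z \<alpha>) k * s ^ k) = (\<alpha> * s + (1 - \<alpha>)) ^ z"
    using assms by (subst binomial_ring) (auto simp: power_mult_distrib mult_ac intro!: sum.cong)
  finally show "(\<lambda>k. pmf (binomial_pmf z \<alpha>) k * s ^ k) sums ((1 - \<alpha> + \<alpha> * s) ^ z)"
    by (simp add: add.commute)
qed

text \<open>
The generating function of one of the independent summands, that is, of the case \<open>z = 1\<close>.
\<close>

definition zero_modified_geom_pgf :: "real \<Rightarrow> real \<Rightarrow> real \<Rightarrow> real" where
  "zero_modified_geom_pgf \<alpha> \<beta> s = 1 - \<alpha> + \<alpha> * \<beta> * s / (1 - (1 - \<beta>) * s)"

lemma pgf_zero_modified_geometric_sum: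
  assumes "0 \<le> \<alpha>" "\<alpha> \<le> 1" "0 < \<beta>" "\<beta> \<le> 1" "0 \<le> s" "s < 1"
  shows "pgf (zero_modified_geometric_sum \<alpha> \<beta> z) (ennreal s) = ennreal (zero_modified_geom_pgf \<alpha> \<beta> s) ^ z"
proof -
  let ?g = "\<beta> / (1 - (1 - \<beta>) * s)"
  have d: "0 < 1 - (1 - \<beta>) * s"
    using assms mult_left_le_one_le[of s "1 - \<beta>"] by simp
  have "pgf (zero_modified_geometric_sum \<alpha> \<beta> z) (ennreal s) =
      (\<integral>\<^sup>+m. pgf (neg_binomial_pmf m \<beta>) (ennreal s) * ennreal s ^ m \<partial>binomial_pmf z \<alpha>)"
    by (simp add: zero_modified_geometric_sum_def pgf_bind)
       (simp add: pgf_def power_add nn_integral_multc)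
  also have "\<dots> = (\<integral>\<^sup>+m. ennreal (s * ?g) ^ m \<partial>binomial_pmf z \<alpha>)"
    by (simp add: pgf_neg_binomial pgf_geometric[OF assms(3-6)] ennreal_mult'[OF assms(5)]
        power_mult_distrib mult.commute del: times_divide_eq_right)
  also have "\<dots> = pgf (binomial_pmf z \<alpha>) (ennreal (s * ?g))"
    by (simp add: pgf_def)
  also have "\<dots> = ennreal ((1 - \<alpha> + \<alpha> * (s * ?g)) ^ z)"
    using assms d by (intro pgf_binomial) auto
  also have "1 - \<alpha> + \<alpha> * (s * ?g) = zero_modified_geom_pgf \<alpha> \<beta> s"
    by (simp add: zero_modified_geom_pgf_def mult_ac)
  also have "ennreal (zero_modified_geom_pgf \<alpha> \<beta> s ^ z) = ennreal (zero_modified_geom_pgf \<alpha> \<beta> s) ^ z"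
    using assms d by (intro ennreal_power[symmetric]) (simp add: zero_modified_geom_pgf_def)
  finally show ?thesis .
qed

lemma pmf_zero_modified_geometric_sum:
  assumes "0 \<le> \<alpha>" "\<alpha> \<le> 1" "0 < \<beta>" "\<beta> \<le> 1" "a \<ge> 1"
  shows "pmf (zero_modified_geometric_sum \<alpha> \<beta> z) a =
    (\<Sum>m\<in>{1..z}. real (z choose m) * \<alpha> ^ m * (1 - \<alpha>) ^ (z - m) *
       (if m \<le> a then real ((a - 1) choose (m - 1)) * \<beta> ^ m * (1 - \<beta>) ^ (a - m) else 0))"
proof -
  have nb: "pmf (map_pmf (\<lambda>k. k + m) (neg_binomial_pmf m \<beta>)) a =
      (if 1 \<le> m \<and> m \<le> a then real ((a - 1) choose (m - 1)) * \<beta> ^ m * (1 - \<beta>) ^ (a - m) else 0)" for m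
  proof (cases "m \<le> a")
    case True
    then obtain k where a: "a = k + m"
      by (metis add.commute le_Suc_ex)
    have "pmf (map_pmf (\<lambda>k. k + m) (neg_binomial_pmf m \<beta>)) a = pmf (neg_binomial_pmf m \<beta>) k"
      unfolding a by (rule pmf_map_inj') (auto simp: inj_def)
    also have "\<dots> = real ((a - 1) choose k) * \<beta> ^ m * (1 - \<beta>) ^ (a - m)"
      using assms by (subst pmf_neg_binomial) (auto simp: a)
    also have "(a - 1) choose k = (if m \<ge> 1 then (a - 1) choose (m - 1) else 0)"
      using assms(5) a binomial_symmetric[of k "a - 1"] by auto
    finally show ?thesis
      using True by auto
  next
    case False
    then show ?thesis
      by (auto simp: pmf_eq_0_set_pmf)
  qed
  have "pmf (zero_modified_geometric_sum \<alpha> \<beta> z) a =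
      (\<Sum>m\<le>z. real (z choose m) * \<alpha> ^ m * (1 - \<alpha>) ^ (z - m) *
       (if 1 \<le> m \<and> m \<le> a then real ((a - 1) choose (m - 1)) * \<beta> ^ m * (1 - \<beta>) ^ (a - m) else 0))"
    using assms by (simp add: zero_modified_geometric_sum_def pmf_bind nb expectation_binomial_pmf')
  also have "\<dots> = (\<Sum>m\<in>{1..z}. real (z choose m) * \<alpha> ^ m * (1 - \<alpha>) ^ (z - m) *
       (if m \<le> a then real ((a - 1) choose (m - 1)) * \<beta> ^ m * (1 - \<beta>) ^ (a - m) else 0))"
    by (intro sum.mono_neutral_cong_right) auto
  finally show ?thesis .
qed

section \<open>Iterates of the linear fractional generating function\<close>

text \<open>
The \<open>n\<close>-th iterate \<open>f\<^sub>n\<close> of the generating function of the offspring distribution satisfies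
\<open>1 / (1 - f\<^sub>n(s)) = slope \<sigma> + shift\<close> with \<open>\<sigma> = 1 / (1 - s)\<close>. The slope is the inverse of the mean of \<open>Z\<^sub>n\<close>, and
composing affine maps makes the shift a geometric sum.
\<close>

definition slope :: "real \<Rightarrow> real \<Rightarrow> nat \<Rightarrow> real" where
  "slope \<eta> q n = (q / \<eta>) ^ n"

definition shift :: "real \<Rightarrow> real \<Rightarrow> nat \<Rightarrow> real" where
  "shift \<eta> q n = (1 - q) / \<eta> * (\<Sum>j<n. (q / \<eta>) ^ j)"

text \<open>
The value of \<open>1 - f\<^sub>n\<close> at \<open>0\<close>, that is, the probability of \<open>Z\<^sub>n > 0\<close>.
\<close>

definition survival_prob :: "real \<Rightarrow> real \<Rightarrow> nat \<Rightarrow> real" where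
  "survival_prob \<eta> q n = 1 / (slope \<eta> q n + shift \<eta> q n)"

text \<open>
The parameter of the geometric law of \<open>Z\<^sub>n\<close> on survival.
\<close>

definition geom_param :: "real \<Rightarrow> real \<Rightarrow> nat \<Rightarrow> real" where
  "geom_param \<eta> q n = slope \<eta> q n / (slope \<eta> q n + shift \<eta> q n)"

definition iterate_pgf :: "real \<Rightarrow> real \<Rightarrow> nat \<Rightarrow> real \<Rightarrow> real" where
  "iterate_pgf \<eta> q n s = zero_modified_geom_pgf (survival_prob \<eta> q n) (geom_param \<eta> q n) s"

context
  fixes \<eta> q :: real
  assumes eta: "0 < \<eta>" "\<eta> \<le> 1" and q: "0 < q" "q < 1"
begin

lemma slope_pos: "slope \<eta> q n > 0"
  using eta q by (simp add: slope_def)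

lemma shift_nonneg: "shift \<eta> q n \<ge> 0"
  using eta q by (simp add: shift_def sum_nonneg)

lemma shift_pos: "n > 0 \<Longrightarrow> shift \<eta> q n > 0"
  unfolding shift_def using eta q by (intro mult_pos_pos sum_pos) auto

lemma geom_param_pos: "geom_param \<eta> q n > 0"
  using slope_pos[of n] shift_nonneg[of n] by (simp add: geom_param_def)

lemma geom_param_le_1: "geom_param \<eta> q n \<le> 1"
  using slope_pos[of n] shift_nonneg[of n] by (simp add: geom_param_def)

lemma geom_param_less_1: "n > 0 \<Longrightarrow> geom_param \<eta> q n < 1"
  using slope_pos[of n] shift_pos[of n] by (simp add: geom_param_def)

lemma one_minus_geom_param: "1 - geom_param \<eta> q n = shift \<eta> q n / (slope \<eta> q n + shift \<eta> q n)"
  using slope_pos[of n] shift_nonneg[of n] by (simp add: geom_param_def field_simps)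

lemma survival_prob_pos: "survival_prob \<eta> q n > 0"
  using slope_pos[of n] shift_nonneg[of n] by (simp add: survival_prob_def)

lemma slope_Suc: "slope \<eta> q (Suc n) = q / \<eta> * slope \<eta> q n"
  by (simp add: slope_def)

lemma shift_Suc: "shift \<eta> q (Suc n) = shift \<eta> q n + (1 - q) / \<eta> * slope \<eta> q n"
  by (simp add: shift_def slope_def distrib_left)

lemma slope_plus_shift_ge_1: "slope \<eta> q n + shift \<eta> q n \<ge> 1"
proof (induction n)
  case 0
  then show ?case
    by (simp add: slope_def shift_def)
next
  case (Suc n)
  have "slope \<eta> q (Suc n) + shift \<eta> q (Suc n) = shift \<eta> q n + slope \<eta> q n / \<eta>"
    using eta by (simp add: slope_Suc shift_Suc field_simps)
  also have "\<dots> \<ge> shift \<eta> q n + slope \<eta> q n"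
    using slope_pos[of n] eta by (simp add: le_divide_eq)
  finally show ?case
    using Suc by simp
qed

lemma survival_prob_le_1: "survival_prob \<eta> q n \<le> 1"
  using slope_plus_shift_ge_1[of n] by (simp add: survival_prob_def)

text \<open>
The affine form of the iterate in the variable \<open>1 / (1 - s)\<close>; the computation uses \<open>x = 1 - s\<close>.
\<close>

lemma one_minus_iterate_pgf:
  assumes "0 \<le> s" "s < 1"
  shows "1 - iterate_pgf \<eta> q n s = 1 / (slope \<eta> q n / (1 - s) + shift \<eta> q n)"
proof -
  let ?M = "slope \<eta> q n" and ?N = "shift \<eta> q n"
  have pos: "?M > 0" "?N \<ge> 0" "1 - s > 0"
    using slope_pos shift_nonneg assms by auto
  have gen: "1 - (1 - 1 / (M + N) + 1 / (M + N) * (M / (M + N)) * (1 - x) / (1 - N / (M + N) * (1 - x))) =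
      1 / (M / x + N)" if "M > 0" "N \<ge> 0" "x > 0" for M N x :: real
  proof -
    have D: "M + N > 0" "M + N * x > 0"
      using that by (auto intro: add_pos_nonneg)
    have "1 - N / (M + N) * (1 - x) = (M + N * x) / (M + N)"
      using D by (simp add: field_simps)
    then have "1 - (1 - 1 / (M + N) + 1 / (M + N) * (M / (M + N)) * (1 - x) / (1 - N / (M + N) * (1 - x))) =
        1 / (M + N) - M * (1 - x) / ((M + N) * (M + N * x))"
      using D by simp
    also have "\<dots> = ((M + N * x) - M * (1 - x)) / ((M + N) * (M + N * x))"
      using D by (simp add: diff_divide_distrib)
    also have "(M + N * x) - M * (1 - x) = (M + N) * x"
      by (simp add: algebra_simps)
    also have "(M + N) * x / ((M + N) * (M + N * x)) = 1 / ((M + N * x) / x)"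
      using D by simp
    also have "(M + N * x) / x = M / x + N"
      using that by (simp add: field_simps)
    finally show ?thesis .
  qed
  show ?thesis
    using gen[OF pos] by (simp add: iterate_pgf_def zero_modified_geom_pgf_def one_minus_geom_param)
      (simp add: survival_prob_def geom_param_def)
qed

lemma iterate_pgf_0: "0 \<le> s \<Longrightarrow> s < 1 \<Longrightarrow> iterate_pgf \<eta> q 0 s = s"
  using one_minus_iterate_pgf[of s 0] by (simp add: slope_def shift_def)

lemma iterate_pgf_bounds:
  assumes "0 \<le> s" "s < 1"
  shows "0 \<le> iterate_pgf \<eta> q n s" "iterate_pgf \<eta> q n s < 1"
proof -
  have "slope \<eta> q n / (1 - s) + shift \<eta> q n \<ge> slope \<eta> q n + shift \<eta> q n"
    using slope_pos[of n] assms by (simp add: le_divide_eq mult_left_le)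
  then have "slope \<eta> q n / (1 - s) + shift \<eta> q n \<ge> 1"
    using slope_plus_shift_ge_1[of n] by linarith
  then have "0 < 1 - iterate_pgf \<eta> q n s" "1 - iterate_pgf \<eta> q n s \<le> 1"
    by (auto simp: one_minus_iterate_pgf[OF assms])
  then show "0 \<le> iterate_pgf \<eta> q n s" "iterate_pgf \<eta> q n s < 1"
    by auto
qed

text \<open>
Iteration becomes composition of affine maps.
\<close>

lemma iterate_pgf_Suc:
  assumes "0 \<le> s" "s < 1"
  shows "iterate_pgf \<eta> q (Suc n) s = iterate_pgf \<eta> q n (iterate_pgf \<eta> q 1 s)"
proof -
  have "1 / (1 - iterate_pgf \<eta> q 1 s) = slope \<eta> q 1 / (1 - s) + shift \<eta> q 1"
    by (simp add: one_minus_iterate_pgf[OF assms])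
  then have "slope \<eta> q n / (1 - iterate_pgf \<eta> q 1 s) + shift \<eta> q n =
      slope \<eta> q n * (slope \<eta> q 1 / (1 - s) + shift \<eta> q 1) + shift \<eta> q n"
    by (metis divide_inverse mult_1 inverse_eq_divide)
  also have "\<dots> = slope \<eta> q (Suc n) / (1 - s) + shift \<eta> q (Suc n)"
    by (simp add: slope_Suc shift_Suc algebra_simps)
       (simp add: slope_def shift_def)
  finally have "1 - iterate_pgf \<eta> q n (iterate_pgf \<eta> q 1 s) = 1 - iterate_pgf \<eta> q (Suc n) s"
    by (simp add: one_minus_iterate_pgf iterate_pgf_bounds assms)
  then show ?thesis
    by simp
qed

lemma pgf_geom_offspring:
  assumes "0 \<le> s" "s < 1"
  shows "pgf (geom_offspring \<eta> q) (ennreal s) = ennreal (iterate_pgf \<eta> q 1 s)"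
proof (rule pgf_eqI_sums[OF assms(1)])
  have "(1 - q) * s < 1" "0 \<le> (1 - q) * s"
    using assms q mult_left_le_one_le[of s "1 - q"] by auto
  then have "(\<lambda>k. \<eta> * q * s * ((1 - q) * s) ^ k) sums (\<eta> * q * s * (1 / (1 - (1 - q) * s)))"
    by (intro sums_mult geometric_sums) simp
  also have "(\<lambda>k. \<eta> * q * s * ((1 - q) * s) ^ k) = (\<lambda>k. pmf (geom_offspring \<eta> q) (Suc k) * s ^ Suc k)"
    using eta q by (auto simp: pmf_geom_offspring power_mult_distrib)
  finally have "(\<lambda>k. pmf (geom_offspring \<eta> q) k * s ^ k) sums
      (\<eta> * q * s * (1 / (1 - (1 - q) * s)) + pmf (geom_offspring \<eta> q) 0 * s ^ 0)"
    by (rule sums_Suc)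
  moreover have "survival_prob \<eta> q 1 = \<eta>" "geom_param \<eta> q 1 = q"
    using eta q by (auto simp: survival_prob_def geom_param_def slope_def shift_def field_simps)
  ultimately show "(\<lambda>k. pmf (geom_offspring \<eta> q) k * s ^ k) sums iterate_pgf \<eta> q 1 s"
    using eta q by (simp add: iterate_pgf_def zero_modified_geom_pgf_def pmf_geom_offspring add.commute)
qed

end

section \<open>The truncated Galton-Watson tree\<close>

definition gw_step :: "nat pmf \<Rightarrow> nat \<Rightarrow> word set \<Rightarrow> word set pmf" where
  "gw_step p h t = map_pmf (add_generation h t) (Pi_pmf (level h t) 0 (\<lambda>_. p))"

text \<open>
The law at height \<open>h + j\<close> of the Galton-Watson tree whose truncation at height \<open>h\<close> is \<open>t\<close>.
\<close>

primrec gw_from :: "nat pmf \<Rightarrow> nat \<Rightarrow> nat \<Rightarrow> word set \<Rightarrow> word set pmf" where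
  "gw_from p h 0 t = return_pmf t"
| "gw_from p h (Suc j) t = bind_pmf (gw_from p h j t) (gw_step p (h + j))"

lemma set_gw_step: "t' \<in> set_pmf (gw_step p h t) \<Longrightarrow> t \<in> trees_upto h \<Longrightarrow>
    \<exists>k. t' = add_generation h t k \<and> (\<forall>u. u \<notin> level h t \<longrightarrow> k u = 0)"
  using set_Pi_pmf_subset[OF finite_level_trees_upto[of t h], of 0 "\<lambda>_. p"]
  by (auto simp: gw_step_def)

lemma set_gw_from:
  assumes "t \<in> trees_upto h" "t' \<in> set_pmf (gw_from p h j t)"
  shows "t' \<in> trees_upto (h + j) \<and> restrict_height h t' = t"
  using assms(2)
proof (induction j arbitrary: t')
  case 0
  then show ?case
    using assms(1) by (simp add: restrict_height_trees_upto)
next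
  case (Suc j)
  then obtain t1 where t1: "t1 \<in> set_pmf (gw_from p h j t)" "t' \<in> set_pmf (gw_step p (h + j) t1)"
    by auto
  note IH = Suc.IH[OF t1(1)]
  obtain k where k: "t' = add_generation (h + j) t1 k"
    using set_gw_step[OF t1(2)] IH by blast
  have "restrict_height h t' = restrict_height h (restrict_height (h + j) t')"
    by (simp add: restrict_height_restrict_height)
  then show ?case
    using IH by (simp add: k add_generation_in_trees_upto restrict_height_add_generation)
qed

lemma gw_from_add: "gw_from p h (i + j) t = bind_pmf (gw_from p h i t) (gw_from p (h + i) j)"
  by (induction j) (simp_all add: bind_return_pmf' bind_assoc_pmf add.assoc)

lemma pgf_card_gw_step:
  assumes "t \<in> trees_upto h"
  shows "pgf (map_pmf (\<lambda>t'. card (level (Suc h) t')) (gw_step p h t)) x = pgf p x ^ card (level h t)"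
proof -
  have "pgf (map_pmf (\<lambda>t'. card (level (Suc h) t')) (gw_step p h t)) x =
      (\<integral>\<^sup>+k. (\<Prod>u\<in>level h t. x ^ k u) \<partial>Pi_pmf (level h t) 0 (\<lambda>_. p))"
    using assms by (simp add: pgf_def gw_step_def card_level_Suc_add_generation power_sum)
  also have "\<dots> = pgf p x ^ card (level h t)"
    using finite_level_trees_upto[OF assms] by (subst nn_integral_prod_Pi_pmf) (auto simp: pgf_def)
  finally show ?thesis .
qed

text \<open>
The last generation is removed first: averaging over it replaces the argument \<open>s\<close> by its image under the
offspring generating function.
\<close>

lemma pgf_card_gw_from:
  assumes "0 < \<eta>" "\<eta> \<le> 1" "0 < q" "q < 1" "t \<in> trees_upto h" "0 \<le> s" "s < 1"
  shows "pgf (map_pmf (\<lambda>t'. card (level (h + j) t')) (gw_from (geom_offspring \<eta> q) h j t)) (ennreal s) =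
    ennreal (iterate_pgf \<eta> q j s) ^ card (level h t)"
  using assms(6,7)
proof (induction j arbitrary: s)
  case 0
  then show ?case
    using assms by (simp add: iterate_pgf_0 pgf_def)
next
  case (Suc j)
  let ?p = "geom_offspring \<eta> q"
  have "pgf (map_pmf (\<lambda>t'. card (level (h + Suc j) t')) (gw_from ?p h (Suc j) t)) (ennreal s) =
      (\<integral>\<^sup>+t'. pgf (map_pmf (\<lambda>t'. card (level (Suc (h + j)) t')) (gw_step ?p (h + j) t')) (ennreal s)
         \<partial>gw_from ?p h j t)"
    by (simp add: map_bind_pmf pgf_bind)
  also have "\<dots> = (\<integral>\<^sup>+t'. ennreal (iterate_pgf \<eta> q 1 s) ^ card (level (h + j) t') \<partial>gw_from ?p h j t)"
  proof (intro nn_integral_cong_AE AE_pmfI)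
    fix t'
    assume "t' \<in> set_pmf (gw_from ?p h j t)"
    then have "t' \<in> trees_upto (h + j)"
      using set_gw_from assms(5) by blast
    then show "pgf (map_pmf (\<lambda>t'. card (level (Suc (h + j)) t')) (gw_step ?p (h + j) t')) (ennreal s) =
        ennreal (iterate_pgf \<eta> q 1 s) ^ card (level (h + j) t')"
      using pgf_geom_offspring[OF assms(1-4) Suc.prems] by (simp add: pgf_card_gw_step)
  qed
  also have "\<dots> = pgf (map_pmf (\<lambda>t'. card (level (h + j) t')) (gw_from ?p h j t)) (ennreal (iterate_pgf \<eta> q 1 s))"
    by (simp add: pgf_def)
  also have "\<dots> = ennreal (iterate_pgf \<eta> q j (iterate_pgf \<eta> q 1 s)) ^ card (level h t)"
    by (intro Suc.IH iterate_pgf_bounds assms(1-4) Suc.prems)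
  also have "iterate_pgf \<eta> q j (iterate_pgf \<eta> q 1 s) = iterate_pgf \<eta> q (Suc j) s"
    by (rule iterate_pgf_Suc[OF assms(1-4) Suc.prems, symmetric])
  finally show ?case .
qed

lemma law_of_generation_size:
  assumes "0 < \<eta>" "\<eta> \<le> 1" "0 < q" "q < 1" "t \<in> trees_upto h"
  shows "map_pmf (\<lambda>t'. card (level (h + j) t')) (gw_from (geom_offspring \<eta> q) h j t) =
    zero_modified_geometric_sum (survival_prob \<eta> q j) (geom_param \<eta> q j) (card (level h t))"
proof (rule pmf_eqI_pgf)
  fix s :: real
  assume s: "0 < s" "s < 1"
  have "pgf (zero_modified_geometric_sum (survival_prob \<eta> q j) (geom_param \<eta> q j) (card (level h t))) (ennreal s) =
      ennreal (iterate_pgf \<eta> q j s) ^ card (level h t)"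
    unfolding iterate_pgf_def
    using s survival_prob_pos[OF assms(1-4)] survival_prob_le_1[OF assms(1-4)] geom_param_pos[OF assms(1-4)]
      geom_param_le_1[OF assms(1-4)]
    by (intro pgf_zero_modified_geometric_sum) (auto intro: less_imp_le)
  then show "pgf (map_pmf (\<lambda>t'. card (level (h + j) t')) (gw_from (geom_offspring \<eta> q) h j t)) (ennreal s) =
      pgf (zero_modified_geometric_sum (survival_prob \<eta> q j) (geom_param \<eta> q j) (card (level h t))) (ennreal s)"
    using s by (simp add: pgf_card_gw_from assms)
qed

text \<open>
When the outcome \<open>y\<close> determines the intermediate value, its probability is a single product. All the
explicit probabilities of trees below rest on this.
\<close>

lemma pmf_bind_unique_source:
  assumes "\<And>x'. x' \<in> set_pmf p \<Longrightarrow> y \<in> set_pmf (K x') \<Longrightarrow> x' = x"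
  shows "pmf (bind_pmf p K) y = pmf p x * pmf (K x) y"
proof -
  have "pmf (bind_pmf p K) y = (\<integral>x'. pmf (K x') y \<partial>p)"
    by (rule pmf_bind)
  also have "\<dots> = (\<Sum>x'\<in>{x}. pmf p x' *\<^sub>R pmf (K x') y)"
    using assms by (intro integral_measure_pmf) (auto simp: set_pmf_iff)
  finally show ?thesis
    by simp
qed

text \<open>
A tree in the support determines its truncation and the numbers of children of the last generation, so
its probability factorises over the vertices.
\<close>

lemma pmf_gw_law_eq_weight_on_support:
  assumes "t \<in> set_pmf (gw_from p 0 n {[]})"
  shows "pmf (gw_from p 0 n {[]}) t = gw_weight p n t"
  using assms
proof (induction n arbitrary: t)
  case 0
  then show ?case
    by (simp add: gw_weight_def)
next
  case (Suc n)
  then obtain t1 where t1: "t1 \<in> set_pmf (gw_from p 0 n {[]})" "t \<in> set_pmf (gw_step p n t1)"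
    by auto
  have tree: "t' \<in> trees_upto n" if "t' \<in> set_pmf (gw_from p 0 n {[]})" for t'
    using set_gw_from[OF root_in_trees_upto_0 that] by simp
  obtain k where k: "t = add_generation n t1 k" "\<And>u. u \<notin> level n t1 \<Longrightarrow> k u = 0"
    using set_gw_step[OF t1(2) tree[OF t1(1)]] by blast
  have "pmf (gw_from p 0 (Suc n) {[]}) t = pmf (gw_from p 0 n {[]}) t1 * pmf (gw_step p n t1) t"
    unfolding gw_from.simps add_0
  proof (rule pmf_bind_unique_source)
    fix t2
    assume t2: "t2 \<in> set_pmf (gw_from p 0 n {[]})" "t \<in> set_pmf (gw_step p n t2)"
    obtain k' where "t = add_generation n t2 k'"
      using set_gw_step[OF t2(2) tree[OF t2(1)]] by blast
    then have "t2 = restrict_height n t"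
      using restrict_height_add_generation[OF tree[OF t2(1)]] by simp
    then show "t2 = t1"
      using restrict_height_add_generation[OF tree[OF t1(1)]] k(1) by simp
  qed
  also have "pmf (gw_step p n t1) t = pmf (Pi_pmf (level n t1) 0 (\<lambda>_. p)) k"
    unfolding gw_step_def map_pmf_def
  proof (subst pmf_bind_unique_source[where x = k])
    fix k'
    assume k': "k' \<in> set_pmf (Pi_pmf (level n t1) 0 (\<lambda>_. p))" "t \<in> set_pmf (return_pmf (add_generation n t1 k'))"
    then have "\<And>u. u \<notin> level n t1 \<Longrightarrow> k' u = 0"
      using set_Pi_pmf_subset[OF finite_level_trees_upto[OF tree[OF t1(1)]], of 0 "\<lambda>_. p"] by auto
    then show "k' = k"
      using k k'(2) by (intro add_generation_inject[OF tree[OF t1(1)]]) auto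
  qed (simp add: k(1))
  also have "\<dots> = (\<Prod>u\<in>level n t1. pmf p (k u))"
    using k(2) finite_level_trees_upto[OF tree[OF t1(1)]] by (simp add: pmf_Pi')
  finally show ?case
    by (simp add: Suc.IH[OF t1(1)] k(1) gw_weight_add_generation[OF tree[OF t1(1)]])
qed

lemma galton_watson_cylinder:
  assumes "galton_watson p M \<tau>" "t \<in> trees_upto h" "h \<ge> 1"
  shows "measure M {\<omega>\<in>space M. restrict_height h (\<tau> \<omega>) = t} = gw_weight p h t"
proof -
  have "restrict_height (h - 1) t = {u \<in> t. length u < h}"
    using assms(3) by (auto simp: restrict_height_def)
  then show ?thesis
    using assms trees_upto_locally_finite[OF assms(2)]
    by (simp add: galton_watson_def gw_weight_def child_count_def)
qed

text \<open>
Both laws give the same probability to every tree in the support of the second one. This support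
has full mass, so the laws agree. The event on the left is measurable because truncations of locally
finite trees are finite sets of words, of which there are countably many.
\<close>

lemma galton_watson_restrict_height:
  assumes gw: "galton_watson p M \<tau>" and n: "n \<ge> 1"
  shows "measure M {\<omega>\<in>space M. Q (restrict_height n (\<tau> \<omega>))} = measure (gw_from p 0 n {[]}) {t. Q t}"
proof -
  let ?G = "gw_from p 0 n {[]}"
  have \<tau>: "random_tree M \<tau>" "\<And>\<omega>. \<omega> \<in> space M \<Longrightarrow> \<tau> \<omega> \<in> locally_finite_trees"
    using gw by (auto simp: galton_watson_def)
  interpret prob_space M
    using \<tau>(1) by (simp add: random_tree_def)
  have cyl [measurable]: "{\<omega>\<in>space M. restrict_height n (\<tau> \<omega>) = t} \<in> sets M" for t
    using \<tau>(1) by (intro sets_restrict_height_tree_eq) (simp add: random_tree_def)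
  have UN: "{\<omega>\<in>space M. restrict_height n (\<tau> \<omega>) \<in> A} = (\<Union>t\<in>A. {\<omega>\<in>space M. restrict_height n (\<tau> \<omega>) = t})" for A
    by auto
  have sets_A [measurable]: "{\<omega>\<in>space M. restrict_height n (\<tau> \<omega>) \<in> A} \<in> sets M" if "countable A" for A
    unfolding UN using that cyl by (intro sets.countable_UN') auto
  have em: "emeasure M {\<omega>\<in>space M. restrict_height n (\<tau> \<omega>) \<in> A} =
      (\<integral>\<^sup>+t. emeasure M {\<omega>\<in>space M. restrict_height n (\<tau> \<omega>) = t} \<partial>count_space A)" if "countable A" for A
    unfolding UN using that cyl by (intro emeasure_UN_countable) (auto simp: disjoint_family_on_def)
  have on_support: "emeasure M {\<omega>\<in>space M. restrict_height n (\<tau> \<omega>) \<in> A} = emeasure ?G A"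
    if "A \<subseteq> set_pmf ?G" for A
  proof -
    have "countable A"
      using that countable_set_pmf countable_subset by blast
    then have "emeasure M {\<omega>\<in>space M. restrict_height n (\<tau> \<omega>) \<in> A} = (\<integral>\<^sup>+t. ennreal (pmf ?G t) \<partial>count_space A)"
      unfolding em[OF \<open>countable A\<close>]
    proof (intro nn_integral_cong)
      fix t
      assume "t \<in> space (count_space A)"
      then have t: "t \<in> set_pmf ?G"
        using that by auto
      then have "t \<in> trees_upto n"
        using set_gw_from[OF root_in_trees_upto_0] by fastforce
      then show "emeasure M {\<omega>\<in>space M. restrict_height n (\<tau> \<omega>) = t} = ennreal (pmf ?G t)"
        using galton_watson_cylinder[OF gw _ n] pmf_gw_law_eq_weight_on_support[OF t]
        by (simp add: emeasure_eq_measure)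
    qed
    then show ?thesis
      by (simp add: nn_integral_pmf)
  qed
  have full: "measure M {\<omega>\<in>space M. restrict_height n (\<tau> \<omega>) \<in> set_pmf ?G} = 1"
    using on_support[OF order_refl] emeasure_pmf[of ?G] by (simp add: emeasure_eq_measure measure_pmf.emeasure_eq_measure)
  have AE: "AE \<omega> in M. restrict_height n (\<tau> \<omega>) \<in> set_pmf ?G"
    using full sets_A[OF countable_set_pmf] by (simp add: prob_Collect_eq_1)
  have "{\<omega>\<in>space M. Q (restrict_height n (\<tau> \<omega>))} =
      {\<omega>\<in>space M. restrict_height n (\<tau> \<omega>) \<in> {t. finite t \<and> Q t}}"
    using \<tau>(2) finite_restrict_height by auto
  also have "\<dots> \<in> sets M"
  proof (rule sets_A)
    show "countable {t :: word set. finite t \<and> Q t}"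
      using countable_Collect_finite by (rule countable_subset[rotated]) auto
  qed
  finally have Q: "{\<omega>\<in>space M. Q (restrict_height n (\<tau> \<omega>))} \<in> sets M" .
  have "measure M {\<omega>\<in>space M. Q (restrict_height n (\<tau> \<omega>))} =
      measure M {\<omega>\<in>space M. restrict_height n (\<tau> \<omega>) \<in> {t \<in> set_pmf ?G. Q t}}"
  proof (rule measure_eq_AE[OF _ Q])
    show "{\<omega>\<in>space M. restrict_height n (\<tau> \<omega>) \<in> {t \<in> set_pmf ?G. Q t}} \<in> sets M"
      by (rule sets_A, rule countable_subset[OF _ countable_set_pmf[of ?G]]) blast
    show "AE \<omega> in M. \<omega> \<in> {\<omega>\<in>space M. Q (restrict_height n (\<tau> \<omega>))} \<longleftrightarrow>
        \<omega> \<in> {\<omega>\<in>space M. restrict_height n (\<tau> \<omega>) \<in> {t \<in> set_pmf ?G. Q t}}"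
      using AE by (rule AE_mp) (intro AE_I2 impI, blast)
  qed
  also have "\<dots> = measure ?G {t \<in> set_pmf ?G. Q t}"
    using on_support[of "{t \<in> set_pmf ?G. Q t}"] by (simp add: emeasure_eq_measure measure_pmf.emeasure_eq_measure)
  also have "\<dots> = measure ?G {t. Q t}"
    by (intro measure_eq_AE) (auto simp: AE_measure_pmf_iff)
  finally show ?thesis .
qed

text \<open>
Off the support the product vanishes as well, because it is the probability of a cylinder for the tree
\<open>\<tau>\<close>, whose truncation has the same law.
\<close>

lemma pmf_gw_law:
  assumes gw: "galton_watson p M \<tau>" and t: "t \<in> trees_upto h"
  shows "pmf (gw_from p 0 h {[]}) t = gw_weight p h t"
proof (cases h)
  case 0
  then have "t = {[]}"
    using t by (auto simp: trees_upto_def all_trees_def)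
  then show ?thesis
    using 0 by (simp add: gw_weight_def)
next
  case (Suc n)
  then show ?thesis
    using galton_watson_restrict_height[OF gw, of h "\<lambda>t'. t' = t"] galton_watson_cylinder[OF gw t]
    by (simp add: pmf.rep_eq)
qed

text \<open>
The branching property: given the truncation \<open>t\<close>, the vertices of level \<open>h\<close> have independent
Galton-Watson trees, and the size of generation \<open>n\<close> is a sum of independent zero-modified geometric
variables.
\<close>

lemma galton_watson_cylinder_and_size:
  assumes par: "0 < \<eta>" "\<eta> \<le> 1" "0 < q" "q < 1"
    and gw: "galton_watson (geom_offspring \<eta> q) M \<tau>" and t: "t \<in> trees_upto h" and n: "n \<ge> 1" "h \<le> n"
  shows "measure M {\<omega>\<in>space M. restrict_height h (\<tau> \<omega>) = t \<and> generation_size n (\<tau> \<omega>) = a} =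
    gw_weight (geom_offspring \<eta> q) h t *
    pmf (zero_modified_geometric_sum (survival_prob \<eta> q (n - h)) (geom_param \<eta> q (n - h)) (card (level h t))) a"
proof -
  let ?p = "geom_offspring \<eta> q"
  let ?K = "\<lambda>t'. map_pmf (\<lambda>t'. (restrict_height h t', card (level n t'))) (gw_from ?p h (n - h) t')"
  have gs: "generation_size n t' = card (level n (restrict_height n t'))" for t'
    unfolding generation_size_def by (rule arg_cong[of _ _ card]) (auto simp: level_def restrict_height_def)
  have "measure M {\<omega>\<in>space M. restrict_height h (\<tau> \<omega>) = t \<and> generation_size n (\<tau> \<omega>) = a} =
      measure M {\<omega>\<in>space M. (\<lambda>t'. restrict_height h t' = t \<and> card (level n t') = a) (restrict_height n (\<tau> \<omega>))}"
    by (simp add: gs restrict_height_restrict_height[OF n(2)])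
  also have "\<dots> = measure (gw_from ?p 0 n {[]}) {t'. restrict_height h t' = t \<and> card (level n t') = a}"
    by (rule galton_watson_restrict_height[OF gw n(1)])
  also have "\<dots> = pmf (map_pmf (\<lambda>t'. (restrict_height h t', card (level n t'))) (gw_from ?p 0 n {[]})) (t, a)"
    by (simp add: pmf_map vimage_def)
  also have "\<dots> = pmf (bind_pmf (gw_from ?p 0 h {[]}) ?K) (t, a)"
    using gw_from_add[of ?p 0 h "n - h" "{[]}"] n(2) by (simp add: map_bind_pmf)
  also have "\<dots> = pmf (gw_from ?p 0 h {[]}) t * pmf (?K t) (t, a)"
  proof (rule pmf_bind_unique_source)
    fix t'
    assume t': "t' \<in> set_pmf (gw_from ?p 0 h {[]})" "(t, a) \<in> set_pmf (?K t')"
    have "t' \<in> trees_upto h"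
      using set_gw_from[OF root_in_trees_upto_0 t'(1)] by simp
    then show "t' = t"
      using t'(2) set_gw_from[of t' h _ ?p "n - h"] by auto
  qed
  also have "?K t = map_pmf (Pair t) (map_pmf (\<lambda>t'. card (level n t')) (gw_from ?p h (n - h) t))"
    unfolding map_pmf_comp using set_gw_from[OF t] by (intro map_pmf_cong) auto
  also have "pmf \<dots> (t, a) = pmf (map_pmf (\<lambda>t'. card (level n t')) (gw_from ?p h (n - h) t)) a"
    by (rule pmf_map_inj') (simp add: inj_def)
  also have "map_pmf (\<lambda>t'. card (level n t')) (gw_from ?p h (n - h) t) =
      zero_modified_geometric_sum (survival_prob \<eta> q (n - h)) (geom_param \<eta> q (n - h)) (card (level h t))"
    using law_of_generation_size[OF par t, of "n - h"] n(2) by simp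
  finally show ?thesis
    by (simp add: pmf_gw_law[OF gw t])
qed

section \<open>A common parametrisation of the three regimes\<close>

text \<open>
Equal to \<open>\<mu>\<close> in the supercritical regime, to \<open>1 / \<mu>\<close> in the subcritical one, and to \<open>1\<close> in the critical one.
\<close>

definition growth_rate :: "real \<Rightarrow> real \<Rightarrow> real" where
  "growth_rate \<eta> q = max q \<eta> / min q \<eta>"

text \<open>
The smallest fixed point of the offspring generating function: \<open>1\<close> if \<open>\<eta> \<le> q\<close>, and \<open>\<kappa>\<close> otherwise.
\<close>

definition ext_prob :: "real \<Rightarrow> real \<Rightarrow> real" where
  "ext_prob \<eta> q = (1 - max q \<eta>) / (1 - q)"

text \<open>
The value of \<open>\<zeta>\<^sub>h\<close> extrapolated to the index \<open>h = -1\<close>. The critical regime has a formula of its own: the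
general one tends to \<open>0\<close> as \<open>\<eta>\<close> tends to \<open>q\<close>, in keeping with the different normalisation \<open>n\<^sup>2\<close> of \<open>a\<^sub>n\<close>.
\<close>

definition zeta_base :: "real \<Rightarrow> real \<Rightarrow> real" where
  "zeta_base \<eta> q = (if \<eta> = q then q / (1 - q) else (\<eta> - q)\<^sup>2 / (max q \<eta> * (1 - min q \<eta>)))"

text \<open>
The limit of \<open>a\<^sub>n \<alpha>\<^sub>n \<beta>\<^sub>n / (1 - \<beta>\<^sub>n)\<close>, which is the quantity through which the conditioning enters. It is
proportional to \<open>\<theta>\<close>, with a factor that absorbs the different normalisations of the three regimes.
\<close>

definition s_intensity :: "real \<Rightarrow> real \<Rightarrow> real \<Rightarrow> real" where
  "s_intensity \<eta> q \<theta> = \<theta> * zeta_base \<eta> q * max q \<eta> / (1 - q)"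

context
  fixes \<eta> q :: real
  assumes eta: "0 < \<eta>" "\<eta> \<le> 1" and q: "0 < q" "q < 1"
begin

lemma growth_rate_pos: "growth_rate \<eta> q > 0"
  using eta q by (simp add: growth_rate_def)

lemma zeta_base_pos: "zeta_base \<eta> q > 0"
  using eta q by (auto simp: zeta_base_def)

text \<open>
In the subcritical regime, \<open>(\<kappa> - 1) / \<kappa> = (q - \<eta>) / (1 - \<eta>)\<close>; in the supercritical one,
\<open>1 - \<kappa> = (\<eta> - q) / (1 - q)\<close>.
\<close>

lemma zeta_eq: "zeta \<eta> q h = zeta_base \<eta> q * growth_rate \<eta> q ^ Suc h"
proof (cases \<eta> q rule: linorder_cases)
  case less
  have "\<eta> / q < 1"
    using less q by simp
  then have "zeta \<eta> q h = (1 - \<eta> / q) * ((1 - \<eta>) / (1 - q) - 1) / ((1 - \<eta>) / (1 - q)) / (\<eta> / q) ^ Suc h"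
    by (simp add: zeta_def Let_def)
  also have "(1 - \<eta> / q) * ((1 - \<eta>) / (1 - q) - 1) / ((1 - \<eta>) / (1 - q)) = zeta_base \<eta> q"
  proof -
    have "1 - \<eta> / q = (q - \<eta>) / q" "(1 - \<eta>) / (1 - q) - 1 = (q - \<eta>) / (1 - q)"
      using q by (auto simp: field_simps)
    moreover have "zeta_base \<eta> q = (q - \<eta>)\<^sup>2 / (q * (1 - \<eta>))"
      using less by (simp add: zeta_base_def power2_commute[of q])
    ultimately show ?thesis
      using less eta q by (simp add: power2_eq_square)
  qed
  finally show ?thesis
    using less by (simp add: growth_rate_def min_def max_def power_divide)
next
  case equal
  have "\<eta> / q = 1"
    using equal q by simp
  then have "zeta \<eta> q h = 1 / (1 - q) - 1"
    by (simp add: zeta_def Let_def)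
  also have "\<dots> = q / (1 - q)"
    using q by (simp add: field_simps)
  finally show ?thesis
    using equal q by (simp add: zeta_base_def growth_rate_def)
next
  case greater
  have "\<not> \<eta> / q < 1" "\<eta> / q \<noteq> 1"
    using greater q by auto
  then have "zeta \<eta> q h = (\<eta> / q) ^ h * (\<eta> / q - 1) * (1 - (1 - \<eta>) / (1 - q))"
    by (simp add: zeta_def Let_def)
  also have "\<dots> = (\<eta> / q) ^ h * (\<eta> / q) * ((\<eta> - q) / \<eta> * ((\<eta> - q) / (1 - q)))"
    using eta q by (simp add: field_simps)
  finally show ?thesis
    using greater q
    by (simp add: zeta_base_def growth_rate_def min_def max_def power2_eq_square algebra_simps)
qed

lemma zeta_pos: "zeta \<eta> q h > 0"
  using zeta_base_pos growth_rate_pos by (simp add: zeta_eq)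

lemma s_intensity_pos: "\<theta> > 0 \<Longrightarrow> s_intensity \<eta> q \<theta> > 0"
  using zeta_base_pos eta q by (simp add: s_intensity_def)

end

section \<open>One generation of the typed tree\<close>

text \<open>
Subtracting \<open>1\<close> from every entry and listing \<open>V\<close> turns configurations into lists of natural numbers with a
prescribed length and sum.
\<close>

lemma card_s_configurations:
  assumes V: "finite V" and m: "card V \<le> m" "m \<ge> 1"
  shows "card (s_configurations V m) = (m - 1) choose (m - card V)"
proof -
  obtain xs where xs: "distinct xs" "set xs = V"
    using finite_distinct_list[OF V] by blast
  have len: "length xs = card V"
    using distinct_card[OF xs(1)] xs(2) by simp
  have sum_xs: "(\<Sum>u\<in>V. f u) = sum_list (map f xs)" for f :: "word \<Rightarrow> nat"
    using sum_list_distinct_conv_sum_set[OF xs(1), of f] xs(2) by simp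
  have "bij_betw (\<lambda>s. map (\<lambda>u. s u - 1) xs) (s_configurations V m)
      {l. length l = card V \<and> sum_list l = m - card V}"
    unfolding bij_betw_def
  proof (intro conjI equalityI subsetI inj_onI)
    fix s s'
    assume s: "s \<in> s_configurations V m" "s' \<in> s_configurations V m"
      and eq: "map (\<lambda>u. s u - 1) xs = map (\<lambda>u. s' u - 1) xs"
    show "s = s'"
    proof
      fix u
      show "s u = s' u"
      proof (cases "u \<in> V")
        case True
        then have "s u - 1 = s' u - 1" "s u \<ge> 1" "s' u \<ge> 1"
          using eq xs(2) s by (auto simp: s_configurations_def)
        then show ?thesis
          by linarith
      next
        case False
        then show ?thesis
          using s by (simp add: s_configurations_def)
      qed
    qed
  next
    fix l
    assume "l \<in> (\<lambda>s. map (\<lambda>u. s u - 1) xs) ` s_configurations V m"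
    then obtain s where s: "s \<in> s_configurations V m" "l = map (\<lambda>u. s u - 1) xs"
      by blast
    have "sum_list l = (\<Sum>u\<in>V. s u - 1)"
      by (simp add: s(2) sum_xs)
    also have "\<dots> = (\<Sum>u\<in>V. s u) - (\<Sum>u\<in>V. 1)"
      using s(1) by (intro sum_subtractf_nat) (auto simp: s_configurations_def)
    finally show "l \<in> {l. length l = card V \<and> sum_list l = m - card V}"
      using s len by (simp add: s_configurations_def)
  next
    fix l :: "nat list"
    assume l: "l \<in> {l. length l = card V \<and> sum_list l = m - card V}"
    define s where "s u = (case map_of (zip xs l) u of None \<Rightarrow> 0 | Some n \<Rightarrow> Suc n)" for u
    have len_l: "length l = length xs"
      using l len by simp
    have nth: "s (xs ! i) = Suc (l ! i)" if "i < length xs" for i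
      using that xs(1) len_l by (simp add: s_def map_of_zip_nth)
    have map: "map s xs = map Suc l"
      using len_l nth by (intro nth_equalityI) auto
    have "s u \<ge> 1" if "u \<in> V" for u
    proof -
      have "u \<in> set xs"
        using that by (simp only: xs(2))
      then obtain i where i: "i < length xs" "u = xs ! i"
        unfolding in_set_conv_nth by blast
      have "s u = Suc (l ! i)"
        unfolding i(2) by (rule nth[OF i(1)])
      then show ?thesis
        by simp
    qed
    moreover have "s u = 0" if "u \<notin> V" for u
    proof -
      have "map_of (zip xs l) u = None"
        using that xs(2) len_l by simp
      then show ?thesis
        by (simp add: s_def)
    qed
    moreover have "(\<Sum>u\<in>V. s u) = m"
    proof -
      have "(\<Sum>u\<in>V. s u) = sum_list (map Suc l)"
        by (simp add: sum_xs map)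
      also have "\<dots> = sum_list l + length l"
        by (induction l) auto
      finally show ?thesis
        using l m by simp
    qed
    ultimately have "s \<in> s_configurations V m"
      by (simp add: s_configurations_def)
    moreover have "map (\<lambda>u. s u - 1) xs = l"
      using len_l nth by (intro nth_equalityI) auto
    ultimately show "l \<in> (\<lambda>s. map (\<lambda>u. s u - 1) xs) ` s_configurations V m"
      by blast
  qed
  then have "card (s_configurations V m) = card {l::nat list. length l = card V \<and> sum_list l = m - card V}"
    by (rule bij_betw_same_card)
  also have "\<dots> = (m - card V + card V - 1) choose (m - card V)"
    by (rule card_length_sum_list)
  finally show ?thesis
    using m by simp
qed

lemma
  assumes "finite V" "V \<noteq> {}"
  shows finite_s_configurations: "finite (s_configurations V (card V + \<Delta>))"
    and s_configurations_nonempty: "s_configurations V (card V + \<Delta>) \<noteq> {}"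
    and card_s_configurations_add:
      "card (s_configurations V (card V + \<Delta>)) = (card V + \<Delta> - 1) choose \<Delta>"
proof -
  have 1: "card V \<ge> 1"
    using assms by (simp add: Suc_le_eq card_gt_0_iff)
  then show c: "card (s_configurations V (card V + \<Delta>)) = (card V + \<Delta> - 1) choose \<Delta>"
    using card_s_configurations[OF assms(1), of "card V + \<Delta>"] by simp
  have "(card V + \<Delta> - 1) choose \<Delta> > 0"
    using 1 by (intro zero_less_binomial) simp
  then have "card (s_configurations V (card V + \<Delta>)) > 0"
    using c by simp
  then show "finite (s_configurations V (card V + \<Delta>))" "s_configurations V (card V + \<Delta>) \<noteq> {}"
    using card_gt_0_iff by blast+
qed

text \<open>
The possible outcomes of the random choices in \<open>grow\<close>.
\<close>

definition grow_data ::
  "nat \<Rightarrow> word set \<Rightarrow> word set \<Rightarrow> nat \<Rightarrow> (word \<Rightarrow> nat) \<Rightarrow> (word \<Rightarrow> nat) \<Rightarrow> (word \<Rightarrow> nat set) \<Rightarrow> bool" where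
  "grow_data h t S \<Delta> s k A \<longleftrightarrow>
     s \<in> s_configurations (level h S) (card (level h S) + \<Delta>) \<and>
     (\<forall>u. u \<notin> level h t \<longrightarrow> k u = 0) \<and>
     (\<forall>u\<in>level h S. s u \<le> k u \<and> A u \<subseteq> {1..k u} \<and> card (A u) = s u) \<and>
     (\<forall>u. u \<notin> level h S \<longrightarrow> A u = {})"

definition grow_state ::
  "nat \<Rightarrow> word set \<Rightarrow> word set \<Rightarrow> (word \<Rightarrow> nat) \<Rightarrow> (word \<Rightarrow> nat set) \<Rightarrow> word set \<times> word set" where
  "grow_state h t S k A = (add_generation h t k, S \<union> children_of (level h S) A)"

lemma grow_alt:
  "grow \<eta> q \<theta> h (t, S) =
     bind_pmf (poisson_pmf (\<theta> * zeta \<eta> q h)) (\<lambda>\<Delta>.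
     bind_pmf (pmf_of_set (s_configurations (level h S) (card (level h S) + \<Delta>))) (\<lambda>s.
     bind_pmf (Pi_pmf (level h t) 0
       (\<lambda>u. if u \<in> level h S then size_biased_offspring \<eta> q (s u) else e_offspring \<eta> q)) (\<lambda>k.
     bind_pmf (Pi_pmf (level h S) {} (\<lambda>u. pmf_of_set {B. B \<subseteq> {1..k u} \<and> card B = s u})) (\<lambda>A.
     return_pmf (grow_state h t S k A)))))"
  by (simp add: grow_def Let_def grow_state_def add_generation_def children_of_def level_def)

text \<open>
The new state determines all the choices that led to it: the ranks of the type-s children of \<open>u\<close> are
visible in the new set of type-s vertices, their numbers are the values of \<open>s\<close>, and these add up to the new
number of type-s vertices.
\<close>

lemma grow_state_inject:
  assumes t: "t \<in> trees_upto h" and S: "S \<subseteq> t"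
    and d: "grow_data h t S \<Delta> s k A" "grow_data h t S \<Delta>' s' k' A'"
    and eq: "grow_state h t S k A = grow_state h t S k' A'"
  shows "\<Delta> = \<Delta>'" "s = s'" "k = k'" "A = A'"
proof -
  show "k = k'"
    using d eq by (intro add_generation_inject[OF t]) (auto simp: grow_data_def grow_state_def)
  have not_in_S: "u @ [i] \<notin> S" if "u \<in> level h S" for u i
  proof
    assume "u @ [i] \<in> S"
    then have "length (u @ [i]) \<le> h"
      using S t unfolding trees_upto_def by blast
    then show False
      using that by (simp add: level_def)
  qed
  have "A u = A' u" for u
  proof (cases "u \<in> level h S")
    case True
    have "A u = {i. u @ [i] \<in> S \<union> children_of (level h S) A}"
      using True not_in_S[OF True] by auto
    also have "S \<union> children_of (level h S) A = S \<union> children_of (level h S) A'"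
      using eq by (simp add: grow_state_def)
    also have "{i. u @ [i] \<in> S \<union> children_of (level h S) A'} = A' u"
      using True not_in_S[OF True] by auto
    finally show ?thesis .
  next
    case False
    then show ?thesis
      using d by (simp add: grow_data_def)
  qed
  then show A: "A = A'" ..
  have "s u = s' u" for u
    using d A by (cases "u \<in> level h S") (auto simp: grow_data_def s_configurations_def)
  then show s: "s = s'" ..
  have "(\<Sum>u\<in>level h S. s u) = card (level h S) + \<Delta>" "(\<Sum>u\<in>level h S. s' u) = card (level h S) + \<Delta>'"
    using d by (auto simp: grow_data_def s_configurations_def)
  then show "\<Delta> = \<Delta>'"
    using s by simp
qed

lemma finite_levels:
  assumes "t \<in> trees_upto h" "S \<subseteq> t"
  shows "finite (level h t)" "finite (level h S)" "level h S \<subseteq> level h t"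
proof -
  show "finite (level h t)"
    by (rule finite_level_trees_upto[OF assms(1)])
  moreover show "level h S \<subseteq> level h t"
    using assms(2) by (auto simp: level_def)
  ultimately show "finite (level h S)"
    by (rule finite_subset[rotated])
qed

lemma set_pmf_subsets:
  "s \<le> k \<Longrightarrow> set_pmf (pmf_of_set {B. B \<subseteq> {1..k} \<and> card B = s}) = {B. B \<subseteq> {1..k} \<and> card B = s}"
  "s \<le> k \<Longrightarrow> B \<subseteq> {1..k} \<Longrightarrow> card B = s \<Longrightarrow>
     pmf (pmf_of_set {B. B \<subseteq> {1..k} \<and> card B = s}) B = 1 / real (k choose s)"
proof -
  assume s: "s \<le> k"
  have fin: "finite {B. B \<subseteq> {1..k} \<and> card B = s}"
    by (rule finite_subset[of _ "Pow {1..k}"]) auto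
  have c: "card {B. B \<subseteq> {1..k} \<and> card B = s} = k choose s"
    using n_subsets[of "{1..k}" s] by simp
  then have "{B. B \<subseteq> {1..k} \<and> card B = s} \<noteq> {}"
    using s by (metis card.empty zero_less_binomial less_irrefl)
  with fin c show "set_pmf (pmf_of_set {B. B \<subseteq> {1..k} \<and> card B = s}) = {B. B \<subseteq> {1..k} \<and> card B = s}"
    "B \<subseteq> {1..k} \<Longrightarrow> card B = s \<Longrightarrow>
       pmf (pmf_of_set {B. B \<subseteq> {1..k} \<and> card B = s}) B = 1 / real (k choose s)"
    by (auto simp: pmf_of_set)
qed

context
  fixes \<eta> q \<theta> :: real
  assumes eta: "0 < \<eta>" "\<eta> \<le> 1" and q: "0 < q" "q < 1" and theta: "0 < \<theta>"
begin

lemma set_pmf_size_biased: "k \<in> set_pmf (size_biased_offspring \<eta> q s) \<Longrightarrow> s \<le> k"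
  using eta q by (auto simp: set_pmf_iff pmf_size_biased_offspring split: if_splits)

context
  fixes h t S
  assumes t: "t \<in> trees_upto h" and S: "S \<subseteq> t" and V: "level h S \<noteq> {}"
begin

abbreviation "offspring_law s \<equiv> Pi_pmf (level h t) 0
   (\<lambda>u. if u \<in> level h S then size_biased_offspring \<eta> q (s u) else e_offspring \<eta> q)"

abbreviation "rank_law s k \<equiv> Pi_pmf (level h S) {} (\<lambda>u. pmf_of_set {B. B \<subseteq> {1..k u} \<and> card B = s u})"

lemma grow_data_of_support:
  assumes "s \<in> set_pmf (pmf_of_set (s_configurations (level h S) (card (level h S) + \<Delta>)))"
    "k \<in> set_pmf (offspring_law s)" "A \<in> set_pmf (rank_law s k)"
  shows "grow_data h t S \<Delta> s k A"
proof -
  have s: "s \<in> s_configurations (level h S) (card (level h S) + \<Delta>)"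
    using assms(1) finite_s_configurations[OF finite_levels(2)[OF t S] V] s_configurations_nonempty[OF finite_levels(2)[OF t S] V]
    by simp
  have k: "k \<in> PiE_dflt (level h t) 0 (set_pmf \<circ>
      (\<lambda>u. if u \<in> level h S then size_biased_offspring \<eta> q (s u) else e_offspring \<eta> q))"
    using assms(2) by (simp only: set_Pi_pmf[OF finite_levels(1)[OF t S]])
  have sk: "s u \<le> k u" if "u \<in> level h S" for u
  proof -
    have "k u \<in> set_pmf (size_biased_offspring \<eta> q (s u))"
      using k that finite_levels(3)[OF t S] by (auto simp: PiE_dflt_def dest!: spec[of _ u])
    then show ?thesis
      by (rule set_pmf_size_biased)
  qed
  have "A \<in> PiE_dflt (level h S) {} (set_pmf \<circ> (\<lambda>u. pmf_of_set {B. B \<subseteq> {1..k u} \<and> card B = s u}))"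
    using assms(3) by (simp only: set_Pi_pmf[OF finite_levels(2)[OF t S]])
  then have A: "A u \<in> set_pmf (pmf_of_set {B. B \<subseteq> {1..k u} \<and> card B = s u})" if "u \<in> level h S" for u
    using that by (simp add: PiE_dflt_def)
  have A_out: "A u = {}" if "u \<notin> level h S" for u
    using \<open>A \<in> PiE_dflt _ _ _\<close> that by (simp add: PiE_dflt_def)
  have k_out: "k u = 0" if "u \<notin> level h t" for u
    using k that by (simp add: PiE_dflt_def)
  show ?thesis
    unfolding grow_data_def
  proof (intro conjI ballI allI impI)
    fix u
    assume u: "u \<in> level h S"
    show "s u \<le> k u"
      by (rule sk[OF u])
    show "A u \<subseteq> {1..k u}" "card (A u) = s u"
      using A[OF u] unfolding set_pmf_subsets(1)[OF sk[OF u]] by auto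
  qed (use s k_out A_out in auto)
qed

lemma set_grow:
  assumes "x \<in> set_pmf (grow \<eta> q \<theta> h (t, S))"
  obtains \<Delta> s k A where "grow_data h t S \<Delta> s k A" "x = grow_state h t S k A"
  using assms unfolding grow_alt by (auto dest: grow_data_of_support)

text \<open>
As the choices are determined by the outcome, the probability is the product of the probabilities of
the four successive choices.
\<close>

lemma pmf_grow:
  assumes d: "grow_data h t S \<Delta> s k A"
  shows "pmf (grow \<eta> q \<theta> h (t, S)) (grow_state h t S k A) =
    pmf (poisson_pmf (\<theta> * zeta \<eta> q h)) \<Delta> *
    (1 / real ((card (level h S) + \<Delta> - 1) choose \<Delta>)) *
    ((\<Prod>u\<in>level h t. pmf (if u \<in> level h S then size_biased_offspring \<eta> q (s u) else e_offspring \<eta> q) (k u)) *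
    (\<Prod>u\<in>level h S. 1 / real (k u choose s u)))"
proof -
  let ?x = "grow_state h t S k A"
  note inj = grow_state_inject[OF t S _ d]
  have s: "s \<in> s_configurations (level h S) (card (level h S) + \<Delta>)"
    using d by (simp add: grow_data_def)
  note conf = finite_s_configurations[OF finite_levels(2)[OF t S] V] s_configurations_nonempty[OF finite_levels(2)[OF t S] V]
  have s_supp: "s \<in> set_pmf (pmf_of_set (s_configurations (level h S) (card (level h S) + \<Delta>)))"
    using s conf by simp
  have 4: "pmf (bind_pmf (rank_law s k) (\<lambda>A. return_pmf (grow_state h t S k A))) ?x =
      (\<Prod>u\<in>level h S. 1 / real (k u choose s u))"
    if k: "k \<in> set_pmf (offspring_law s)"
  proof -
    have "pmf (bind_pmf (rank_law s k) (\<lambda>A. return_pmf (grow_state h t S k A))) ?x =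
        pmf (rank_law s k) A * pmf (return_pmf (grow_state h t S k A)) ?x"
    proof (rule pmf_bind_unique_source)
      fix A'
      assume A': "A' \<in> set_pmf (rank_law s k)" "?x \<in> set_pmf (return_pmf (grow_state h t S k A'))"
      show "A' = A"
        using inj(4)[OF grow_data_of_support[OF s_supp k A'(1)]] A'(2) by simp
    qed
    also have "pmf (rank_law s k) A = (\<Prod>u\<in>level h S. pmf (pmf_of_set {B. B \<subseteq> {1..k u} \<and> card B = s u}) (A u))"
      using d finite_levels(2)[OF t S] by (intro pmf_Pi') (auto simp: grow_data_def)
    also have "\<dots> = (\<Prod>u\<in>level h S. 1 / real (k u choose s u))"
      using d by (intro prod.cong refl set_pmf_subsets(2)) (auto simp: grow_data_def)
    finally show ?thesis
      by simp
  qed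
  have 3: "pmf (bind_pmf (offspring_law s) (\<lambda>k. bind_pmf (rank_law s k) (\<lambda>A. return_pmf (grow_state h t S k A)))) ?x =
      (\<Prod>u\<in>level h t. pmf (if u \<in> level h S then size_biased_offspring \<eta> q (s u) else e_offspring \<eta> q) (k u)) *
      (\<Prod>u\<in>level h S. 1 / real (k u choose s u))"
  proof -
    have E: "pmf (bind_pmf (offspring_law s) (\<lambda>k. bind_pmf (rank_law s k) (\<lambda>A. return_pmf (grow_state h t S k A)))) ?x =
        pmf (offspring_law s) k * pmf (bind_pmf (rank_law s k) (\<lambda>A. return_pmf (grow_state h t S k A))) ?x"
    proof (rule pmf_bind_unique_source)
      fix k'
      assume k': "k' \<in> set_pmf (offspring_law s)"
        "?x \<in> set_pmf (bind_pmf (rank_law s k') (\<lambda>A. return_pmf (grow_state h t S k' A)))"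
      then obtain A' where "A' \<in> set_pmf (rank_law s k')" "?x = grow_state h t S k' A'"
        by auto
      then show "k' = k"
        using inj(3)[OF grow_data_of_support[OF s_supp k'(1)]] by simp
    qed
    have k: "pmf (offspring_law s) k =
        (\<Prod>u\<in>level h t. pmf (if u \<in> level h S then size_biased_offspring \<eta> q (s u) else e_offspring \<eta> q) (k u))"
      using d finite_levels(1)[OF t S] by (intro pmf_Pi') (auto simp: grow_data_def)
    show ?thesis
    proof (cases "k \<in> set_pmf (offspring_law s)")
      case True
      then show ?thesis
        by (simp only: E k 4)
    next
      case False
      then have "pmf (offspring_law s) k = 0"
        by (simp add: pmf_eq_0_set_pmf)
      then show ?thesis
        by (simp only: E k[symmetric] mult_zero_left)
    qed
  qed
  have 2: "pmf (bind_pmf (pmf_of_set (s_configurations (level h S) (card (level h S) + \<Delta>))) (\<lambda>s.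
        bind_pmf (offspring_law s) (\<lambda>k. bind_pmf (rank_law s k) (\<lambda>A. return_pmf (grow_state h t S k A))))) ?x =
      pmf (pmf_of_set (s_configurations (level h S) (card (level h S) + \<Delta>))) s *
      pmf (bind_pmf (offspring_law s) (\<lambda>k. bind_pmf (rank_law s k) (\<lambda>A. return_pmf (grow_state h t S k A)))) ?x"
  proof (rule pmf_bind_unique_source)
    fix s'
    assume s': "s' \<in> set_pmf (pmf_of_set (s_configurations (level h S) (card (level h S) + \<Delta>)))"
      "?x \<in> set_pmf (bind_pmf (offspring_law s') (\<lambda>k. bind_pmf (rank_law s' k) (\<lambda>A. return_pmf (grow_state h t S k A))))"
    then obtain k' A' where "k' \<in> set_pmf (offspring_law s')" "A' \<in> set_pmf (rank_law s' k')"
        "?x = grow_state h t S k' A'"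
      by auto
    then show "s' = s"
      using inj(2)[OF grow_data_of_support[OF s'(1)]] by simp
  qed
  have 1: "pmf (grow \<eta> q \<theta> h (t, S)) ?x = pmf (poisson_pmf (\<theta> * zeta \<eta> q h)) \<Delta> *
      pmf (bind_pmf (pmf_of_set (s_configurations (level h S) (card (level h S) + \<Delta>))) (\<lambda>s.
        bind_pmf (offspring_law s) (\<lambda>k. bind_pmf (rank_law s k) (\<lambda>A. return_pmf (grow_state h t S k A))))) ?x"
    unfolding grow_alt
  proof (rule pmf_bind_unique_source)
    fix \<Delta>'
    assume "?x \<in> set_pmf (bind_pmf (pmf_of_set (s_configurations (level h S) (card (level h S) + \<Delta>'))) (\<lambda>s.
        bind_pmf (offspring_law s) (\<lambda>k. bind_pmf (rank_law s k) (\<lambda>A. return_pmf (grow_state h t S k A)))))"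
    then obtain s' k' A' where "s' \<in> set_pmf (pmf_of_set (s_configurations (level h S) (card (level h S) + \<Delta>')))"
        "k' \<in> set_pmf (offspring_law s')" "A' \<in> set_pmf (rank_law s' k')" "?x = grow_state h t S k' A'"
      by auto
    then show "\<Delta>' = \<Delta>"
      using inj(1)[OF grow_data_of_support] by simp
  qed
  have "pmf (pmf_of_set (s_configurations (level h S) (card (level h S) + \<Delta>))) s =
      1 / real ((card (level h S) + \<Delta> - 1) choose \<Delta>)"
    using s conf card_s_configurations_add[OF finite_levels(2)[OF t S] V] by (simp add: pmf_of_set)
  then show ?thesis
    unfolding 1 2 3 by simp
qed

end

text \<open>
The offspring law of a type-e vertex is \<open>p\<close> conditioned on extinction. The factor is kept on the left because
\<open>ext_prob\<close> vanishes when \<open>\<eta> = 1\<close>.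
\<close>

lemma e_offspring_tilt:
  "ext_prob \<eta> q * pmf (e_offspring \<eta> q) k = ext_prob \<eta> q ^ k * pmf (geom_offspring \<eta> q) k"
proof (cases "\<eta> \<le> q")
  case True
  then have "\<eta> / q \<le> 1"
    using q by simp
  then show ?thesis
    using True q by (simp add: e_offspring_def ext_prob_def max_def)
next
  case False
  then have *: "\<not> \<eta> / q \<le> 1" "max q \<eta> = \<eta>"
    using q by auto
  show ?thesis
  proof (cases k)
    case 0
    then show ?thesis
      using * eta q by (simp add: e_offspring_def ext_prob_def pmf_geom_offspring)
  next
    case (Suc j)
    then show ?thesis
      using * eta q by (simp add: e_offspring_def ext_prob_def pmf_geom_offspring power_divide)
  qed
qed

text \<open>
The binomial coefficient of the size-biased law cancels against the choice of the ranks. What is left is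
a geometric expression in \<open>k\<close>, which can be compared with \<open>p\<close>.
\<close>

lemma size_biased_tilt:
  assumes "1 \<le> s" "s \<le> k"
  shows "pmf (size_biased_offspring \<eta> q s) k * (1 / real (k choose s)) =
    pmf (geom_offspring \<eta> q) k * ext_prob \<eta> q ^ (k - s) * (max q \<eta> / (1 - q)) ^ (s - 1) * growth_rate \<eta> q"
proof -
  let ?r = "max q \<eta>"
  have "k choose s > 0"
    using assms by simp
  then have "pmf (size_biased_offspring \<eta> q s) k * (1 / real (k choose s)) = ?r ^ (s + 1) * (1 - ?r) ^ (k - s)"
    using assms eta q by (simp add: pmf_size_biased_offspring)
  also have "1 - ?r = ext_prob \<eta> q * (1 - q)"
    using q by (simp add: ext_prob_def)
  also have "?r ^ (s + 1) * (ext_prob \<eta> q * (1 - q)) ^ (k - s) =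
      (1 - q) ^ (k - s) * (1 - q) ^ (s - 1) * ?r\<^sup>2 * ext_prob \<eta> q ^ (k - s) * (?r / (1 - q)) ^ (s - 1)"
  proof -
    have "s + 1 = 2 + (s - 1)"
      using assms by simp
    then have "?r ^ (s + 1) = ?r\<^sup>2 * ?r ^ (s - 1)"
      by (metis power_add)
    moreover have "?r ^ (s - 1) = (1 - q) ^ (s - 1) * (?r / (1 - q)) ^ (s - 1)"
      using q by (simp add: power_mult_distrib[symmetric])
    ultimately show ?thesis
      by (simp only: power_mult_distrib mult_ac)
  qed
  also have "(1 - q) ^ (k - s) * (1 - q) ^ (s - 1) = (1 - q) ^ (k - 1)"
    using assms by (simp add: power_add[symmetric])
  also have "(1 - q) ^ (k - 1) * ?r\<^sup>2 = pmf (geom_offspring \<eta> q) k * growth_rate \<eta> q"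
    using assms eta q by (simp add: pmf_geom_offspring growth_rate_def max_def min_def power2_eq_square)
  finally show ?thesis
    by (simp only: mult_ac)
qed

text \<open>
Collecting the tilts over a generation, each new vertex that is not of type s contributes a factor
\<open>ext_prob\<close>, so the exponent passes from the type-e vertices of level \<open>h\<close> to those of level \<open>h + 1\<close>. The other
factors only depend on the numbers of type-s vertices.
\<close>

lemma pmf_grow_tilt:
  assumes t: "t \<in> trees_upto h" and S: "S \<subseteq> t" and V: "level h S \<noteq> {}"
    and d: "grow_data h t S \<Delta> s k A"
  shows "ext_prob \<eta> q ^ (card (level h t) - card (level h S)) *
     ((\<Prod>u\<in>level h t. pmf (if u \<in> level h S then size_biased_offspring \<eta> q (s u) else e_offspring \<eta> q) (k u)) *
      (\<Prod>u\<in>level h S. 1 / real (k u choose s u))) =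
    (\<Prod>u\<in>level h t. pmf (geom_offspring \<eta> q) (k u)) *
    ext_prob \<eta> q ^ ((\<Sum>u\<in>level h t. k u) - (card (level h S) + \<Delta>)) *
    ((max q \<eta> / (1 - q)) ^ \<Delta> * growth_rate \<eta> q ^ card (level h S))"
proof -
  let ?L = "level h t" and ?V = "level h S" and ?c = "ext_prob \<eta> q" and ?p = "geom_offspring \<eta> q"
  let ?x = "max q \<eta> / (1 - q)" and ?b = "growth_rate \<eta> q"
  note fin = finite_levels[OF t S]
  have sk: "1 \<le> s u" "s u \<le> k u" if "u \<in> ?V" for u
    using d that by (auto simp: grow_data_def s_configurations_def)
  have sum_s: "(\<Sum>u\<in>?V. s u) = card ?V + \<Delta>"
    using d by (simp add: grow_data_def s_configurations_def)
  have split: "(\<Prod>u\<in>?L. f u) = (\<Prod>u\<in>?V. f u) * (\<Prod>u\<in>?L - ?V. f u)" for f :: "word \<Rightarrow> real"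
    using prod.subset_diff[OF fin(3,1), of f] by (simp add: mult.commute)
  have split': "(\<Sum>u\<in>?L. f u) = (\<Sum>u\<in>?V. f u) + (\<Sum>u\<in>?L - ?V. f u)" for f :: "word \<Rightarrow> nat"
    using sum.subset_diff[OF fin(3,1), of f] by (simp add: add.commute)
  have "(\<Prod>u\<in>?V. pmf (size_biased_offspring \<eta> q (s u)) (k u) * (1 / real (k u choose s u))) =
      (\<Prod>u\<in>?V. pmf ?p (k u) * ?c ^ (k u - s u) * ?x ^ (s u - 1) * ?b)"
    using sk by (intro prod.cong refl size_biased_tilt) auto
  also have "\<dots> = (\<Prod>u\<in>?V. pmf ?p (k u)) * ?c ^ (\<Sum>u\<in>?V. k u - s u) * ?x ^ (\<Sum>u\<in>?V. s u - 1) * ?b ^ card ?V"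
    by (simp add: prod.distrib power_sum)
  also have "(\<Sum>u\<in>?V. s u - 1) = \<Delta>"
    using sum_subtractf_nat[of ?V "\<lambda>_. 1" s] sk sum_s by simp
  also have "(\<Sum>u\<in>?V. k u - s u) = (\<Sum>u\<in>?V. k u) - (card ?V + \<Delta>)"
    using sum_subtractf_nat[of ?V s k] sk sum_s by simp
  finally have on_V: "(\<Prod>u\<in>?V. pmf (size_biased_offspring \<eta> q (s u)) (k u)) * (\<Prod>u\<in>?V. 1 / real (k u choose s u)) =
      (\<Prod>u\<in>?V. pmf ?p (k u)) * ?c ^ ((\<Sum>u\<in>?V. k u) - (card ?V + \<Delta>)) * ?x ^ \<Delta> * ?b ^ card ?V"
    by (simp only: prod.distrib)
  have "?c ^ (card ?L - card ?V) * (\<Prod>u\<in>?L - ?V. pmf (e_offspring \<eta> q) (k u)) =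
      (\<Prod>u\<in>?L - ?V. ?c * pmf (e_offspring \<eta> q) (k u))"
    using fin by (simp add: prod.distrib card_Diff_subset)
  also have "\<dots> = (\<Prod>u\<in>?L - ?V. ?c ^ k u * pmf ?p (k u))"
    by (simp only: e_offspring_tilt)
  also have "\<dots> = ?c ^ (\<Sum>u\<in>?L - ?V. k u) * (\<Prod>u\<in>?L - ?V. pmf ?p (k u))"
    by (simp add: prod.distrib power_sum)
  finally have off_V: "?c ^ (card ?L - card ?V) * (\<Prod>u\<in>?L - ?V. pmf (e_offspring \<eta> q) (k u)) =
      ?c ^ (\<Sum>u\<in>?L - ?V. k u) * (\<Prod>u\<in>?L - ?V. pmf ?p (k u))" .
  have "card ?V + \<Delta> \<le> (\<Sum>u\<in>?V. k u)"
    unfolding sum_s[symmetric] using sk by (intro sum_mono) auto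
  then have exponent: "(\<Sum>u\<in>?L. k u) - (card ?V + \<Delta>) = ((\<Sum>u\<in>?V. k u) - (card ?V + \<Delta>)) + (\<Sum>u\<in>?L - ?V. k u)"
    by (simp add: split')
  have "(\<Prod>u\<in>?L. pmf (if u \<in> ?V then size_biased_offspring \<eta> q (s u) else e_offspring \<eta> q) (k u)) =
      (\<Prod>u\<in>?V. pmf (size_biased_offspring \<eta> q (s u)) (k u)) * (\<Prod>u\<in>?L - ?V. pmf (e_offspring \<eta> q) (k u))"
    unfolding split by (intro arg_cong2[of _ _ _ _ "(*)"] prod.cong) auto
  then have "?c ^ (card ?L - card ?V) *
     ((\<Prod>u\<in>?L. pmf (if u \<in> ?V then size_biased_offspring \<eta> q (s u) else e_offspring \<eta> q) (k u)) *
      (\<Prod>u\<in>?V. 1 / real (k u choose s u))) =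
     (?c ^ (card ?L - card ?V) * (\<Prod>u\<in>?L - ?V. pmf (e_offspring \<eta> q) (k u))) *
     ((\<Prod>u\<in>?V. pmf (size_biased_offspring \<eta> q (s u)) (k u)) * (\<Prod>u\<in>?V. 1 / real (k u choose s u)))"
    by (simp only: mult_ac)
  also have "\<dots> = (\<Prod>u\<in>?L. pmf ?p (k u)) * ?c ^ ((\<Sum>u\<in>?L. k u) - (card ?V + \<Delta>)) * (?x ^ \<Delta> * ?b ^ card ?V)"
    unfolding on_V off_V exponent split[of "\<lambda>u. pmf ?p (k u)"] power_add by (simp only: mult_ac)
  finally show ?thesis .
qed

end

section \<open>The law of the truncated typed tree\<close>

text \<open>
The density of the typed tree with respect to the Galton-Watson tree, for \<open>m\<close> type-s vertices at level \<open>h\<close>,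
except for the factor \<open>ext_prob\<close> for each of the remaining vertices of that level. Up to a constant it is the
mass at \<open>m - 1\<close> of a Poisson law.
\<close>

definition s_weight :: "real \<Rightarrow> real \<Rightarrow> real \<Rightarrow> nat \<Rightarrow> nat \<Rightarrow> real" where
  "s_weight \<eta> q \<theta> h m = exp (- (\<Sum>l<h. \<theta> * zeta \<eta> q l)) * growth_rate \<eta> q ^ h *
     (s_intensity \<eta> q \<theta> * growth_rate \<eta> q ^ h) ^ (m - 1) / fact (m - 1)"

text \<open>
Every type-s vertex has a type-s child, so the type-s vertices are the ancestors of those at the last level.
\<close>

definition valid_typed_tree :: "nat \<Rightarrow> word set \<Rightarrow> word set \<Rightarrow> bool" where
  "valid_typed_tree h t S \<longleftrightarrow> t \<in> trees_upto h \<and> S \<subseteq> t \<and> level h S \<noteq> {} \<and>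
     S = {u. \<exists>w\<in>level h S. prefix u w}"

lemma level_Suc_S:
  assumes "S \<subseteq> t" "t \<in> trees_upto h"
  shows "level (Suc h) (S \<union> children_of (level h S) A) = children_of (level h S) A"
  using assms length_children_of[of _ h S A] by (fastforce simp: level_def[of "Suc h"] trees_upto_def)

lemma valid_typed_tree_grow:
  assumes v: "valid_typed_tree h t S" and d: "grow_data h t S \<Delta> s k A"
  shows "valid_typed_tree (Suc h) (add_generation h t k) (S \<union> children_of (level h S) A)"
proof -
  let ?V = "level h S" and ?S = "S \<union> children_of (level h S) A"
  have t: "t \<in> trees_upto h" and S: "S \<subseteq> t" and V: "?V \<noteq> {}" and pre: "S = {u. \<exists>w\<in>?V. prefix u w}"
    using v by (auto simp: valid_typed_tree_def)
  have lev: "level (Suc h) ?S = children_of ?V A"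
    by (rule level_Suc_S[OF S t])
  have A: "A u \<subseteq> {1..k u}" "A u \<noteq> {}" if "u \<in> ?V" for u
  proof -
    have "card (A u) = s u" "s u \<ge> 1"
      using d that by (auto simp: grow_data_def s_configurations_def)
    then show "A u \<noteq> {}"
      by auto
  qed (use d that in \<open>auto simp: grow_data_def\<close>)
  have "children_of ?V A \<subseteq> children_of (level h t) (\<lambda>u. {1..k u})"
    using A(1) S by (fastforce simp: children_of_def level_def)
  then have "?S \<subseteq> add_generation h t k"
    using S by (auto simp: add_generation_def)
  moreover have "children_of ?V A \<noteq> {}"
    using V A(2) by (fastforce simp: children_of_def)
  moreover have "?S = {u. \<exists>w\<in>children_of ?V A. prefix u w}"
  proof (intro equalityI subsetI)
    fix u
    assume "u \<in> ?S"
    then show "u \<in> {u. \<exists>w\<in>children_of ?V A. prefix u w}"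
    proof
      assume "u \<in> S"
      then obtain w where w: "w \<in> ?V" "prefix u w"
        using pre by blast
      obtain i where "i \<in> A w"
        using A(2)[OF w(1)] by blast
      then have "w @ [i] \<in> children_of ?V A"
        using w(1) by simp
      moreover have "prefix u (w @ [i])"
        using w(2) by simp
      ultimately show ?thesis
        by blast
    qed auto
  next
    fix u
    assume "u \<in> {u. \<exists>w\<in>children_of ?V A. prefix u w}"
    then obtain w i where w: "w \<in> ?V" "i \<in> A w" "prefix u (w @ [i])"
      by (auto simp: children_of_def)
    then consider "u = w @ [i]" | "prefix u w"
      by auto
    then show "u \<in> ?S"
    proof cases
      case 1
      then show ?thesis
        using w by simp
    next
      case 2
      then have "u \<in> {u. \<exists>w\<in>?V. prefix u w}"
        using w(1) by blast
      then show ?thesis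
        using pre by blast
    qed
  qed
  ultimately show ?thesis
    unfolding valid_typed_tree_def lev using add_generation_in_trees_upto[OF t] by blast
qed

lemma sum_Pow_card:
  fixes f :: "nat \<Rightarrow> real"
  assumes "finite L"
  shows "(\<Sum>W\<in>Pow L - {{}}. f (card W)) = (\<Sum>m\<in>{1..card L}. real (card L choose m) * f m)"
proof -
  have "(\<Sum>W\<in>Pow L - {{}}. f (card W)) =
      (\<Sum>m\<in>{1..card L}. \<Sum>W\<in>{W \<in> Pow L - {{}}. card W = m}. f (card W))"
    using assms
    by (intro sum.group[symmetric]) (auto simp: card_mono Suc_le_eq card_gt_0_iff dest: finite_subset[OF _ assms])
  also have "\<dots> = (\<Sum>m\<in>{1..card L}. real (card L choose m) * f m)"
  proof (rule sum.cong[OF refl])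
    fix m
    assume "m \<in> {1..card L}"
    then have "{W \<in> Pow L - {{}}. card W = m} = {W. W \<subseteq> L \<and> card W = m}"
      by auto
    then show "(\<Sum>W\<in>{W \<in> Pow L - {{}}. card W = m}. f (card W)) = real (card L choose m) * f m"
      using n_subsets[OF assms, of m] by simp
  qed
  finally show ?thesis .
qed

context
  fixes \<eta> q \<theta> :: real
  assumes eta: "0 < \<eta>" "\<eta> \<le> 1" and q: "0 < q" "q < 1" and theta: "0 < \<theta>"
begin

text \<open>
The step behind the telescoping product: the Poisson probability divided by the number of configurations
is a quotient of factorials at consecutive values of the number of type-s vertices, and the powers of
the growth rate recombine because \<open>\<zeta>\<^sub>h\<close> is geometric in \<open>h\<close>.
\<close>

lemma s_weight_Suc:
  assumes "m \<ge> 1"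
  shows "s_weight \<eta> q \<theta> h m * pmf (poisson_pmf (\<theta> * zeta \<eta> q h)) \<Delta> * (1 / real ((m + \<Delta> - 1) choose \<Delta>)) *
    ((max q \<eta> / (1 - q)) ^ \<Delta> * growth_rate \<eta> q ^ m) = s_weight \<eta> q \<theta> (Suc h) (m + \<Delta>)"
proof -
  obtain j where m: "m = Suc j"
    using assms by (cases m) auto
  let ?b = "growth_rate \<eta> q" and ?l = "s_intensity \<eta> q \<theta>" and ?z = "\<theta> * zeta \<eta> q h"
  have z: "?z > 0"
    using theta zeta_pos[OF eta q] by simp
  have "fact \<Delta> * fact j * ((j + \<Delta>) choose \<Delta>) = (fact (j + \<Delta>) :: nat)"
    using binomial_fact_lemma[of \<Delta> "j + \<Delta>"] by simp
  then have "real (fact \<Delta> * fact j * ((j + \<Delta>) choose \<Delta>)) = real (fact (j + \<Delta>))"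
    by (simp only:)
  then have "real (fact (j + \<Delta>)) = real (fact \<Delta>) * real (fact j) * real ((j + \<Delta>) choose \<Delta>)"
    by (simp only: of_nat_mult)
  then have choose: "1 / real ((j + \<Delta>) choose \<Delta>) = fact \<Delta> * fact j / fact (j + \<Delta>)"
    by (simp add: field_simps)
  have rate: "?z * (max q \<eta> / (1 - q)) = ?l * ?b ^ Suc h"
    by (simp add: zeta_eq[OF eta q] s_intensity_def)
  have "s_weight \<eta> q \<theta> h m * pmf (poisson_pmf ?z) \<Delta> * (1 / real ((m + \<Delta> - 1) choose \<Delta>)) *
      ((max q \<eta> / (1 - q)) ^ \<Delta> * ?b ^ m) =
    exp (- (\<Sum>l<h. \<theta> * zeta \<eta> q l)) * exp (- ?z) * (?z * (max q \<eta> / (1 - q))) ^ \<Delta> *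
      (?b ^ h * ?b ^ m * (?l * ?b ^ h) ^ j) / fact (j + \<Delta>)"
    using z by (simp add: m s_weight_def choose power_mult_distrib del: times_divide_eq_right times_divide_eq_left)
      (simp add: power_mult_distrib power_divide field_simps)
  also have "?b ^ h * ?b ^ m * (?l * ?b ^ h) ^ j = ?b ^ Suc h * (?l * ?b ^ Suc h) ^ j"
    by (simp add: m power_mult_distrib mult_ac)
  also have "exp (- (\<Sum>l<h. \<theta> * zeta \<eta> q l)) * exp (- ?z) = exp (- (\<Sum>l<Suc h. \<theta> * zeta \<eta> q l))"
    by (simp add: exp_add[symmetric])
  finally show ?thesis
    unfolding rate by (simp add: m s_weight_def power_add mult_ac)
qed

lemma set_typed_tree_law:
  "(t, S) \<in> set_pmf (typed_tree_law \<eta> q \<theta> h) \<Longrightarrow> valid_typed_tree h t S"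
proof (induction h arbitrary: t S)
  case 0
  then show ?case
    using root_in_trees_upto_0 by (auto simp: valid_typed_tree_def level_def)
next
  case (Suc h)
  then obtain t1 S1 where 1: "(t1, S1) \<in> set_pmf (typed_tree_law \<eta> q \<theta> h)"
    "(t, S) \<in> set_pmf (grow \<eta> q \<theta> h (t1, S1))"
    by auto
  note v = Suc.IH[OF 1(1)]
  then have v': "t1 \<in> trees_upto h" "S1 \<subseteq> t1" "level h S1 \<noteq> {}"
    by (auto simp: valid_typed_tree_def)
  obtain \<Delta> s k A where "grow_data h t1 S1 \<Delta> s k A" "(t, S) = grow_state h t1 S1 k A"
    using set_grow[OF eta q theta v' 1(2)] by blast
  then show ?case
    using valid_typed_tree_grow[OF v] by (simp add: grow_state_def)
qed

text \<open>
A typed tree in the support determines its truncation, so its probability is a product over generations.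
The induction step combines the tilts of one generation with the recursion for \<open>s_weight\<close>.
\<close>

lemma pmf_typed_tree_law:
  "(t, S) \<in> set_pmf (typed_tree_law \<eta> q \<theta> h) \<Longrightarrow>
   pmf (typed_tree_law \<eta> q \<theta> h) (t, S) = gw_weight (geom_offspring \<eta> q) h t * s_weight \<eta> q \<theta> h (card (level h S)) *
     ext_prob \<eta> q ^ (card (level h t) - card (level h S))"
proof (induction h arbitrary: t S)
  case 0
  then have "t = {[]}" "S = {[]}"
    by auto
  moreover have "level 0 {[]} = {[]}"
    by (auto simp: level_def)
  ultimately show ?case
    by (simp add: gw_weight_def s_weight_def)
next
  case (Suc h)
  then obtain t1 S1 where 1: "(t1, S1) \<in> set_pmf (typed_tree_law \<eta> q \<theta> h)"
    "(t, S) \<in> set_pmf (grow \<eta> q \<theta> h (t1, S1))"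
    by auto
  let ?V = "level h S1" and ?L = "level h t1" and ?p = "geom_offspring \<eta> q"
  have v: "t' \<in> trees_upto h" "S' \<subseteq> t'" "level h S' \<noteq> {}"
    if "(t', S') \<in> set_pmf (typed_tree_law \<eta> q \<theta> h)" for t' S'
    using set_typed_tree_law[OF that] by (auto simp: valid_typed_tree_def)
  note v1 = v[OF 1(1)]
  have restrict: "t' = restrict_height h t \<and> S' = restrict_height h S"
    if *: "(t', S') \<in> set_pmf (typed_tree_law \<eta> q \<theta> h)" "(t, S) \<in> set_pmf (grow \<eta> q \<theta> h (t', S'))" for t' S'
  proof -
    note v' = v[OF *(1)]
    obtain \<Delta> s k A where "(t, S) = grow_state h t' S' k A"
      using set_grow[OF eta q theta v' *(2)] by blast
    then have "t = add_generation h t' k" "S = S' \<union> children_of (level h S') A"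
      by (auto simp: grow_state_def)
    moreover have "restrict_height h (S' \<union> children_of (level h S') A) = S'"
      using v'(1,2) length_children_of[of _ h S' A] by (fastforce simp: restrict_height_def trees_upto_def)
    ultimately show ?thesis
      using restrict_height_add_generation[OF v'(1)] by simp
  qed
  obtain \<Delta> s k A where d: "grow_data h t1 S1 \<Delta> s k A" and x: "(t, S) = grow_state h t1 S1 k A"
    using set_grow[OF eta q theta v1 1(2)] by blast
  then have tS: "t = add_generation h t1 k" "S = S1 \<union> children_of ?V A"
    by (auto simp: grow_state_def)
  have m: "card ?V \<ge> 1"
    using v1(3) finite_levels(2)[OF v1(1,2)] by (simp add: Suc_le_eq card_gt_0_iff)
  have card_t: "card (level (Suc h) t) = (\<Sum>u\<in>?L. k u)"
    unfolding tS by (rule card_level_Suc_add_generation[OF v1(1)])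
  have card_S: "card (level (Suc h) S) = card ?V + \<Delta>"
  proof -
    have "card (children_of ?V A) = (\<Sum>u\<in>?V. card (A u))"
      using d finite_levels(2)[OF v1(1,2)]
      by (intro card_children_of) (auto simp: grow_data_def intro: finite_subset[OF _ finite_atLeastAtMost])
    also have "\<dots> = (\<Sum>u\<in>?V. s u)"
      using d by (intro sum.cong) (auto simp: grow_data_def)
    also have "\<dots> = card ?V + \<Delta>"
      using d by (simp add: grow_data_def s_configurations_def)
    finally show ?thesis
      unfolding tS(2) level_Suc_S[OF v1(2,1)] .
  qed
  have "pmf (typed_tree_law \<eta> q \<theta> (Suc h)) (t, S) =
      pmf (typed_tree_law \<eta> q \<theta> h) (t1, S1) * pmf (grow \<eta> q \<theta> h (t1, S1)) (t, S)"
    unfolding typed_tree_law.simps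
  proof (rule pmf_bind_unique_source)
    fix y
    assume "y \<in> set_pmf (typed_tree_law \<eta> q \<theta> h)" "(t, S) \<in> set_pmf (grow \<eta> q \<theta> h y)"
    then show "y = (t1, S1)"
      using restrict[OF 1] restrict[of "fst y" "snd y"] by (cases y) simp
  qed
  also have "\<dots> = gw_weight ?p h t1 * (s_weight \<eta> q \<theta> h (card ?V) *
      pmf (poisson_pmf (\<theta> * zeta \<eta> q h)) \<Delta> * (1 / real ((card ?V + \<Delta> - 1) choose \<Delta>))) *
     (ext_prob \<eta> q ^ (card ?L - card ?V) *
     ((\<Prod>u\<in>?L. pmf (if u \<in> ?V then size_biased_offspring \<eta> q (s u) else e_offspring \<eta> q) (k u)) *
      (\<Prod>u\<in>?V. 1 / real (k u choose s u))))"
    unfolding Suc.IH[OF 1(1)] x pmf_grow[OF eta q theta v1 d] by (simp only: mult_ac)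
  also have "\<dots> = (gw_weight ?p h t1 * (\<Prod>u\<in>?L. pmf ?p (k u))) *
      (s_weight \<eta> q \<theta> h (card ?V) * pmf (poisson_pmf (\<theta> * zeta \<eta> q h)) \<Delta> *
        (1 / real ((card ?V + \<Delta> - 1) choose \<Delta>)) *
        ((max q \<eta> / (1 - q)) ^ \<Delta> * growth_rate \<eta> q ^ card ?V)) *
      ext_prob \<eta> q ^ ((\<Sum>u\<in>?L. k u) - (card ?V + \<Delta>))"
    unfolding pmf_grow_tilt[OF eta q theta v1 d] by (simp only: mult_ac)
  also have "gw_weight ?p h t1 * (\<Prod>u\<in>?L. pmf ?p (k u)) = gw_weight ?p (Suc h) t"
    unfolding tS(1) by (rule gw_weight_add_generation[OF v1(1), symmetric])
  finally show ?case
    unfolding s_weight_Suc[OF m] card_t card_S .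
qed

lemma s_weight_nonneg: "s_weight \<eta> q \<theta> h m \<ge> 0"
  using growth_rate_pos[OF eta q] s_intensity_pos[OF eta q theta] by (simp add: s_weight_def)

lemma ext_prob_nonneg: "ext_prob \<eta> q \<ge> 0"
  using eta q by (simp add: ext_prob_def)

text \<open>
The law of the truncated typed tree is prescribed on single states. They are countably many with total
mass \<open>1\<close>, so the truncated typed tree almost surely lies in the support.
\<close>

lemma theta_tree_typed_law:
  assumes "theta_tree \<eta> q \<theta> M T"
  shows "\<exists>X. (\<forall>x. {\<omega>\<in>space M. X \<omega> = x} \<in> sets M) \<and>
    (\<forall>x. measure M {\<omega>\<in>space M. X \<omega> = x} = pmf (typed_tree_law \<eta> q \<theta> h) x) \<and>
    (AE \<omega> in M. X \<omega> \<in> set_pmf (typed_tree_law \<eta> q \<theta> h)) \<and>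
    (\<forall>\<omega>. fst (X \<omega>) = restrict_height h (T \<omega>))"
proof -
  let ?law = "typed_tree_law \<eta> q \<theta> h"
  have T: "prob_space M" "T \<in> M \<rightarrow>\<^sub>M tree_borel"
    using assms by (auto simp: theta_tree_def random_tree_def)
  interpret prob_space M
    by (rule T(1))
  obtain S where S: "\<And>u. {\<omega>\<in>space M. u \<in> S \<omega>} \<in> sets M"
      "\<And>t V. measure M {\<omega>\<in>space M. restrict_height h (T \<omega>) = t \<and> restrict_height h (S \<omega>) = V} = pmf ?law (t, V)"
  proof -
    from assms obtain S where
      "\<forall>u. {\<omega>\<in>space M. u \<in> S \<omega>} \<in> sets M"
      "\<forall>h t V. measure M {\<omega>\<in>space M. restrict_height h (T \<omega>) = t \<and> restrict_height h (S \<omega>) = V} =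
         pmf (typed_tree_law \<eta> q \<theta> h) (t, V)"
      unfolding theta_tree_def by (elim conjE exE)
    then show thesis
      by (intro that[of S]) simp_all
  qed
  define X where "X \<omega> = (restrict_height h (T \<omega>), restrict_height h (S \<omega>))" for \<omega>
  have X_eq: "{\<omega>\<in>space M. X \<omega> = (t, V)} =
      {\<omega>\<in>space M. restrict_height h (T \<omega>) = t} \<inter> {\<omega>\<in>space M. restrict_height h (S \<omega>) = V}" for t V
    by (auto simp: X_def)
  have X_sets: "{\<omega>\<in>space M. X \<omega> = x} \<in> sets M" for x
    using sets_restrict_height_tree_eq[OF T(2)] sets_restrict_height_eq[OF S(1)]
    by (cases x) (simp only: X_eq sets.Int)
  have X_pmf: "measure M {\<omega>\<in>space M. X \<omega> = x} = pmf ?law x" for x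
    using S(2)[of "fst x" "snd x"] by (cases x) (simp add: X_def)
  have "{\<omega>\<in>space M. X \<omega> \<in> set_pmf ?law} = (\<Union>x\<in>set_pmf ?law. {\<omega>\<in>space M. X \<omega> = x})"
    by auto
  then have "emeasure M {\<omega>\<in>space M. X \<omega> \<in> set_pmf ?law} =
      (\<integral>\<^sup>+x. emeasure M {\<omega>\<in>space M. X \<omega> = x} \<partial>count_space (set_pmf ?law))"
    using X_sets by (simp only:) (intro emeasure_UN_countable, auto simp: disjoint_family_on_def)
  also have "\<dots> = (\<integral>\<^sup>+x. ennreal (pmf ?law x) \<partial>count_space (set_pmf ?law))"
    by (simp only: emeasure_eq_measure X_pmf)
  also have "\<dots> = 1"
    by (simp add: nn_integral_pmf emeasure_pmf)
  finally have "measure M {\<omega>\<in>space M. X \<omega> \<in> set_pmf ?law} = 1"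
    by (simp add: emeasure_eq_measure)
  moreover have "{\<omega>\<in>space M. X \<omega> \<in> set_pmf ?law} \<in> sets M"
    unfolding \<open>{\<omega>\<in>space M. X \<omega> \<in> set_pmf ?law} = _\<close>
    using X_sets by (intro sets.countable_UN') auto
  ultimately have "AE \<omega> in M. X \<omega> \<in> set_pmf ?law"
    by (simp add: prob_Collect_eq_1)
  then show ?thesis
    using X_sets X_pmf by (intro exI[of _ X]) (simp add: X_def)
qed

lemma theta_tree_support:
  assumes th: "theta_tree \<eta> q \<theta> M T"
  shows "AE \<omega> in M. restrict_height h (T \<omega>) \<in> fst ` set_pmf (typed_tree_law \<eta> q \<theta> h)"
proof -
  obtain X where X: "AE \<omega> in M. X \<omega> \<in> set_pmf (typed_tree_law \<eta> q \<theta> h)"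
    "\<forall>\<omega>. fst (X \<omega>) = restrict_height h (T \<omega>)"
    using theta_tree_typed_law[OF th, of h] by (elim exE conjE)
  from X(1) show ?thesis
    unfolding X(2)[rule_format, symmetric] by eventually_elim (rule imageI)
qed

text \<open>
The type-s vertices in the support are determined by their last level, a nonempty subset of level \<open>h\<close> of \<open>t\<close>.
The probability of each of them depends on the size of this subset only, so the sum is bounded by
a sum over the sizes, with binomial coefficients.
\<close>

lemma theta_tree_cylinder_le:
  assumes th: "theta_tree \<eta> q \<theta> M T" and t: "t \<in> fst ` set_pmf (typed_tree_law \<eta> q \<theta> h)"
  shows "measure M {\<omega>\<in>space M. restrict_height h (T \<omega>) = t} \<le>
    gw_weight (geom_offspring \<eta> q) h t * (\<Sum>m\<in>{1..card (level h t)}. real (card (level h t) choose m) *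
      (s_weight \<eta> q \<theta> h m * ext_prob \<eta> q ^ (card (level h t) - m)))"
proof -
  let ?law = "typed_tree_law \<eta> q \<theta> h" and ?L = "level h t"
  define g where "g m = s_weight \<eta> q \<theta> h m * ext_prob \<eta> q ^ (card ?L - m)" for m
  have g: "g m \<ge> 0" for m
    using s_weight_nonneg ext_prob_nonneg by (simp add: g_def)
  interpret prob_space M
    using th by (simp add: theta_tree_def random_tree_def)
  obtain X where "\<forall>x. {\<omega>\<in>space M. X \<omega> = x} \<in> sets M"
    "\<forall>x. measure M {\<omega>\<in>space M. X \<omega> = x} = pmf ?law x"
    "AE \<omega> in M. X \<omega> \<in> set_pmf ?law" "\<forall>\<omega>. fst (X \<omega>) = restrict_height h (T \<omega>)"
    using theta_tree_typed_law[OF th, of h] by (elim exE conjE)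
  note X = this(1)[rule_format] this(2)[rule_format] this(3) this(4)[rule_format]
  define A where "A = {S. (t, S) \<in> set_pmf ?law}"
  have valid: "valid_typed_tree h t S" if "S \<in> A" for S
    using that set_typed_tree_law by (simp add: A_def)
  have tt: "t \<in> trees_upto h"
    using t set_typed_tree_law by (force simp: valid_typed_tree_def)
  have finA: "finite A"
    using valid tt by (intro finite_subset[of A "Pow t"]) (auto simp: valid_typed_tree_def trees_upto_def)
  have "measure M {\<omega>\<in>space M. restrict_height h (T \<omega>) = t} \<le> measure M (\<Union>S\<in>A. {\<omega>\<in>space M. X \<omega> = (t, S)})"
  proof (rule finite_measure_mono_AE)
    show "(\<Union>S\<in>A. {\<omega>\<in>space M. X \<omega> = (t, S)}) \<in> sets M"
      using finA X(1) by (intro sets.finite_UN) auto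
    show "AE \<omega> in M. \<omega> \<in> {\<omega>\<in>space M. restrict_height h (T \<omega>) = t} \<longrightarrow>
        \<omega> \<in> (\<Union>S\<in>A. {\<omega>\<in>space M. X \<omega> = (t, S)})"
      using X(3)
    proof eventually_elim
      case (elim \<omega>)
      then show ?case
        using X(4)[of \<omega>] by (cases "X \<omega>") (auto simp: A_def)
    qed
  qed
  also have "\<dots> = (\<Sum>S\<in>A. measure M {\<omega>\<in>space M. X \<omega> = (t, S)})"
    using finA X(1) by (intro finite_measure_finite_Union) (auto simp: disjoint_family_on_def)
  also have "\<dots> = (\<Sum>S\<in>A. gw_weight (geom_offspring \<eta> q) h t * g (card (level h S)))"
    by (intro sum.cong refl) (simp add: X(2) A_def pmf_typed_tree_law g_def mult.assoc)
  also have "\<dots> = gw_weight (geom_offspring \<eta> q) h t * (\<Sum>S\<in>A. g (card (level h S)))"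
    by (simp add: sum_distrib_left)
  also have "\<dots> \<le> gw_weight (geom_offspring \<eta> q) h t * (\<Sum>m\<in>{1..card ?L}. real (card ?L choose m) * g m)"
  proof (rule mult_left_mono)
    have "(\<Sum>S\<in>A. g (card (level h S))) = (\<Sum>W\<in>level h ` A. g (card W))"
    proof (rule sum.reindex_cong[symmetric])
      show "inj_on (level h) A"
      proof (rule inj_onI)
        fix S S'
        assume "S \<in> A" "S' \<in> A" "level h S = level h S'"
        then show "S = S'"
          using valid[of S] valid[of S'] unfolding valid_typed_tree_def by metis
      qed
    qed auto
    also have "\<dots> \<le> (\<Sum>W\<in>Pow ?L - {{}}. g (card W))"
      using valid finite_level_trees_upto[OF tt] g
      by (intro sum_mono2) (auto simp: valid_typed_tree_def level_def)
    also have "\<dots> = (\<Sum>m\<in>{1..card ?L}. real (card ?L choose m) * g m)"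
      using finite_level_trees_upto[OF tt] by (rule sum_Pow_card)
    finally show "(\<Sum>S\<in>A. g (card (level h S))) \<le> (\<Sum>m\<in>{1..card ?L}. real (card ?L choose m) * g m)" .
    show "0 \<le> gw_weight (geom_offspring \<eta> q) h t"
      by (simp add: gw_weight_def prod_nonneg)
  qed
  finally show ?thesis
    by (simp only: g_def)
qed

end

section \<open>Asymptotics of the survival probability and of the geometric parameter\<close>

text \<open>
From \<open>- y / (1 - y) \<le> ln (1 - y) \<le> - y\<close>, in exponential form.
\<close>

lemma tendsto_one_minus_power:
  fixes y :: "nat \<Rightarrow> real" and a :: "nat \<Rightarrow> nat"
  assumes y: "y \<longlonglongrightarrow> 0" "eventually (\<lambda>n. 0 \<le> y n) sequentially" and a: "(\<lambda>n. real (a n) * y n) \<longlonglongrightarrow> l"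
  shows "(\<lambda>n. (1 - y n) ^ a n) \<longlonglongrightarrow> exp (- l)"
proof (rule tendsto_sandwich)
  have y1: "eventually (\<lambda>n. y n < 1) sequentially"
    using order_tendstoD(2)[OF y(1), of 1] by simp
  show "eventually (\<lambda>n. exp (- (real (a n) * y n / (1 - y n))) \<le> (1 - y n) ^ a n) sequentially"
    using y1
  proof eventually_elim
    case (elim n)
    have "exp (- (y n / (1 - y n))) = inverse (exp (y n / (1 - y n)))"
      by (simp add: exp_minus)
    also have "\<dots> \<le> inverse (1 + y n / (1 - y n))"
      using elim exp_ge_add_one_self[of "y n / (1 - y n)"]
      by (intro le_imp_inverse_le) (auto simp: field_simps)
    also have "\<dots> = 1 - y n"
      using elim by (simp add: field_simps)
    finally have "exp (- (y n / (1 - y n))) ^ a n \<le> (1 - y n) ^ a n"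
      by (intro power_mono) auto
    then show ?case
      by (simp add: exp_of_nat_mult[symmetric])
  qed
  show "eventually (\<lambda>n. (1 - y n) ^ a n \<le> exp (- (real (a n) * y n))) sequentially"
    using y1
  proof eventually_elim
    case (elim n)
    have "(1 - y n) ^ a n \<le> exp (- y n) ^ a n"
      using elim exp_ge_add_one_self[of "- y n"] by (intro power_mono) auto
    then show ?case
      by (simp add: exp_of_nat_mult[symmetric])
  qed
  have "(\<lambda>n. exp (- (real (a n) * y n / (1 - y n)))) \<longlonglongrightarrow> exp (- (l / (1 - 0)))"
    by (intro tendsto_intros a y) auto
  then show "(\<lambda>n. exp (- (real (a n) * y n / (1 - y n)))) \<longlonglongrightarrow> exp (- l)"
    by simp
  show "(\<lambda>n. exp (- (real (a n) * y n))) \<longlonglongrightarrow> exp (- l)"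
    by (intro tendsto_intros a)
qed

text \<open>
The binomial coefficient is a product of \<open>k\<close> factors, each of which absorbs one factor \<open>x n\<close>.
\<close>

lemma tendsto_binomial_mult_power:
  fixes x :: "nat \<Rightarrow> real" and a :: "nat \<Rightarrow> nat"
  assumes x: "x \<longlonglongrightarrow> 0" and a: "filterlim a at_top sequentially" and ax: "(\<lambda>n. real (a n) * x n) \<longlonglongrightarrow> l"
  shows "(\<lambda>n. real ((a n - 1) choose k) * x n ^ k) \<longlonglongrightarrow> l ^ k / fact k"
proof -
  have ev: "eventually (\<lambda>n. a n \<ge> Suc k) sequentially"
    using a by (simp add: filterlim_at_top)
  have "(\<lambda>n. (\<Prod>i=0..<k. (real (a n) * x n - (1 + real i) * x n) / real (k - i))) \<longlonglongrightarrow>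
      (\<Prod>i=0..<k. (l - (1 + real i) * 0) / real (k - i))"
    by (intro tendsto_prod tendsto_divide tendsto_diff tendsto_mult tendsto_const x ax) auto
  also have "(\<Prod>i=0..<k. (l - (1 + real i) * 0) / real (k - i)) = l ^ k / (\<Prod>i=0..<k. real (k - i))"
    by (simp add: prod_dividef)
  also have "(\<Prod>i=0..<k. real (k - i)) = fact k"
    by (simp add: fact_prod_rev)
  finally have "(\<lambda>n. (\<Prod>i=0..<k. (real (a n) * x n - (1 + real i) * x n) / real (k - i))) \<longlonglongrightarrow> l ^ k / fact k" .
  then show ?thesis
  proof (rule Lim_transform_eventually)
    show "eventually (\<lambda>n. (\<Prod>i=0..<k. (real (a n) * x n - (1 + real i) * x n) / real (k - i)) =
        real ((a n - 1) choose k) * x n ^ k) sequentially"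
      using ev
    proof eventually_elim
      case (elim n)
      have "real ((a n - 1) choose k) = (\<Prod>i=0..<k. real (a n - 1 - i) / real (k - i))"
        using elim by (subst binomial_altdef_of_nat) auto
      moreover have "x n ^ k = (\<Prod>i=0..<k. x n)"
        by simp
      ultimately have "real ((a n - 1) choose k) * x n ^ k = (\<Prod>i=0..<k. real (a n - 1 - i) / real (k - i) * x n)"
        by (simp only: prod.distrib)
      also have "\<dots> = (\<Prod>i=0..<k. (real (a n) * x n - (1 + real i) * x n) / real (k - i))"
        using elim by (intro prod.cong) (auto simp: of_nat_diff field_simps)
      finally show ?case
        by simp
    qed
  qed
qed

lemma tendsto_ratio_Suc_scaled:
  fixes f :: "nat \<Rightarrow> real"
  assumes "(\<lambda>n. f n * c ^ n) \<longlonglongrightarrow> l" "l \<noteq> 0" "c > 0"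
  shows "(\<lambda>n. f n / f (Suc n)) \<longlonglongrightarrow> c"
proof -
  have "(\<lambda>n. c * ((f n * c ^ n) / (f (Suc n) * c ^ Suc n))) \<longlonglongrightarrow> c * (l / l)"
    using assms(1) LIMSEQ_Suc[OF assms(1)] assms(2) by (intro tendsto_intros)
  moreover have "c * ((f n * c ^ n) / (f (Suc n) * c ^ Suc n)) = f n / f (Suc n)" for n
    using assms(3) by simp
  ultimately show ?thesis
    using assms(2) by simp
qed

lemma tendsto_ratio_shift:
  fixes f :: "nat \<Rightarrow> real"
  assumes ratio: "(\<lambda>n. f n / f (Suc n)) \<longlonglongrightarrow> b" and pos: "\<And>n. n > 0 \<Longrightarrow> f n > 0"
  shows "(\<lambda>n. f (n - h) / f n) \<longlonglongrightarrow> b ^ h"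
proof (induction h)
  case 0
  have "eventually (\<lambda>n. 1 = f (n - 0) / f n) sequentially"
    using eventually_gt_at_top[of 0]
  proof eventually_elim
    case (elim n)
    then show ?case
      using pos[of n] by simp
  qed
  then show ?case
    by (intro Lim_transform_eventually[OF tendsto_const]) auto
next
  case (Suc h)
  have "(\<lambda>n. f (n - Suc h) / f (Suc (n - Suc h))) \<longlonglongrightarrow> b"
    using ratio by (rule filterlim_compose) (rule filterlim_minus_const_nat_at_top)
  then have "(\<lambda>n. f (n - Suc h) / f (Suc (n - Suc h)) * (f (n - h) / f n)) \<longlonglongrightarrow> b * b ^ h"
    using Suc by (rule tendsto_mult)
  moreover have "eventually (\<lambda>n. f (n - Suc h) / f (Suc (n - Suc h)) * (f (n - h) / f n) = f (n - Suc h) / f n) sequentially"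
    using eventually_gt_at_top[of h]
  proof eventually_elim
    case (elim n)
    then have "Suc (n - Suc h) = n - h" "f (n - h) > 0"
      using pos by auto
    then show ?case
      by simp
  qed
  ultimately show ?case
    unfolding power_Suc by (rule Lim_transform_eventually)
qed

text \<open>
This is \<open>\<alpha>\<^sub>n \<beta>\<^sub>n / (1 - \<beta>\<^sub>n)\<close>, the reciprocal of the scale on which the conditioned sizes grow.
\<close>

definition size_scale :: "real \<Rightarrow> real \<Rightarrow> nat \<Rightarrow> real" where
  "size_scale \<eta> q n = slope \<eta> q n / (shift \<eta> q n * (slope \<eta> q n + shift \<eta> q n))"

context
  fixes \<eta> q :: real
  assumes eta: "0 < \<eta>" "\<eta> \<le> 1" and q: "0 < q" "q < 1"
begin

lemma size_scale_pos: "n > 0 \<Longrightarrow> size_scale \<eta> q n > 0"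
  using slope_pos[OF eta q, of n] shift_pos[OF eta q, of n] by (simp add: size_scale_def)

lemma size_scale_eq: "n > 0 \<Longrightarrow> size_scale \<eta> q n = survival_prob \<eta> q n * geom_param \<eta> q n / (1 - geom_param \<eta> q n)"
  using slope_pos[OF eta q, of n] shift_pos[OF eta q, of n]
  unfolding size_scale_def one_minus_geom_param[OF eta q] by (simp add: survival_prob_def geom_param_def)

text \<open>
Consecutive values of \<open>1 - \<beta>\<^sub>n\<close> differ by a relative amount of the order of \<open>1 / a\<^sub>n\<close>, so their ratio to the
power \<open>a\<^sub>n\<close> has an exponential limit; this is the source of the exponential factor of the Poisson
probabilities. The identity follows from the relation
\<open>shift (1 - 1 / \<mu>) = (1 - q) / \<eta> (1 - slope)\<close>, a form of the geometric sum that is also true for \<open>\<mu> = 1\<close>.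
\<close>

lemma geom_param_ratio:
  assumes "n > 0"
  shows "(1 - geom_param \<eta> q n) / (1 - geom_param \<eta> q (Suc n)) =
    1 - (1 - q) / \<eta> * (shift \<eta> q n / shift \<eta> q (Suc n)) * size_scale \<eta> q n"
proof -
  let ?M = "slope \<eta> q n" and ?N = "shift \<eta> q n" and ?N1 = "(1 - q) / \<eta>" and ?m = "q / \<eta>"
  have pos: "?M > 0" "?N > 0" "?N1 > 0" "?m > 0"
    using slope_pos[OF eta q] shift_pos[OF eta q] assms eta q by auto
  have key: "?m * ?M + (?N + ?N1 * ?M) = ?N + ?M / \<eta>"
    using eta by (simp add: field_simps)
  have N: "?N = ?N1 * (1 - ?m ^ n) / (1 - ?m)" if "?m \<noteq> 1"
    by (simp only: shift_def sum_gp_strict that if_False times_divide_eq_right)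
  have rel: "?N * (1 - ?m) = ?N1 * (1 - ?M)"
  proof (cases "?m = 1")
    case True
    then show ?thesis
      by (simp only: slope_def power_one diff_self mult_zero_right)
  next
    case False
    then show ?thesis
      using N by (simp add: slope_def)
  qed
  have rel2: "(?N + ?M / \<eta>) * ?N - ((?N + ?N1 * ?M) * (?M + ?N) - ?N1 * ?M) = 0"
  proof -
    have "(?N + ?M / \<eta>) * ?N - ((?N + ?N1 * ?M) * (?M + ?N) - ?N1 * ?M) =
      ?M * (?N / \<eta> - ?N - ?N1 * ?N - ?N1 * ?M + ?N1)"
      by (simp add: algebra_simps add_divide_distrib diff_divide_distrib)
    also have "?N / \<eta> - ?N - ?N1 * ?N = - (?N * (1 - ?m))"
      using eta by (simp add: field_simps)
    finally have "(?N + ?M / \<eta>) * ?N - ((?N + ?N1 * ?M) * (?M + ?N) - ?N1 * ?M) =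
        ?M * (- (?N1 * (1 - ?M)) - ?N1 * ?M + ?N1)"
      by (simp only: rel)
    also have "\<dots> = 0"
      by (simp only: right_diff_distrib mult_1_right) simp
    finally show ?thesis .
  qed
  have "(1 - geom_param \<eta> q n) / (1 - geom_param \<eta> q (Suc n)) =
      (?N / (?M + ?N)) / ((?N + ?N1 * ?M) / (?N + ?M / \<eta>))"
    by (simp only: one_minus_geom_param[OF eta q] slope_Suc[OF eta q] shift_Suc[OF eta q] key)
  also have "\<dots> = (?N + ?M / \<eta>) * ?N / ((?N + ?N1 * ?M) * (?M + ?N))"
    by (simp add: mult.commute)
  also have "(?N + ?M / \<eta>) * ?N = (?N + ?N1 * ?M) * (?M + ?N) - ?N1 * ?M"
    using rel2 by simp
  also have "\<dots> / ((?N + ?N1 * ?M) * (?M + ?N)) = 1 - ?N1 * ?M / ((?N + ?N1 * ?M) * (?M + ?N))"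
  proof -
    have "(?N + ?N1 * ?M) * (?M + ?N) > 0"
      by (intro add_pos_pos mult_pos_pos pos)
    moreover have "(x - y) / x = 1 - y / x" if "x > 0" for x y :: real
      using that by (simp add: diff_divide_distrib)
    ultimately show ?thesis
      by blast
  qed
  also have "?N1 * ?M / ((?N + ?N1 * ?M) * (?M + ?N)) = ?N1 * (?N / (?N + ?N1 * ?M)) * size_scale \<eta> q n"
    using pos by (simp add: size_scale_def)
  finally show ?thesis
    by (simp add: shift_Suc[OF eta q])
qed

lemma slope_tendsto_0: "q < \<eta> \<Longrightarrow> slope \<eta> q \<longlonglongrightarrow> 0"
  unfolding slope_def using eta q by (intro LIMSEQ_realpow_zero) auto

lemma shift_tendsto_supercritical:
  assumes "q < \<eta>"
  shows "shift \<eta> q \<longlonglongrightarrow> (1 - q) / (\<eta> - q)"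
proof -
  have "(\<lambda>n. (1 - q) / \<eta> * (\<Sum>j<n. (q / \<eta>) ^ j)) \<longlonglongrightarrow> (1 - q) / \<eta> * (1 / (1 - q / \<eta>))"
    using geometric_sums[of "q / \<eta>"] eta q assms by (intro tendsto_intros) (auto simp: sums_def)
  also have "1 - q / \<eta> = (\<eta> - q) / \<eta>"
    using eta by (simp add: field_simps)
  also have "(1 - q) / \<eta> * (1 / ((\<eta> - q) / \<eta>)) = (1 - q) / (\<eta> - q)"
    using eta by simp
  finally show ?thesis
    by (simp add: shift_def[abs_def])
qed

lemma shift_scaled_subcritical:
  assumes "\<eta> < q"
  shows "(\<lambda>n. shift \<eta> q n * (\<eta> / q) ^ n) \<longlonglongrightarrow> (1 - q) / (q - \<eta>)"
proof -
  have "shift \<eta> q n * (\<eta> / q) ^ n = (1 - q) / (q - \<eta>) * (1 - (\<eta> / q) ^ n)" for n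
  proof -
    have "shift \<eta> q n = (1 - q) / \<eta> * ((1 - (q / \<eta>) ^ n) / (1 - q / \<eta>))"
      using assms eta by (simp add: shift_def sum_gp_strict)
    also have "\<dots> = (1 - q) / (q - \<eta>) * ((q / \<eta>) ^ n - 1)"
      using assms eta by (simp add: field_simps)
    finally show ?thesis
      using eta q by (simp add: algebra_simps power_mult_distrib[symmetric])
  qed
  moreover have "(\<lambda>n. (1 - q) / (q - \<eta>) * (1 - (\<eta> / q) ^ n)) \<longlonglongrightarrow> (1 - q) / (q - \<eta>) * (1 - 0)"
    using assms eta q by (intro tendsto_intros LIMSEQ_realpow_zero) auto
  ultimately show ?thesis
    by simp
qed

lemma slope_scaled: "slope \<eta> q n * (\<eta> / q) ^ n = 1"
  using eta q by (simp add: slope_def power_mult_distrib[symmetric])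

lemma shift_critical: "\<eta> = q \<Longrightarrow> shift \<eta> q n = (1 - q) / q * real n"
  using eta by (simp add: shift_def)

lemma slope_critical: "\<eta> = q \<Longrightarrow> slope \<eta> q n = 1"
  using eta by (simp add: slope_def)

lemma shift_ratio: "(\<lambda>n. shift \<eta> q n / shift \<eta> q (Suc n)) \<longlonglongrightarrow> min 1 (\<eta> / q)"
proof (cases \<eta> q rule: linorder_cases)
  case less
  then show ?thesis
    using tendsto_ratio_Suc_scaled[OF shift_scaled_subcritical] eta q by (simp add: min_def)
next
  case equal
  have "(\<lambda>n. real n / real (Suc n)) \<longlonglongrightarrow> 1"
    by (rule LIMSEQ_n_over_Suc_n)
  moreover have "shift \<eta> q n / shift \<eta> q (Suc n) = real n / real (Suc n)" for n
    unfolding shift_critical[OF equal] using q by simp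
  ultimately show ?thesis
    using equal q by simp
next
  case greater
  then show ?thesis
    using tendsto_ratio_Suc_scaled[of "shift \<eta> q" 1] shift_tendsto_supercritical eta q
    by (simp add: min_def)
qed

lemma slope_plus_shift_ratio:
  "(\<lambda>n. (slope \<eta> q n + shift \<eta> q n) / (slope \<eta> q (Suc n) + shift \<eta> q (Suc n))) \<longlonglongrightarrow> min 1 (\<eta> / q)"
proof (cases \<eta> q rule: linorder_cases)
  case less
  have "(\<lambda>n. (slope \<eta> q n + shift \<eta> q n) * (\<eta> / q) ^ n) \<longlonglongrightarrow> 1 + (1 - q) / (q - \<eta>)"
    unfolding distrib_right slope_scaled by (intro tendsto_intros shift_scaled_subcritical less)
  moreover have "1 + (1 - q) / (q - \<eta>) > 0"
    using less q by (intro add_pos_pos) auto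
  ultimately show ?thesis
    using tendsto_ratio_Suc_scaled less eta q by (fastforce simp: min_def)
next
  case equal
  have "(\<lambda>n. (1 + (1 - q) / q * real n) / (1 + (1 - q) / q * real (Suc n))) \<longlonglongrightarrow> 1"
  proof -
    have "(\<lambda>n. (1 / real n + (1 - q) / q) / (1 / real n + (1 - q) / q * (1 + 1 / real n))) \<longlonglongrightarrow>
        (0 + (1 - q) / q) / (0 + (1 - q) / q * (1 + 0))"
      using q by (intro tendsto_intros lim_1_over_n) auto
    then have "(\<lambda>n. (1 / real n + (1 - q) / q) / (1 / real n + (1 - q) / q * (1 + 1 / real n))) \<longlonglongrightarrow> 1"
      using q by simp
    then show ?thesis
    proof (rule Lim_transform_eventually)
      show "eventually (\<lambda>n. (1 / real n + (1 - q) / q) / (1 / real n + (1 - q) / q * (1 + 1 / real n)) =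
          (1 + (1 - q) / q * real n) / (1 + (1 - q) / q * real (Suc n))) sequentially"
        using eventually_gt_at_top[of 0]
      proof eventually_elim
        case (elim n)
        have "1 / real n + (1 - q) / q = (1 + (1 - q) / q * real n) / real n"
          "1 / real n + (1 - q) / q * (1 + 1 / real n) = (1 + (1 - q) / q * real (Suc n)) / real n"
          using elim by (auto simp: add_divide_distrib distrib_left)
        then show ?case
          using elim by simp
      qed
    qed
  qed
  moreover have "min 1 (\<eta> / q) = 1"
    using equal q by simp
  ultimately show ?thesis
    by (simp only: shift_critical[OF equal] slope_critical[OF equal])
next
  case greater
  have "(\<lambda>n. slope \<eta> q n + shift \<eta> q n) \<longlonglongrightarrow> 0 + (1 - q) / (\<eta> - q)"
    using greater by (intro tendsto_intros slope_tendsto_0 shift_tendsto_supercritical)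
  then show ?thesis
    using tendsto_ratio_Suc_scaled[of "\<lambda>n. slope \<eta> q n + shift \<eta> q n" 1] greater q
    by (simp add: min_def)
qed

lemma survival_geom_param_ratio:
  "(\<lambda>n. (survival_prob \<eta> q n * geom_param \<eta> q n) / (survival_prob \<eta> q (Suc n) * geom_param \<eta> q (Suc n)))
     \<longlonglongrightarrow> growth_rate \<eta> q"
proof -
  have "(\<lambda>n. \<eta> / q / ((slope \<eta> q n + shift \<eta> q n) / (slope \<eta> q (Suc n) + shift \<eta> q (Suc n)))\<^sup>2)
     \<longlonglongrightarrow> \<eta> / q / (min 1 (\<eta> / q))\<^sup>2"
    using eta q by (intro tendsto_intros slope_plus_shift_ratio) (auto simp: min_def)
  moreover have "\<eta> / q / (min 1 (\<eta> / q))\<^sup>2 = growth_rate \<eta> q"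
    using eta q by (auto simp: growth_rate_def min_def max_def field_simps power2_eq_square)
  moreover have "\<eta> / q / ((slope \<eta> q n + shift \<eta> q n) / (slope \<eta> q (Suc n) + shift \<eta> q (Suc n)))\<^sup>2 =
     (survival_prob \<eta> q n * geom_param \<eta> q n) / (survival_prob \<eta> q (Suc n) * geom_param \<eta> q (Suc n))" for n
  proof -
    have "\<eta> / q / (S / S')\<^sup>2 = (1 / S * (m / S)) / (1 / S' * (q / \<eta> * m / S'))"
      if "S > 0" "S' > 0" "m > 0" for S S' m
      using that eta q by (simp add: field_simps power2_eq_square)
    from this[of "slope \<eta> q n + shift \<eta> q n" "slope \<eta> q (Suc n) + shift \<eta> q (Suc n)" "slope \<eta> q n"]
    show ?thesis
      using slope_plus_shift_ge_1[OF eta q, of n] slope_plus_shift_ge_1[OF eta q, of "Suc n"] slope_pos[OF eta q, of n]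
      by (simp add: survival_prob_def geom_param_def slope_Suc[OF eta q])
  qed
  ultimately show ?thesis
    by simp
qed

lemma size_scale_ratio: "(\<lambda>n. size_scale \<eta> q n / size_scale \<eta> q (Suc n)) \<longlonglongrightarrow> growth_rate \<eta> q"
proof -
  have "(\<lambda>n. \<eta> / q / ((shift \<eta> q n / shift \<eta> q (Suc n)) * ((slope \<eta> q n + shift \<eta> q n) / (slope \<eta> q (Suc n) + shift \<eta> q (Suc n)))))
     \<longlonglongrightarrow> \<eta> / q / (min 1 (\<eta> / q) * min 1 (\<eta> / q))"
    using eta q by (intro tendsto_intros slope_plus_shift_ratio shift_ratio) (auto simp: min_def)
  moreover have "\<eta> / q / (min 1 (\<eta> / q) * min 1 (\<eta> / q)) = growth_rate \<eta> q"
    using eta q by (auto simp: growth_rate_def min_def max_def field_simps)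
  moreover have "\<eta> / q / ((shift \<eta> q n / shift \<eta> q (Suc n)) * ((slope \<eta> q n + shift \<eta> q n) / (slope \<eta> q (Suc n) + shift \<eta> q (Suc n)))) =
     size_scale \<eta> q n / size_scale \<eta> q (Suc n)" for n
    using eta q slope_pos[OF eta q, of n]
    by (simp add: size_scale_def slope_Suc[OF eta q])
  ultimately show ?thesis
    by simp
qed

text \<open>
For \<open>\<eta> \<le> q\<close> the shift is bounded below by a multiple of \<open>n\<close>; for \<open>\<eta> > q\<close> the slope tends to \<open>0\<close> and the shift
is a convergent geometric sum.
\<close>

lemma survival_prob_tendsto: "(\<lambda>n. 1 - survival_prob \<eta> q n) \<longlonglongrightarrow> ext_prob \<eta> q"
proof (cases "\<eta> \<le> q")
  case True
  have "filterlim (\<lambda>n. slope \<eta> q n + shift \<eta> q n) at_top sequentially"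
  proof (rule filterlim_at_top_mono)
    show "filterlim (\<lambda>n. (1 - q) / \<eta> * real n) at_top sequentially"
      using eta q filterlim_real_sequentially
      by (intro filterlim_tendsto_pos_mult_at_top[OF tendsto_const]) auto
    show "eventually (\<lambda>n. (1 - q) / \<eta> * real n \<le> slope \<eta> q n + shift \<eta> q n) sequentially"
    proof (intro always_eventually allI)
      fix n
      have "(\<Sum>j<n. 1) \<le> (\<Sum>j<n. (q / \<eta>) ^ j)"
        using True eta by (intro sum_mono one_le_power) simp
      then have "(1 - q) / \<eta> * real n \<le> shift \<eta> q n"
        unfolding shift_def using eta q by (intro mult_left_mono) auto
      then show "(1 - q) / \<eta> * real n \<le> slope \<eta> q n + shift \<eta> q n"
        using slope_pos[OF eta q, of n] by linarith
    qed
  qed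
  then have "(\<lambda>n. 1 / (slope \<eta> q n + shift \<eta> q n)) \<longlonglongrightarrow> 0"
    by (intro tendsto_divide_0[OF tendsto_const] filterlim_at_top_imp_at_infinity)
  then have "(\<lambda>n. 1 - survival_prob \<eta> q n) \<longlonglongrightarrow> 1 - 0"
    unfolding survival_prob_def by (intro tendsto_intros)
  then show ?thesis
    using True q by (simp add: ext_prob_def max_def)
next
  case False
  then have "(\<lambda>n. 1 - survival_prob \<eta> q n) \<longlonglongrightarrow> 1 - 1 / (0 + (1 - q) / (\<eta> - q))"
    unfolding survival_prob_def using q
    by (intro tendsto_intros slope_tendsto_0 shift_tendsto_supercritical) auto
  also have "1 - 1 / (0 + (1 - q) / (\<eta> - q)) = ext_prob \<eta> q"
    using False q by (simp add: ext_prob_def max_def field_simps)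
  finally show ?thesis .
qed

lemma size_scale_tendsto_0: "size_scale \<eta> q \<longlonglongrightarrow> 0"
proof -
  have x: "size_scale \<eta> q n = slope \<eta> q n / shift \<eta> q n * (1 - (1 - survival_prob \<eta> q n))" for n
    by (simp add: size_scale_def survival_prob_def)
  have "\<exists>l. (\<lambda>n. slope \<eta> q n / shift \<eta> q n) \<longlonglongrightarrow> l \<and> l * (1 - ext_prob \<eta> q) = 0"
  proof (cases \<eta> q rule: linorder_cases)
    case less
    have "(\<lambda>n. 1 / (shift \<eta> q n * (\<eta> / q) ^ n)) \<longlonglongrightarrow> 1 / ((1 - q) / (q - \<eta>))"
      using less q by (intro tendsto_intros shift_scaled_subcritical) auto
    moreover have "1 / (shift \<eta> q n * (\<eta> / q) ^ n) = slope \<eta> q n / shift \<eta> q n" for n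
      by (simp add: slope_def power_divide)
    ultimately show ?thesis
      using less q by (auto simp: ext_prob_def)
  next
    case equal
    have "(\<lambda>n. 1 / ((1 - q) / q) * (1 / real n)) \<longlonglongrightarrow> 1 / ((1 - q) / q) * 0"
      by (intro tendsto_intros lim_1_over_n)
    then have "(\<lambda>n. slope \<eta> q n / shift \<eta> q n) \<longlonglongrightarrow> 0"
      unfolding shift_critical[OF equal] slope_critical[OF equal] by simp
    then show ?thesis
      by auto
  next
    case greater
    have "(\<lambda>n. slope \<eta> q n / shift \<eta> q n) \<longlonglongrightarrow> 0 / ((1 - q) / (\<eta> - q))"
      using greater q by (intro tendsto_intros slope_tendsto_0 shift_tendsto_supercritical) auto
    then show ?thesis
      by auto
  qed
  then obtain l where l: "(\<lambda>n. slope \<eta> q n / shift \<eta> q n) \<longlonglongrightarrow> l" "l * (1 - ext_prob \<eta> q) = 0"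
    by blast
  have "(\<lambda>n. slope \<eta> q n / shift \<eta> q n * (1 - (1 - survival_prob \<eta> q n))) \<longlonglongrightarrow> l * (1 - ext_prob \<eta> q)"
    by (intro tendsto_mult[OF l(1)] tendsto_diff tendsto_const survival_prob_tendsto)
  then show ?thesis
    unfolding l(2) x[symmetric] .
qed

text \<open>
In each regime, \<open>size_scale\<close> is asymptotically a constant times the normalisation of \<open>a\<^sub>n\<close> in the hypothesis,
that is, times \<open>\<mu>\<^sup>n\<close>, \<open>1 / n\<^sup>2\<close> and \<open>1 / \<mu>\<^sup>n\<close> respectively.
\<close>

lemma normalised_size_tendsto:
  assumes "\<eta> < q \<Longrightarrow> (\<lambda>n. real (a n) * (\<eta> / q) ^ n) \<longlonglongrightarrow> \<theta>"
    and "\<eta> = q \<Longrightarrow> (\<lambda>n. real (a n) / real n ^ 2) \<longlonglongrightarrow> \<theta>"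
    and "\<eta> > q \<Longrightarrow> (\<lambda>n. real (a n) / (\<eta> / q) ^ n) \<longlonglongrightarrow> \<theta>"
  shows "(\<lambda>n. real (a n) * size_scale \<eta> q n) \<longlonglongrightarrow> s_intensity \<eta> q \<theta>"
proof (cases \<eta> q rule: linorder_cases)
  case less
  let ?m = "\<eta> / q"
  have "(\<lambda>n. (real (a n) * ?m ^ n) / ((shift \<eta> q n * ?m ^ n) * (1 + shift \<eta> q n * ?m ^ n))) \<longlonglongrightarrow>
      \<theta> / ((1 - q) / (q - \<eta>) * (1 + (1 - q) / (q - \<eta>)))"
    using less q by (intro tendsto_intros assms(1) shift_scaled_subcritical) (auto simp: add_divide_eq_iff)
  moreover have "\<theta> / ((1 - q) / (q - \<eta>) * (1 + (1 - q) / (q - \<eta>))) = s_intensity \<eta> q \<theta>"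
  proof -
    have "1 + (1 - q) / (q - \<eta>) = (1 - \<eta>) / (q - \<eta>)"
      using less by (simp add: field_simps)
    moreover have "s_intensity \<eta> q \<theta> = \<theta> * ((q - \<eta>)\<^sup>2 / (q * (1 - \<eta>))) * q / (1 - q)"
      using less by (simp add: s_intensity_def zeta_base_def power2_commute[of q])
    ultimately show ?thesis
      using less eta q by (simp add: power2_eq_square)
  qed
  moreover have "(real (a n) * ?m ^ n) / ((shift \<eta> q n * ?m ^ n) * (1 + shift \<eta> q n * ?m ^ n)) =
      real (a n) * size_scale \<eta> q n" for n
  proof -
    have *: "y * m / ((N * m) * (1 + N * m)) = y * (M / (N * (M + N)))"
      if "M * m = 1" "m > 0" "M > 0" for y m N M :: real
    proof -
      have "(N * m) * (1 + N * m) = N * m * (m * (M + N))"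
        using that(1) by (simp add: algebra_simps)
      then have "y * m / ((N * m) * (1 + N * m)) = y * m / (N * m * (m * (M + N)))"
        by (simp only:)
      also have "\<dots> = y * (1 / m) / (N * (M + N))"
        using that(2) by simp
      also have "1 / m = M"
        using that by (simp add: field_simps)
      finally show ?thesis
        by simp
    qed
    show ?thesis
      unfolding size_scale_def using slope_scaled[of n] slope_pos[OF eta q, of n] eta q by (intro *) auto
  qed
  ultimately show ?thesis
    by simp
next
  case equal
  have "(\<lambda>n. (real (a n) / real n ^ 2) / ((1 - q) / q * (1 / real n + (1 - q) / q))) \<longlonglongrightarrow>
      \<theta> / ((1 - q) / q * (0 + (1 - q) / q))"
    using q by (intro tendsto_intros assms(2) equal lim_1_over_n) auto
  also have "\<theta> / ((1 - q) / q * (0 + (1 - q) / q)) = s_intensity \<eta> q \<theta>"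
    using equal by (simp add: s_intensity_def zeta_base_def)
  finally show ?thesis
  proof (rule Lim_transform_eventually)
    show "eventually (\<lambda>n. (real (a n) / real n ^ 2) / ((1 - q) / q * (1 / real n + (1 - q) / q)) =
        real (a n) * size_scale \<eta> q n) sequentially"
      using eventually_gt_at_top[of 0]
    proof eventually_elim
      case (elim n)
      have *: "y / m ^ 2 / (c * (1 / m + c)) = y * (1 / (c * m * (1 + c * m)))" if "m > 0" for y c m :: real
      proof -
        have "1 / m + c = (1 + c * m) / m"
          using that by (simp add: field_simps)
        then show ?thesis
          using that by (simp add: power2_eq_square)
      qed
      show ?case
        unfolding size_scale_def shift_critical[OF equal] slope_critical[OF equal]
        using elim by (intro *) simp
    qed
  qed
next
  case greater
  let ?m = "\<eta> / q"
  have "(\<lambda>n. (real (a n) / ?m ^ n) / (shift \<eta> q n * (slope \<eta> q n + shift \<eta> q n))) \<longlonglongrightarrow>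
      \<theta> / ((1 - q) / (\<eta> - q) * (0 + (1 - q) / (\<eta> - q)))"
    using greater q by (intro tendsto_intros assms(3) shift_tendsto_supercritical slope_tendsto_0) auto
  moreover have "\<theta> / ((1 - q) / (\<eta> - q) * (0 + (1 - q) / (\<eta> - q))) = s_intensity \<eta> q \<theta>"
    using greater eta q by (simp add: s_intensity_def zeta_base_def power2_eq_square min_def max_def)
  moreover have "(real (a n) / ?m ^ n) / (shift \<eta> q n * (slope \<eta> q n + shift \<eta> q n)) = real (a n) * size_scale \<eta> q n" for n
    unfolding size_scale_def by (simp add: slope_def power_divide)
  ultimately show ?thesis
    by simp
qed

end

section \<open>Limits of the conditioned cylinder probabilities\<close>

context
  fixes \<eta> q \<theta> :: real and a :: "nat \<Rightarrow> nat"
  assumes eta: "0 < \<eta>" "\<eta> \<le> 1" and q: "0 < q" "q < 1" and theta: "0 < \<theta>"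
    and a_x: "(\<lambda>n. real (a n) * size_scale \<eta> q n) \<longlonglongrightarrow> s_intensity \<eta> q \<theta>"
begin

lemma conditioned_size_at_top: "filterlim a at_top sequentially"
proof -
  have "filterlim (\<lambda>n. inverse (size_scale \<eta> q n)) at_top sequentially"
    using size_scale_pos[OF eta q]
    by (intro filterlim_inverse_at_top[OF size_scale_tendsto_0[OF eta q]])
       (auto intro: eventually_mono[OF eventually_gt_at_top[of 0]])
  then have "filterlim (\<lambda>n. real (a n) * size_scale \<eta> q n * inverse (size_scale \<eta> q n)) at_top sequentially"
    by (rule filterlim_tendsto_pos_mult_at_top[OF a_x s_intensity_pos[OF eta q theta]])
  then have *: "filterlim (\<lambda>n. real (a n)) at_top sequentially"
  proof (rule filterlim_cong[THEN iffD1, OF refl refl, rotated])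
    show "eventually (\<lambda>n. real (a n) * size_scale \<eta> q n * inverse (size_scale \<eta> q n) = real (a n)) sequentially"
      using eventually_gt_at_top[of 0]
    proof eventually_elim
      case (elim n)
      then show ?case
        using size_scale_pos[OF eta q, of n] by simp
    qed
  qed
  show ?thesis
    unfolding filterlim_at_top
  proof
    fix Z
    show "eventually (\<lambda>n. Z \<le> a n) sequentially"
      using *[unfolded filterlim_at_top, rule_format, of "real Z"] by simp
  qed
qed

lemma conditioned_size_shifted: "(\<lambda>n. real (a n) * size_scale \<eta> q (n - h)) \<longlonglongrightarrow> s_intensity \<eta> q \<theta> * growth_rate \<eta> q ^ h"
proof -
  have "(\<lambda>n. real (a n) * size_scale \<eta> q n * (size_scale \<eta> q (n - h) / size_scale \<eta> q n)) \<longlonglongrightarrow> s_intensity \<eta> q \<theta> * growth_rate \<eta> q ^ h"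
    by (intro tendsto_mult[OF a_x] tendsto_ratio_shift[OF size_scale_ratio[OF eta q]] size_scale_pos[OF eta q])
  moreover have "eventually (\<lambda>n. real (a n) * size_scale \<eta> q n * (size_scale \<eta> q (n - h) / size_scale \<eta> q n) =
      real (a n) * size_scale \<eta> q (n - h)) sequentially"
    using eventually_gt_at_top[of 0]
  proof eventually_elim
    case (elim n)
    then show ?case
      using size_scale_pos[OF eta q, of n] by simp
  qed
  ultimately show ?thesis
    by (rule Lim_transform_eventually)
qed

lemma size_scale_shifted: "(\<lambda>n. size_scale \<eta> q (n - h)) \<longlonglongrightarrow> 0"
  using size_scale_tendsto_0[OF eta q] by (rule filterlim_compose) (rule filterlim_minus_const_nat_at_top)

text \<open>
The ratio is a product of \<open>h\<close> ratios for consecutive indices. Each of them has the form \<open>1 - y\<close> with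
\<open>a\<^sub>n y\<close> converging to the corresponding Poisson rate \<open>\<theta> \<zeta>\<^sub>h\<close>.
\<close>

lemma geom_param_ratio_power:
  "(\<lambda>n. ((1 - geom_param \<eta> q (n - h)) / (1 - geom_param \<eta> q n)) ^ (a n - 1)) \<longlonglongrightarrow>
     exp (- (\<Sum>l<h. \<theta> * zeta \<eta> q l))"
proof (induction h)
  case 0
  have "eventually (\<lambda>n. 1 = ((1 - geom_param \<eta> q (n - 0)) / (1 - geom_param \<eta> q n)) ^ (a n - 1)) sequentially"
    using eventually_gt_at_top[of 0]
  proof eventually_elim
    case (elim n)
    then show ?case
      using geom_param_less_1[OF eta q, of n] by simp
  qed
  then show ?case
    by (intro Lim_transform_eventually[OF tendsto_const]) auto
next
  case (Suc h)
  define y where "y n = (1 - q) / \<eta> * (shift \<eta> q n / shift \<eta> q (Suc n)) * size_scale \<eta> q n" for n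
  have sub: "filterlim (\<lambda>n. n - Suc h) sequentially sequentially"
    by (rule filterlim_minus_const_nat_at_top)
  have N: "(\<lambda>n. shift \<eta> q (n - Suc h) / shift \<eta> q (Suc (n - Suc h))) \<longlonglongrightarrow> min 1 (\<eta> / q)"
    by (rule filterlim_compose[OF shift_ratio[OF eta q] sub])
  \<comment> \<open>The power is \<open>a n - 1\<close> rather than \<open>a n\<close>; the difference \<open>y\<close> vanishes in the limit.\<close>
  have "(\<lambda>n. y (n - Suc h)) \<longlonglongrightarrow> (1 - q) / \<eta> * min 1 (\<eta> / q) * 0"
    unfolding y_def by (intro tendsto_mult N tendsto_const size_scale_shifted)
  then have y0: "(\<lambda>n. y (n - Suc h)) \<longlonglongrightarrow> 0"
    by simp
  have "(\<lambda>n. (1 - q) / \<eta> * (shift \<eta> q (n - Suc h) / shift \<eta> q (Suc (n - Suc h))) * (real (a n) * size_scale \<eta> q (n - Suc h))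
      - y (n - Suc h)) \<longlonglongrightarrow> (1 - q) / \<eta> * min 1 (\<eta> / q) * (s_intensity \<eta> q \<theta> * growth_rate \<eta> q ^ Suc h) - 0"
    by (intro tendsto_diff tendsto_mult N tendsto_const conditioned_size_shifted y0)
  moreover have "eventually (\<lambda>n. (1 - q) / \<eta> * (shift \<eta> q (n - Suc h) / shift \<eta> q (Suc (n - Suc h))) *
      (real (a n) * size_scale \<eta> q (n - Suc h)) - y (n - Suc h) = real (a n - 1) * y (n - Suc h)) sequentially"
    using conditioned_size_at_top[unfolded filterlim_at_top, rule_format, of 1]
  proof eventually_elim
    case (elim n)
    have "c * (r * x) - c * x = (r - 1) * (c * x)" for c r x :: real
      by (simp add: algebra_simps)
    then show ?case
      unfolding y_def of_nat_diff[OF elim] of_nat_1 .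
  qed
  moreover have "(1 - q) / \<eta> * min 1 (\<eta> / q) * (s_intensity \<eta> q \<theta> * growth_rate \<eta> q ^ Suc h) - 0 = \<theta> * zeta \<eta> q h"
  proof -
    have "(1 - q) / \<eta> * min 1 (\<eta> / q) * (max q \<eta> / (1 - q)) = 1"
      using eta q by (auto simp: min_def max_def field_simps)
    then have "\<theta> * zeta_base \<eta> q * growth_rate \<eta> q ^ Suc h * ((1 - q) / \<eta> * min 1 (\<eta> / q) * (max q \<eta> / (1 - q))) =
        \<theta> * zeta \<eta> q h"
      by (simp only: zeta_eq[OF eta q] mult_ac mult_1_left)
    moreover have "(1 - q) / \<eta> * min 1 (\<eta> / q) * (s_intensity \<eta> q \<theta> * growth_rate \<eta> q ^ Suc h) =
        \<theta> * zeta_base \<eta> q * growth_rate \<eta> q ^ Suc h * ((1 - q) / \<eta> * min 1 (\<eta> / q) * (max q \<eta> / (1 - q)))"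
      unfolding s_intensity_def times_divide_eq_right[symmetric] by (simp only: mult_ac)
    ultimately show ?thesis
      by (simp only: diff_zero)
  qed
  ultimately have ay: "(\<lambda>n. real (a n - 1) * y (n - Suc h)) \<longlonglongrightarrow> \<theta> * zeta \<eta> q h"
    by (simp only:) (rule Lim_transform_eventually)
  have "eventually (\<lambda>n. 0 \<le> y (n - Suc h)) sequentially"
    using eventually_gt_at_top[of "Suc h"]
  proof eventually_elim
    case (elim n)
    then show ?case
      using size_scale_pos[OF eta q, of "n - Suc h"] shift_nonneg[OF eta q] eta q by (simp add: y_def)
  qed
  then have "(\<lambda>n. (1 - y (n - Suc h)) ^ (a n - 1)) \<longlonglongrightarrow> exp (- (\<theta> * zeta \<eta> q h))"
    by (rule tendsto_one_minus_power[OF y0 _ ay])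
  then have "(\<lambda>n. (1 - y (n - Suc h)) ^ (a n - 1) * ((1 - geom_param \<eta> q (n - h)) / (1 - geom_param \<eta> q n)) ^ (a n - 1))
      \<longlonglongrightarrow> exp (- (\<theta> * zeta \<eta> q h)) * exp (- (\<Sum>l<h. \<theta> * zeta \<eta> q l))"
    using Suc by (rule tendsto_mult)
  also have "exp (- (\<theta> * zeta \<eta> q h)) * exp (- (\<Sum>l<h. \<theta> * zeta \<eta> q l)) = exp (- (\<Sum>l<Suc h. \<theta> * zeta \<eta> q l))"
    by (simp add: exp_add[symmetric])
  finally have "(\<lambda>n. (1 - y (n - Suc h)) ^ (a n - 1) * ((1 - geom_param \<eta> q (n - h)) / (1 - geom_param \<eta> q n)) ^ (a n - 1))
      \<longlonglongrightarrow> exp (- (\<Sum>l<Suc h. \<theta> * zeta \<eta> q l))" .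
  moreover have "eventually (\<lambda>n. (1 - y (n - Suc h)) ^ (a n - 1) * ((1 - geom_param \<eta> q (n - h)) / (1 - geom_param \<eta> q n)) ^ (a n - 1) =
     ((1 - geom_param \<eta> q (n - Suc h)) / (1 - geom_param \<eta> q n)) ^ (a n - 1)) sequentially"
    using eventually_gt_at_top[of "Suc h"]
  proof eventually_elim
    case (elim n)
    then have n: "n - Suc h > 0" "Suc (n - Suc h) = n - h" "n - h > 0"
      by auto
    have "1 - y (n - Suc h) = (1 - geom_param \<eta> q (n - Suc h)) / (1 - geom_param \<eta> q (n - h))"
      using geom_param_ratio[OF eta q n(1)] by (simp add: y_def n(2))
    then show ?case
      using geom_param_less_1[OF eta q n(3)] by (simp add: power_mult_distrib[symmetric])
  qed
  ultimately show ?case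
    by (rule Lim_transform_eventually)
qed

text \<open>
The term for \<open>m\<close> surviving individuals factorises into a ratio of \<open>\<alpha> \<beta>\<close>, a binomial coefficient times a
power of \<open>size_scale\<close>, a power of a ratio of \<open>1 - \<beta>\<close>, and the probability that the other individuals
have no descendants. These converge separately, and the limits make up \<open>s_weight\<close> and \<open>ext_prob\<close>.
\<close>

lemma conditional_probability_tendsto:
  assumes a_pos: "\<And>n. n \<ge> 1 \<Longrightarrow> a n \<ge> 1"
  shows "(\<lambda>n. pmf (zero_modified_geometric_sum (survival_prob \<eta> q (n - h)) (geom_param \<eta> q (n - h)) z) (a n) /
      pmf (zero_modified_geometric_sum (survival_prob \<eta> q n) (geom_param \<eta> q n) 1) (a n)) \<longlonglongrightarrow>
    (\<Sum>m\<in>{1..z}. real (z choose m) * (s_weight \<eta> q \<theta> h m * ext_prob \<eta> q ^ (z - m)))"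
proof -
  let ?A = "survival_prob \<eta> q" and ?B = "geom_param \<eta> q" and ?x = "size_scale \<eta> q"
  note AB = survival_prob_pos[OF eta q] survival_prob_le_1[OF eta q] geom_param_pos[OF eta q] geom_param_le_1[OF eta q]
  have sub: "filterlim (\<lambda>n. n - h) sequentially sequentially"
    by (rule filterlim_minus_const_nat_at_top)
  have AB_ratio: "(\<lambda>n. ?A (n - h) * ?B (n - h) / (?A n * ?B n)) \<longlonglongrightarrow> growth_rate \<eta> q ^ h"
    using tendsto_ratio_shift[OF survival_geom_param_ratio[OF eta q], of h] AB by simp
  have "(\<lambda>n. \<Sum>m\<in>{1..z}. real (z choose m) * (((?A (n - h) * ?B (n - h) / (?A n * ?B n)) *
       (real ((a n - 1) choose (m - 1)) * ?x (n - h) ^ (m - 1)) *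
       ((1 - ?B (n - h)) / (1 - ?B n)) ^ (a n - 1)) * (1 - ?A (n - h)) ^ (z - m))) \<longlonglongrightarrow>
    (\<Sum>m\<in>{1..z}. real (z choose m) * ((growth_rate \<eta> q ^ h *
       ((s_intensity \<eta> q \<theta> * growth_rate \<eta> q ^ h) ^ (m - 1) / fact (m - 1)) *
       exp (- (\<Sum>l<h. \<theta> * zeta \<eta> q l))) * ext_prob \<eta> q ^ (z - m)))"
    by (intro tendsto_sum tendsto_mult tendsto_const AB_ratio geom_param_ratio_power
        tendsto_binomial_mult_power size_scale_shifted conditioned_size_at_top conditioned_size_shifted
        tendsto_power filterlim_compose[OF survival_prob_tendsto[OF eta q] sub])
  also have "(\<Sum>m\<in>{1..z}. real (z choose m) * ((growth_rate \<eta> q ^ h *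
       ((s_intensity \<eta> q \<theta> * growth_rate \<eta> q ^ h) ^ (m - 1) / fact (m - 1)) *
       exp (- (\<Sum>l<h. \<theta> * zeta \<eta> q l))) * ext_prob \<eta> q ^ (z - m))) =
    (\<Sum>m\<in>{1..z}. real (z choose m) * (s_weight \<eta> q \<theta> h m * ext_prob \<eta> q ^ (z - m)))"
    by (intro sum.cong refl) (simp add: s_weight_def)
  finally show ?thesis
  proof (rule Lim_transform_eventually)
    show "eventually (\<lambda>n. (\<Sum>m\<in>{1..z}. real (z choose m) * (((?A (n - h) * ?B (n - h) / (?A n * ?B n)) *
         (real ((a n - 1) choose (m - 1)) * ?x (n - h) ^ (m - 1)) *
         ((1 - ?B (n - h)) / (1 - ?B n)) ^ (a n - 1)) * (1 - ?A (n - h)) ^ (z - m))) =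
       pmf (zero_modified_geometric_sum (?A (n - h)) (?B (n - h)) z) (a n) /
       pmf (zero_modified_geometric_sum (?A n) (?B n) 1) (a n)) sequentially"
      using eventually_gt_at_top[of h] conditioned_size_at_top[unfolded filterlim_at_top, rule_format, of "Suc z"]
    proof eventually_elim
      case (elim n)
      then have n: "n - h > 0" "n > 0" "a n \<ge> 1"
        by auto
      have B: "1 - ?B (n - h) > 0" "1 - ?B n > 0"
        using geom_param_less_1[OF eta q n(1)] geom_param_less_1[OF eta q n(2)] by auto
      have one: "pmf (zero_modified_geometric_sum (?A n) (?B n) 1) (a n) = ?A n * ?B n * (1 - ?B n) ^ (a n - 1)"
        using AB[of n] n(3) by (subst pmf_zero_modified_geometric_sum) auto
      have summand: "real (z choose m) * ?A (n - h) ^ m * (1 - ?A (n - h)) ^ (z - m) *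
           (real ((a n - 1) choose (m - 1)) * ?B (n - h) ^ m * (1 - ?B (n - h)) ^ (a n - m)) /
           (?A n * ?B n * (1 - ?B n) ^ (a n - 1)) =
         real (z choose m) * (((?A (n - h) * ?B (n - h) / (?A n * ?B n)) *
           (real ((a n - 1) choose (m - 1)) * ?x (n - h) ^ (m - 1)) *
           ((1 - ?B (n - h)) / (1 - ?B n)) ^ (a n - 1)) * (1 - ?A (n - h)) ^ (z - m))"
        if m: "m \<in> {1..z}" for m
      proof -
        obtain j where j: "m = Suc j"
          using m by (cases m) auto
        obtain d where d: "a n = m + d"
          using m elim(2) by (metis Suc_leD atLeastAtMost_iff le_Suc_ex le_trans)
        have "?x (n - h) ^ j * (1 - ?B (n - h)) ^ (j + d) = (?A (n - h) * ?B (n - h)) ^ j * (1 - ?B (n - h)) ^ d"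
          using B(1) by (simp add: size_scale_eq[OF eta q n(1)] power_divide power_add)
        then have "?A (n - h) ^ m * ?B (n - h) ^ m * (1 - ?B (n - h)) ^ d =
            (?A (n - h) * ?B (n - h)) * (?x (n - h) ^ j * (1 - ?B (n - h)) ^ (j + d))"
          by (simp add: j power_mult_distrib mult_ac)
        moreover have "?A k \<noteq> 0" "?B k \<noteq> 0" for k
          using AB[of k] by auto
        ultimately show ?thesis
          using B by (simp add: j d power_divide mult_ac)
      qed
      have "pmf (zero_modified_geometric_sum (?A (n - h)) (?B (n - h)) z) (a n) =
          (\<Sum>m\<in>{1..z}. real (z choose m) * ?A (n - h) ^ m * (1 - ?A (n - h)) ^ (z - m) *
           (real ((a n - 1) choose (m - 1)) * ?B (n - h) ^ m * (1 - ?B (n - h)) ^ (a n - m)))"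
        using AB[of "n - h"] n(3) elim(2)
        by (subst pmf_zero_modified_geometric_sum) (auto intro!: sum.cong)
      then show ?case
        unfolding one by (simp only: sum_divide_distrib) (intro sum.cong refl summand[symmetric])
    qed
  qed
qed

end

section \<open>Convergence of the conditioned trees\<close>

theorem proposition5p3:
  fixes \<eta> q \<theta> \<mu> :: real
    and a :: "nat \<Rightarrow> nat"
    and M :: "'a measure" and \<tau> :: "'a \<Rightarrow> word set"
    and N :: "nat \<Rightarrow> 'b measure" and \<tau>_cond :: "nat \<Rightarrow> 'b \<Rightarrow> word set"
    and M_theta :: "'c measure" and \<tau>_theta :: "'c \<Rightarrow> word set"
  assumes "0 < \<eta>" "\<eta> \<le> 1" and "0 < q" "q < 1" and "0 < \<theta>"
    and "\<mu> = \<eta> / q"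
    and "\<And>n. n \<ge> 1 \<Longrightarrow> a n \<ge> 1"
    and "galton_watson (geom_offspring \<eta> q) M \<tau>"
    and "\<And>n. n \<ge> 1 \<Longrightarrow> random_tree (N n) (\<tau>_cond n)"
    and "\<And>n. n \<ge> 1 \<Longrightarrow> distr (N n) tree_borel (\<tau>_cond n) =
           distr (uniform_measure M {\<omega>\<in>space M. generation_size n (\<tau> \<omega>) = a n}) tree_borel \<tau>"
    and "theta_tree \<eta> q \<theta> M_theta \<tau>_theta"
    and "\<mu> < 1 \<Longrightarrow> (\<lambda>n. real (a n) * \<mu> ^ n) \<longlonglongrightarrow> \<theta>"
    and "\<mu> = 1 \<Longrightarrow> (\<lambda>n. real (a n) / real n ^ 2) \<longlonglongrightarrow> \<theta>"
    and "\<mu> > 1 \<Longrightarrow> (\<lambda>n. real (a n) / \<mu> ^ n) \<longlonglongrightarrow> \<theta>"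
  shows "converges_in_distribution N \<tau>_cond M_theta \<tau>_theta"
proof -
  note par = assms(1-4)
  note gw = assms(8)
  let ?p = "geom_offspring \<eta> q"
  let ?Z = "\<lambda>h n. zero_modified_geometric_sum (survival_prob \<eta> q (n - h)) (geom_param \<eta> q (n - h))"
  interpret M: prob_space M
    using gw by (simp add: galton_watson_def random_tree_def)
  have \<tau>: "\<tau> \<in> M \<rightarrow>\<^sub>M tree_borel"
    using gw by (simp add: galton_watson_def random_tree_def)
  have \<tau>_tree: "\<tau> \<omega> \<in> all_trees" if "\<omega> \<in> space M" for \<omega>
    using measurable_space[OF \<tau> that] by simp
  have a_x: "(\<lambda>n. real (a n) * size_scale \<eta> q n) \<longlonglongrightarrow> s_intensity \<eta> q \<theta>"
    using assms(12-14) assms(6) par by (intro normalised_size_tendsto) auto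
  \<comment> \<open>At height \<open>0\<close> every truncation is the root, so the branching property gives the law of \<open>Z\<^sub>n\<close> itself.\<close>
  have size: "measure M {\<omega>\<in>space M. generation_size n (\<tau> \<omega>) = a n} = pmf (?Z 0 n 1) (a n)"
    if "n \<ge> 1" for n
  proof -
    have "card (level 0 {[]}) = 1"
      by (auto simp: level_def)
    then have "measure M {\<omega>\<in>space M. restrict_height 0 (\<tau> \<omega>) = {[]} \<and> generation_size n (\<tau> \<omega>) = a n} = pmf (?Z 0 n 1) (a n)"
      using galton_watson_cylinder_and_size[OF par gw root_in_trees_upto_0 that, of "a n"]
      by (simp add: gw_weight_def)
    moreover have "{\<omega>\<in>space M. restrict_height 0 (\<tau> \<omega>) = {[]} \<and> generation_size n (\<tau> \<omega>) = a n} =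
        {\<omega>\<in>space M. generation_size n (\<tau> \<omega>) = a n}"
      using restrict_height_0 \<tau>_tree by auto
    ultimately show ?thesis
      by simp
  qed
  have size_pos: "pmf (?Z 0 n 1) (a n) > 0" if "n \<ge> 1" for n
    using survival_prob_pos[OF par, of n] survival_prob_le_1[OF par, of n] geom_param_pos[OF par, of n]
      geom_param_less_1[OF par, of n] assms(7)[OF that] that
    by (subst pmf_zero_modified_geometric_sum) auto
  have cyl: "measure (N n) {\<omega>\<in>space (N n). restrict_height h (\<tau>_cond n \<omega>) = t} =
      gw_weight ?p h t * (pmf (?Z h n (card (level h t))) (a n) / pmf (?Z 0 n 1) (a n))"
    if t: "t \<in> trees_upto h" and n: "n \<ge> 1" "h \<le> n" for h t n
  proof -
    let ?E = "{\<omega>\<in>space M. generation_size n (\<tau> \<omega>) = a n}"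
    let ?C = "{t' \<in> all_trees. restrict_height h t' = t}"
    have \<tau>n: "\<tau>_cond n \<in> N n \<rightarrow>\<^sub>M tree_borel"
      using assms(9)[OF n(1)] by (simp add: random_tree_def)
    have preim: "X -` ?C \<inter> space P = {\<omega>\<in>space P. restrict_height h (X \<omega>) = t}"
      if "X \<in> P \<rightarrow>\<^sub>M tree_borel" for X and P :: "'x measure"
      using measurable_space[OF that] by auto
    have E: "measure M ?E > 0"
      using size[OF n(1)] size_pos[OF n(1)] by simp
    have \<tau>': "\<tau> \<in> uniform_measure M ?E \<rightarrow>\<^sub>M tree_borel"
      using \<tau> by (simp cong: measurable_cong_sets)
    have "measure (N n) {\<omega>\<in>space (N n). restrict_height h (\<tau>_cond n \<omega>) = t} = measure (distr (N n) tree_borel (\<tau>_cond n)) ?C"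
      by (simp only: measure_distr[OF \<tau>n sets_cylinder] preim[OF \<tau>n])
    also have "\<dots> = measure (uniform_measure M ?E) {\<omega>\<in>space M. restrict_height h (\<tau> \<omega>) = t}"
      unfolding assms(10)[OF n(1)] measure_distr[OF \<tau>' sets_cylinder] preim[OF \<tau>'] by simp
    also have "\<dots> = measure M (?E \<inter> {\<omega>\<in>space M. restrict_height h (\<tau> \<omega>) = t}) / measure M ?E"
      using E sets_restrict_height_tree_eq[OF \<tau>]
      by (intro measure_uniform_measure) (auto simp: M.emeasure_eq_measure)
    also have "?E \<inter> {\<omega>\<in>space M. restrict_height h (\<tau> \<omega>) = t} =
        {\<omega>\<in>space M. restrict_height h (\<tau> \<omega>) = t \<and> generation_size n (\<tau> \<omega>) = a n}"
      by auto
    finally show ?thesis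
      using galton_watson_cylinder_and_size[OF par gw t n, of "a n"] size[OF n(1)] by simp
  qed
  show ?thesis
  proof (rule converges_in_distributionI_cylinders)
    fix h t and e :: real
    assume t: "t \<in> fst ` set_pmf (typed_tree_law \<eta> q \<theta> h)" and e: "e > 0"
    have tt: "t \<in> trees_upto h"
      using t set_typed_tree_law[OF par assms(5)] by (force simp: valid_typed_tree_def)
    let ?lim = "gw_weight ?p h t * (\<Sum>m\<in>{1..card (level h t)}. real (card (level h t) choose m) *
      (s_weight \<eta> q \<theta> h m * ext_prob \<eta> q ^ (card (level h t) - m)))"
    have "(\<lambda>n. gw_weight ?p h t * (pmf (?Z h n (card (level h t))) (a n) / pmf (?Z 0 n 1) (a n))) \<longlonglongrightarrow> ?lim"
      using conditional_probability_tendsto[OF par assms(5) a_x assms(7), of h "card (level h t)"]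
      by (intro tendsto_mult tendsto_const) simp
    moreover have "?lim > measure M_theta {\<omega>\<in>space M_theta. restrict_height h (\<tau>_theta \<omega>) = t} - e"
      using theta_tree_cylinder_le[OF par assms(5) assms(11) t] e by linarith
    ultimately have "eventually (\<lambda>n. gw_weight ?p h t * (pmf (?Z h n (card (level h t))) (a n) / pmf (?Z 0 n 1) (a n)) >
        measure M_theta {\<omega>\<in>space M_theta. restrict_height h (\<tau>_theta \<omega>) = t} - e) sequentially"
      by (rule order_tendstoD)
    then show "eventually (\<lambda>n. measure M_theta {\<omega>\<in>space M_theta. restrict_height h (\<tau>_theta \<omega>) = t} - e \<le>
        measure (N n) {\<omega>\<in>space (N n). restrict_height h (\<tau>_cond n \<omega>) = t}) sequentially"
      using eventually_ge_at_top[of 1] eventually_ge_at_top[of h]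
      by eventually_elim (simp only: cyl[OF tt] less_imp_le)
  next
    show "fst ` set_pmf (typed_tree_law \<eta> q \<theta> h) \<subseteq> all_trees" for h
      using set_typed_tree_law[OF par assms(5)] by (force simp: valid_typed_tree_def trees_upto_def)
  qed (use assms(9,11) theta_tree_support[OF par assms(5,11)] in \<open>auto simp: theta_tree_def\<close>)
qed

end
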